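(* Let $G$ be a connected subcubic graph with $m(G)$ edges that is not isomorphic to $K_4^+$ and not isomorphic to $K_{3,3}$. Then $\nu_{ac}(G) \geq m(G)/6$.
   Context: All graphs are finite, simple, and undirected. A graph is subcubic if its maximum degree is at most $3$. A matching $M$ in a graph $G$ is acyclic if the subgraph of $G$ induced by the set of vertices incident to some edge of $M$ is a forest; the acyclic matching number $\nu_{ac}(G)$ is the maximum size of an acyclic matching in $G$. $m(G)$ denotes the number of edges of $G$. $K_4^+$ denotes the graph obtained from the complete graph $K_4$ by subdividing one edge once (i.e., replacing one edge by a path of length $2$ through a new vertex). *)

theory Defs
  imports Complex_Main
begin

record 'a ugraph =
  verts :: "'a set"
  edges :: "'a set set"

definition simple_graph :: "'a ugraph \<Rightarrow> bool" where
  "simple_graph G \<longleftrightarrow> finite (verts G) \<and> (\<forall>e\<in>edges G. e \<subseteq> verts G \<and> card e = 2)"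

definition degree :: "'a ugraph \<Rightarrow> 'a \<Rightarrow> nat" where
  "degree G v = card {e \<in> edges G. v \<in> e}"

definition subcubic :: "'a ugraph \<Rightarrow> bool" where
  "subcubic G \<longleftrightarrow> (\<forall>v\<in>verts G. degree G v \<le> 3)"

text \<open>The null graph does not count as connected.\<close>

definition connected_graph :: "'a ugraph \<Rightarrow> bool" where
  "connected_graph G \<longleftrightarrow> verts G \<noteq> {} \<and>
    (\<forall>u\<in>verts G. \<forall>v\<in>verts G. (u, v) \<in> {(x, y). {x, y} \<in> edges G}\<^sup>*)"

definition induced_subgraph :: "'a ugraph \<Rightarrow> 'a set \<Rightarrow> 'a ugraph" where
  "induced_subgraph G X = \<lparr>verts = verts G \<inter> X, edges = {e \<in> edges G. e \<subseteq> X}\<rparr>"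

text \<open>A cycle is given by the list of its pairwise distinct vertices in cyclic order; the index
  arithmetic modulo the length accounts for the edge from the last vertex to the first.\<close>

definition is_cycle :: "'a ugraph \<Rightarrow> 'a list \<Rightarrow> bool" where
  "is_cycle G xs \<longleftrightarrow> length xs \<ge> 3 \<and> distinct xs \<and>
    (\<forall>i<length xs. {xs ! i, xs ! (Suc i mod length xs)} \<in> edges G)"

definition forest :: "'a ugraph \<Rightarrow> bool" where
  "forest G \<longleftrightarrow> (\<nexists>xs. is_cycle G xs)"

definition matching :: "'a ugraph \<Rightarrow> 'a set set \<Rightarrow> bool" where
  "matching G M \<longleftrightarrow> M \<subseteq> edges G \<and> (\<forall>e\<in>M. \<forall>f\<in>M. e \<noteq> f \<longrightarrow> e \<inter> f = {})"

definition acyclic_matching :: "'a ugraph \<Rightarrow> 'a set set \<Rightarrow> bool" where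
  "acyclic_matching G M \<longleftrightarrow> matching G M \<and> forest (induced_subgraph G (\<Union>M))"

text \<open>For a finite graph the set below is finite, and it contains 0 because of the empty matching.\<close>

definition acyclic_matching_number :: "'a ugraph \<Rightarrow> nat" where
  "acyclic_matching_number G = Max {card M | M. acyclic_matching G M}"

text \<open>Adjacency of a pair of equal vertices is included below, but in a simple graph no singleton
  is an edge.\<close>

definition graph_iso :: "'a ugraph \<Rightarrow> 'b ugraph \<Rightarrow> bool" where
  "graph_iso G H \<longleftrightarrow> (\<exists>f. bij_betw f (verts G) (verts H) \<and>
    (\<forall>u\<in>verts G. \<forall>v\<in>verts G. {u, v} \<in> edges G \<longleftrightarrow> {f u, f v} \<in> edges H))"

definition complete_graph :: "'a set \<Rightarrow> 'a ugraph" where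
  "complete_graph V = \<lparr>verts = V, edges = {e. e \<subseteq> V \<and> card e = 2}\<rparr>"

definition complete_bipartite_graph :: "'a set \<Rightarrow> 'a set \<Rightarrow> 'a ugraph" where
  "complete_bipartite_graph A B = \<lparr>verts = A \<union> B, edges = {{a, b} | a b. a \<in> A \<and> b \<in> B}\<rparr>"

text \<open>Replaces the edge between \<open>u\<close> and \<open>v\<close> by a path of length 2 through \<open>w\<close>, which has to be
  a new vertex.\<close>

definition subdivide_edge :: "'a ugraph \<Rightarrow> 'a \<Rightarrow> 'a \<Rightarrow> 'a \<Rightarrow> 'a ugraph" where
  "subdivide_edge G u v w =
    \<lparr>verts = insert w (verts G), edges = (edges G - {{u, v}}) \<union> {{u, w}, {w, v}}\<rparr>"

definition K4_plus :: "nat ugraph" where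
  "K4_plus = subdivide_edge (complete_graph {0, 1, 2, 3}) 0 1 4"

definition K33 :: "nat ugraph" where
  "K33 = complete_bipartite_graph {0, 1, 2} {3, 4, 5}"

end

theory Submission
  imports Defs
begin

text \<open>
  Let \<open>f\<close> map the degrees \<open>0, 1, 2, 3\<close> to \<open>0, 3, 2, 3\<close>, so that the sum of \<open>f\<close> over all degrees is
  \<open>2m\<close> plus twice the number of leaves. The stronger inequality \<open>\<Sum> f(deg v) \<le> 12 \<nu>\<close> is proved for all
  subcubic graphs without a component \<open>K\<^sub>4\<^sup>+\<close> or \<open>K\<^sub>3\<^sub>,\<^sub>3\<close>, by induction on the number of vertices.
  Counting leaves makes a pendant \<open>K\<^sub>4\<^sup>+\<close> reducible: deleting its four cubic vertices gains one
  matching edge and costs exactly 12, since its fifth vertex becomes a leaf. In a minimal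
  counterexample one may therefore delete any set \<open>X\<close> containing an induced tree \<open>Y\<close> that has a
  perfect matching and sends at most one edge out of \<open>X\<close>, and the loss of weight must exceed
  \<open>6|Y|\<close>. This rules out leaves.

  Take a largest induced tree \<open>T\<close> with a perfect matching, and let \<open>N\<close> be its neighbourhood. A
  vertex of \<open>N\<close> with one neighbour in \<open>T\<close> has all its neighbours in \<open>T \<union> N\<close>, as \<open>T\<close> could be
  extended otherwise. Deleting \<open>T \<union> N\<close> and counting edges leaves almost no slack: all of \<open>T\<close> is
  cubic, and all but at most two vertices of \<open>N\<close> have just one neighbour in \<open>T\<close>. Now consider the
  matched pairs \<open>{u, v}\<close> that hang at the ends of \<open>T\<close>. Exchanging such a pair for another pair of
  adjacent vertices yields further largest trees, and playing these off against each other forces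
  small configurations, each of which can be deleted.
\<close>

section \<open>Trees with a perfect matching\<close>

text \<open>The exceptions are genuine: \<open>K4_plus\<close> and \<open>K33\<close> have 7 and 9
  edges but acyclic matching number 1. A single tree almost pays 12 per matching edge: a cubic T on
  t vertices sends t + 2 edges to N, and if each vertex of N receives one of them and has no
  neighbour outside T \<union> N, then deleting T \<union> N costs at most 3t + 3(t + 2) = 6t + 6
  against a gain of 6t. A counterexample thus has a budget below 6, by parity at most 4, for all
  deviations: a vertex of degree 2 in T uses 4, a vertex of N with two neighbours in T (a
  \<open>double\<close>) at least 2, a vertex of N with degree 2 and one neighbour in T uses 1.
  Doubles are the obstacle, as they can close cycles when pairs are exchanged; but every hanging
  pair turns out to need one, T has two disjoint hanging pairs, and the budget allows at most two
  doubles. Building trees by matched pairs loses nothing: at the end of a longest path of an induced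
  tree with a perfect matching, a leaf and its partner of degree 2 can be peeled off.\<close>

inductive ptree :: "('a \<Rightarrow> 'a set) \<Rightarrow> 'a set \<Rightarrow> bool" for nb where
  edge: "\<lbrakk>b \<in> nb a; a \<in> nb b; a \<noteq> b\<rbrakk> \<Longrightarrow> ptree nb {a, b}"
| add: "\<lbrakk>ptree nb T; p \<notin> T; l \<notin> T; p \<noteq> l; l \<in> nb p; nb p \<inter> T = {r}; nb l \<inter> T = {}\<rbrakk>
    \<Longrightarrow> ptree nb (insert p (insert l T))"

text \<open>The shape in which deletions deliver their result: each contributes a tree joined by at
  most one edge to the forest found in the rest. Successive trees may therefore be adjacent;
  \<open>y0\<close> and \<open>z0\<close> are the possible ends of the joining edge and dummies if
  there is none.\<close>

inductive pforest :: "('a \<Rightarrow> 'a set) \<Rightarrow> 'a set \<Rightarrow> bool" for nb where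
  empty: "pforest nb {}"
| join: "\<lbrakk>pforest nb F; ptree nb Y; Y \<inter> F = {}; \<forall>y\<in>Y - {y0}. nb y \<inter> F = {}; nb y0 \<inter> F \<subseteq> {z0}\<rbrakk>
    \<Longrightarrow> pforest nb (F \<union> Y)"

definition wt :: "nat \<Rightarrow> nat" where
  "wt d = (if d = 1 then 3 else d)"

text \<open>The pair of a last application of \<open>ptree.add\<close>, seen in the finished tree: a
  leaf, its partner, and the vertex at which the partner is attached.\<close>

definition hanging :: "('a \<Rightarrow> 'a set) \<Rightarrow> 'a set \<Rightarrow> 'a \<Rightarrow> 'a \<Rightarrow> 'a \<Rightarrow> bool" where
  "hanging nb T u v w \<longleftrightarrow> nb u \<inter> T = {v} \<and> nb v \<inter> T = {u, w} \<and> u \<noteq> w"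

text \<open>Acyclicity of a vertex set is expressed by degeneracy: every non-empty subset has a vertex with at
  most one neighbour inside. The variant with two such vertices survives joining by a single edge.\<close>

definition thin :: "('a \<Rightarrow> 'a set) \<Rightarrow> 'a set \<Rightarrow> bool" where
  "thin nb A \<longleftrightarrow> (\<forall>S\<subseteq>A. (\<exists>a b. a \<in> S \<and> b \<in> S \<and> a \<noteq> b) \<longrightarrow>
     (\<exists>a b. a \<in> S \<and> b \<in> S \<and> a \<noteq> b \<and> card (nb a \<inter> S) \<le> 1 \<and> card (nb b \<inter> S) \<le> 1))"

definition acyc :: "('a \<Rightarrow> 'a set) \<Rightarrow> 'a set \<Rightarrow> bool" where
  "acyc nb A \<longleftrightarrow> (\<forall>S\<subseteq>A. S \<noteq> {} \<longrightarrow> (\<exists>a\<in>S. card (nb a \<inter> S) \<le> 1))"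

lemma card_le1_if_subset_singleton: "A \<subseteq> {a} \<Longrightarrow> card A \<le> 1"
  using card_mono[of "{a}" A] by simp

lemma two_elements_not_x:
  assumes "a \<in> S" "b \<in> S" "a \<noteq> b" "P a" "P b"
  shows "\<exists>c\<in>S. c \<noteq> x \<and> P c"
  using assms by metis

text \<open>Working with neighbourhood functions makes the deletion of vertices a mere change of the
  function; symmetry and \<open>nb_sub\<close> force \<open>nb\<close> to be empty outside
  \<open>V\<close>.\<close>

locale subcubic_nbs =
  fixes V :: "'a set" and nb :: "'a \<Rightarrow> 'a set"
  assumes fin: "finite V"
    and nb_sub: "nb v \<subseteq> V"
    and nb_sym: "x \<in> nb y \<Longrightarrow> y \<in> nb x"
    and nb_irr: "x \<notin> nb x"
    and nb_card: "card (nb x) \<le> 3"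
begin

lemma nb_iff: "x \<in> nb y \<longleftrightarrow> y \<in> nb x"
  using nb_sym by blast

lemma fin_nb [simp]: "finite (nb v)"
  using nb_sub fin finite_subset by blast

lemma nb_outside: "v \<notin> V \<Longrightarrow> nb v = {}"
  using nb_sub nb_sym by blast

lemma ptree_edge: "b \<in> nb a \<Longrightarrow> ptree nb {a, b}"
  by (metis nb_irr nb_sym ptree.edge)

lemma ptree_fin: "ptree nb T \<Longrightarrow> finite T"
  by (induction rule: ptree.induct) auto

lemma ptree_sub: "ptree nb T \<Longrightarrow> T \<subseteq> V"
  by (induction rule: ptree.induct) (use nb_sub nb_sym in blast)+

lemma ptree_even: "ptree nb T \<Longrightarrow> even (card T)"
proof (induction rule: ptree.induct)
  case (add T p l r)
  then show ?case using ptree_fin[OF add.hyps(1)] by simp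
qed simp

lemma ptree_card_ge2: "ptree nb T \<Longrightarrow> card T \<ge> 2"
proof (induction rule: ptree.induct)
  case (add T p l r)
  then show ?case using ptree_fin[OF add.hyps(1)] by simp
qed simp

lemma ptree_nbr: "ptree nb T \<Longrightarrow> v \<in> T \<Longrightarrow> nb v \<inter> T \<noteq> {}"
proof (induction arbitrary: v rule: ptree.induct)
  case (add T p l r)
  then show ?case using nb_sym by blast
qed blast

text \<open>A tree has |T| - 1 edges, each counted from both ends. Together with the degrees this
  determines how many edges leave the tree.\<close>

lemma ptree_degree_sum:
  "ptree nb T \<Longrightarrow> (\<Sum>v\<in>T. card (nb v \<inter> T)) + 2 = 2 * card T"
proof (induction rule: ptree.induct)
  case (edge b a)
  have "nb a \<inter> {a, b} = {b}" "nb b \<inter> {a, b} = {a}" using edge nb_irr by auto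
  then have "card (nb a \<inter> {a, b}) = 1" "card (nb b \<inter> {a, b}) = 1" by simp_all
  then show ?case using edge(3) by (subst sum.insert) auto
next
  case (add T p l r)
  let ?T = "insert p (insert l T)"
  have fT: "finite T" by (rule ptree_fin[OF add.hyps(1)])
  have r: "r \<in> T" "r \<in> nb p" using add by auto
  have p: "nb p \<inter> ?T = {l, r}" using add nb_irr by auto
  have l: "nb l \<inter> ?T = {p}" using add nb_irr nb_sym by auto
  have rr: "nb r \<inter> ?T = insert p (nb r \<inter> T)"
    using add r nb_sym by blast
  have o: "nb v \<inter> ?T = nb v \<inter> T" if "v \<in> T - {r}" for v
    using add that nb_sym by blast
  have lr: "l \<noteq> r" using add r by blast
  have "(\<Sum>v\<in>?T. card (nb v \<inter> ?T)) = 2 + 1 + (\<Sum>v\<in>T. card (nb v \<inter> ?T))"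
    using add fT p l lr by simp
  also have "(\<Sum>v\<in>T. card (nb v \<inter> ?T)) = card (nb r \<inter> ?T) + (\<Sum>v\<in>T-{r}. card (nb v \<inter> ?T))"
    using sum.remove[OF fT r(1)] by blast
  also have "\<dots> = Suc (card (nb r \<inter> T)) + (\<Sum>v\<in>T-{r}. card (nb v \<inter> T))"
    using rr o add.hyps(2) by simp
  also have "\<dots> = Suc (\<Sum>v\<in>T. card (nb v \<inter> T))"
    using sum.remove[OF fT r(1), of "\<lambda>v. card (nb v \<inter> T)"] by simp
  finally show ?case using add fT by simp
qed

text \<open>Connectedness of the tree, expressed without paths.\<close>

lemma ptree_closed:
  "ptree nb T \<Longrightarrow> S \<subseteq> T \<Longrightarrow> S \<noteq> {} \<Longrightarrow> (\<And>v. v \<in> S \<Longrightarrow> nb v \<inter> T \<subseteq> S) \<Longrightarrow> S = T"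
proof (induction arbitrary: S rule: ptree.induct)
  case (edge b a)
  then show ?case by blast
next
  case (add T p l r)
  let ?T = "insert p (insert l T)"
  have r: "r \<in> T" "r \<in> nb p" using add by auto
  have sy: "p \<in> nb l" "p \<in> nb r" using nb_sym[OF add.hyps(5)] nb_sym[OF r(2)] by auto
  have ne: "S \<inter> T \<noteq> {}"
  proof -
    obtain s where "s \<in> S" using add by blast
    have "p \<in> S \<Longrightarrow> r \<in> S" using add.prems(3)[of p] r by blast
    moreover have "l \<in> S \<Longrightarrow> p \<in> S" using add.prems(3)[of l] sy by blast
    ultimately show ?thesis using \<open>s \<in> S\<close> add.prems r by blast
  qed
  have "S \<inter> T = T" using add.IH[of "S \<inter> T"] ne add.prems(3) by blast
  then have "r \<in> S" using r by blast
  then have "p \<in> S" using add.prems(3)[of r] sy by blast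
  then have "l \<in> S" using add.prems(3)[of p] add.hyps by blast
  then show ?case using \<open>S \<inter> T = T\<close> \<open>p \<in> S\<close> add.prems by blast
qed

text \<open>Of the two low vertices of \<open>S - {b}\<close> one differs from \<open>r\<close> and
  so gains no neighbour from \<open>b\<close>; the second low vertex is \<open>b\<close>
  itself.\<close>

lemma thin_insert:
  assumes "thin nb A" "b \<notin> A" "nb b \<inter> A \<subseteq> {r}"
  shows "thin nb (insert b A)"
  unfolding thin_def
proof (intro allI impI)
  fix S assume S: "S \<subseteq> insert b A" and two: "\<exists>a c. a \<in> S \<and> c \<in> S \<and> a \<noteq> c"
  show "\<exists>a c. a \<in> S \<and> c \<in> S \<and> a \<noteq> c \<and> card (nb a \<inter> S) \<le> 1 \<and> card (nb c \<inter> S) \<le> 1"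
  proof (cases "b \<in> S")
    case False
    then have "S \<subseteq> A" using S by blast
    then show ?thesis using assms(1) two unfolding thin_def by blast
  next
    case True
    have "nb b \<inter> S \<subseteq> {r}" using S assms nb_irr by blast
    then have cb: "card (nb b \<inter> S) \<le> 1" by (rule card_le1_if_subset_singleton)
    have nbS: "nb a \<inter> S = nb a \<inter> (S - {b})" if "a \<noteq> r" "a \<in> S" "a \<noteq> b" for a
    proof -
      have "a \<notin> nb b" using that S assms by blast
      then show ?thesis using nb_sym by blast
    qed
    show ?thesis
    proof (cases "\<exists>a c. a \<in> S - {b} \<and> c \<in> S - {b} \<and> a \<noteq> c")
      case True
      moreover have "S - {b} \<subseteq> A" using S by blast
      ultimately obtain a c where ac: "a \<in> S - {b}" "c \<in> S - {b}" "a \<noteq> c"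
        "card (nb a \<inter> (S - {b})) \<le> 1" "card (nb c \<inter> (S - {b})) \<le> 1"
        using assms(1) unfolding thin_def by meson
      then obtain e where "e \<in> S - {b}" "e \<noteq> r" "card (nb e \<inter> (S - {b})) \<le> 1"
        using two_elements_not_x[of a "S-{b}" c "\<lambda>e. card (nb e \<inter> (S - {b})) \<le> 1" r] by blast
      then have "card (nb e \<inter> S) \<le> 1" "e \<in> S" "e \<noteq> b" using nbS[of e] by auto
      then show ?thesis using cb \<open>b \<in> S\<close> by blast
    next
      case False
      then obtain a where a: "S = {a, b}" "a \<noteq> b" using two \<open>b \<in> S\<close> by blast
      have "nb a \<inter> S \<subseteq> {b}" using a nb_irr by blast
      then have "card (nb a \<inter> S) \<le> 1" by (rule card_le1_if_subset_singleton)
      then show ?thesis using a cb by blast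
    qed
  qed
qed

lemma ptree_thin: "ptree nb T \<Longrightarrow> thin nb T"
proof (induction rule: ptree.induct)
  case (edge b a)
  have "thin nb {a}" unfolding thin_def by blast
  then have "thin nb (insert b {a})" by (rule thin_insert) (use edge in auto)
  then show ?case by (simp add: insert_commute)
next
  case (add T p l r)
  have "thin nb (insert p T)" by (rule thin_insert) (use add in auto)
  then have "thin nb (insert l (insert p T))" by (rule thin_insert[where r=p]) (use add in auto)
  then show ?case by (simp add: insert_commute)
qed

text \<open>If \<open>S\<close> contains two vertices of \<open>Y\<close>, one of the two low
  vertices supplied by \<open>thin\<close> is not \<open>y0\<close> and hence sees nothing of
  \<open>F\<close>. If \<open>S\<close> meets \<open>Y\<close> in one vertex only, that vertex has
  at most the neighbour \<open>z0\<close>.\<close>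

lemma pforest_acyc: "pforest nb F \<Longrightarrow> acyc nb F"
proof (induction rule: pforest.induct)
  case empty
  show ?case by (simp add: acyc_def)
next
  case (join F Y y0 z0)
  show ?case unfolding acyc_def
  proof (intro allI impI)
    fix S assume S: "S \<subseteq> F \<union> Y" and ne: "S \<noteq> {}"
    show "\<exists>a\<in>S. card (nb a \<inter> S) \<le> 1"
    proof (cases "S \<inter> Y = {}")
      case True
      then have "S \<subseteq> F" using S by blast
      then show ?thesis using join.IH ne unfolding acyc_def by blast
    next
      case False
      show ?thesis
      proof (cases "\<exists>a b. a \<in> S \<inter> Y \<and> b \<in> S \<inter> Y \<and> a \<noteq> b")
        case True
        then obtain a b where ab: "a \<in> S \<inter> Y" "b \<in> S \<inter> Y" "a \<noteq> b"
          "card (nb a \<inter> (S \<inter> Y)) \<le> 1" "card (nb b \<inter> (S \<inter> Y)) \<le> 1"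
          using ptree_thin[OF join.hyps(2)] unfolding thin_def by (meson inf_le2)
        then obtain e where e: "e \<in> S \<inter> Y" "e \<noteq> y0" "card (nb e \<inter> (S \<inter> Y)) \<le> 1"
          using two_elements_not_x[of a "S \<inter> Y" b "\<lambda>e. card (nb e \<inter> (S \<inter> Y)) \<le> 1" y0] by blast
        have "nb e \<inter> S = nb e \<inter> (S \<inter> Y)" using e join.hyps S by blast
        then have "card (nb e \<inter> S) \<le> 1" "e \<in> S" using e by auto
        then show ?thesis by blast
      next
        case False
        then obtain a where a: "S \<inter> Y = {a}" using \<open>S \<inter> Y \<noteq> {}\<close> by blast
        have "nb a \<inter> S \<subseteq> nb a \<inter> F"
        proof
          fix x assume x: "x \<in> nb a \<inter> S"
          then have "x \<noteq> a" using nb_irr by auto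
          then have "x \<notin> Y" using a x by auto
          then show "x \<in> nb a \<inter> F" using x S by auto
        qed
        also have "\<dots> \<subseteq> {z0}" using join.hyps a by (cases "a = y0") auto
        finally have "card (nb a \<inter> S) \<le> 1" by (rule card_le1_if_subset_singleton)
        then show ?thesis using a by blast
      qed
    qed
  qed
qed

lemma ptree_matching:
  "ptree nb T \<Longrightarrow> \<exists>M. finite M \<and> \<Union>M = T \<and> 2 * card M = card T \<and> pairwise disjnt M
     \<and> (\<forall>e\<in>M. \<exists>a b. e = {a, b} \<and> b \<in> nb a)"
proof (induction rule: ptree.induct)
  case (edge b a)
  then show ?case by (intro exI[of _ "{{a, b}}"]) auto
next
  case (add T p l r)
  then obtain M where M: "finite M" "\<Union>M = T" "2 * card M = card T" "pairwise disjnt M"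
     "\<forall>e\<in>M. \<exists>a b. e = {a, b} \<and> b \<in> nb a" by blast
  have "{p, l} \<notin> M" using M add by blast
  moreover have "finite T" by (rule ptree_fin[OF add.hyps(1)])
  moreover have "pairwise disjnt (insert {p, l} M)"
    using M(4) M(2) add.hyps(2,3) by (auto simp: pairwise_insert disjnt_def)
  ultimately show ?case using M add by (intro exI[of _ "insert {p, l} M"]) auto
qed

lemma pforest_fin: "pforest nb F \<Longrightarrow> finite F"
  by (induction rule: pforest.induct) (auto dest: ptree_fin)

lemma pforest_matching:
  "pforest nb F \<Longrightarrow> \<exists>M. finite M \<and> \<Union>M = F \<and> 2 * card M = card F \<and> pairwise disjnt M
     \<and> (\<forall>e\<in>M. \<exists>a b. e = {a, b} \<and> b \<in> nb a)"
proof (induction rule: pforest.induct)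
  case empty
  show ?case by (intro exI[of _ "{}"]) auto
next
  case (join F Y y0 z0)
  then obtain M where M: "finite M" "\<Union>M = F" "2 * card M = card F" "pairwise disjnt M"
     "\<forall>e\<in>M. \<exists>a b. e = {a, b} \<and> b \<in> nb a" by blast
  obtain N where N: "finite N" "\<Union>N = Y" "2 * card N = card Y" "pairwise disjnt N"
     "\<forall>e\<in>N. \<exists>a b. e = {a, b} \<and> b \<in> nb a" using ptree_matching[OF join.hyps(2)] by blast
  have d: "disjnt e f" if "e \<in> M" "f \<in> N" for e f
    using that M(2) N(2) join.hyps(3) by (auto simp: disjnt_def)
  have "M \<inter> N = {}"
  proof (rule ccontr)
    assume "M \<inter> N \<noteq> {}"
    then obtain e where "e \<in> M" "e \<in> N" by blast
    then have "e = {}" using d[of e e] by simp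
    then show False using M(5) \<open>e \<in> M\<close> by blast
  qed
  moreover have "pairwise disjnt (M \<union> N)"
    using M(4) N(4) d by (auto simp: pairwise_def disjnt_sym)
  moreover have "finite F" "finite Y" using M N by (auto intro: pforest_fin join.hyps ptree_fin)
  ultimately show ?case using M N join.hyps(3)
    by (intro exI[of _ "M \<union> N"]) (auto simp: card_Un_disjoint Int_commute)
qed

lemma hangingD:
  assumes "hanging nb T u v w"
  shows "nb u \<inter> T = {v}" "nb v \<inter> T = {u, w}" "u \<noteq> w" "u \<in> T" "v \<in> T" "w \<in> T" "u \<noteq> v" "v \<noteq> w"
    "v \<in> nb u" "u \<in> nb v" "w \<in> nb v" "v \<in> nb w" "u \<notin> nb w" "w \<notin> nb u"
proof -
  show 1: "nb u \<inter> T = {v}" "nb v \<inter> T = {u, w}" "u \<noteq> w"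
    using assms unfolding hanging_def by auto
  then show 2: "u \<in> T" "v \<in> T" "w \<in> T" "v \<in> nb u" "u \<in> nb v" "w \<in> nb v" by auto
  show "v \<in> nb w" "u \<noteq> v" "v \<noteq> w" using 2 nb_sym[of w v] nb_irr by auto
  then show 3: "w \<notin> nb u" using 1 2 by auto
  then show "u \<notin> nb w" using nb_sym[of u w] by auto
qed

text \<open>The pair need not be the one added last, so the construction has to be reordered: the
  pair is removed from the earlier tree and the last pair is added again.\<close>

lemma hanging_remove:
  "ptree nb T \<Longrightarrow> hanging nb T u v w \<Longrightarrow> ptree nb (T - {u, v})"
proof (induction arbitrary: w rule: ptree.induct)
  case (edge b a)
  then show ?case using hangingD[OF edge.prems] by blast
next
  case (add T p l r)
  let ?T = "insert p (insert l T)"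
  note h = hangingD[OF add.prems]
  have r: "r \<in> T" "r \<in> nb p" using add by auto
  have sy: "p \<in> nb l" "p \<in> nb r" using nb_sym[OF add.hyps(5)] nb_sym[OF r(2)] by auto
  have p: "nb p \<inter> ?T = {l, r}" using add nb_irr by auto
  have l: "nb l \<inter> ?T = {p}" using add nb_irr nb_sym by auto
  have lr: "l \<noteq> r" using add r by blast
  have up: "u \<noteq> p" using p h(1) lr by auto
  have vl: "v \<noteq> l" using l h(2) h(3) by auto
  show ?case
  proof (cases "u = l")
    case True
    then have "v = p" using l h(1) by auto
    then have "?T - {u, v} = T" using True add.hyps by auto
    then show ?thesis using add by simp
  next
    case False
    then have uT: "u \<in> T" using h up by blast
    have vT: "v \<in> T"
    proof (rule ccontr)
      assume "v \<notin> T"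
      then have "v = p" using h vl by blast
      then have "u = r" using p h(2) False by auto
      then have "nb u \<inter> T = {}" using h(1) \<open>v = p\<close> add.hyps by auto
      then show False using ptree_nbr[OF add.hyps(1) uT] by blast
    qed
    have ru: "r \<noteq> u"
    proof
      assume "r = u"
      then have "p \<in> nb u \<inter> ?T" using sy by auto
      then show False using h(1) vT add.hyps(2) by auto
    qed
    have nu: "nb u \<inter> T = {v}" using h(1) vT by blast
    show ?thesis
    proof (cases "w = p")
      case True
      \<comment> \<open>The last pair was attached to \<open>v\<close> itself. Then
        \<open>{u, v}\<close> is closed in the earlier tree and thus all of it, and only the last
        pair remains.\<close>
      then have "nb v \<inter> T = {u}" using h(2) uT add.hyps by blast
      then have "{u, v} = T"
        by (intro ptree_closed[OF add.hyps(1)]) (use nu uT vT in auto)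
      then have "?T - {u, v} = {p, l}" using add.hyps by auto
      then show ?thesis using ptree_edge add.hyps by simp
    next
      case False
      have "w \<noteq> l" using h(12) vT add.hyps(7) by auto
      then have wT: "w \<in> T" using h False by blast
      then have "hanging nb T u v w" using h nu uT unfolding hanging_def by blast
      then have pt: "ptree nb (T - {u, v})" by (rule add.IH)
      have "r \<noteq> v"
      proof
        assume "r = v"
        then have "p \<in> nb v \<inter> ?T" using sy by auto
        then show False using h(2) up False by auto
      qed
      then have "nb p \<inter> (T - {u, v}) = {r}" using add.hyps ru by blast
      moreover have "nb l \<inter> (T - {u, v}) = {}" using add.hyps by blast
      ultimately have "ptree nb (insert p (insert l (T - {u, v})))"
        using pt add.hyps by (intro ptree.add) auto
      moreover have "insert p (insert l (T - {u, v})) = ?T - {u, v}" using uT vT add.hyps by blast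
      ultimately show ?thesis by simp
    qed
  qed
qed

lemma hanging_extend:
  assumes "hanging nb T u v w" "nb p \<inter> T = {r}" "nb l \<inter> T = {}" "r \<noteq> u" "r \<noteq> v"
  shows "hanging nb (insert p (insert l T)) u v w"
proof -
  note h = hangingD[OF assms(1)]
  have "p \<notin> nb u" "p \<notin> nb v" "l \<notin> nb u" "l \<notin> nb v" 
  proof -
    have "u \<notin> nb p" "v \<notin> nb p" "u \<notin> nb l" "v \<notin> nb l" using h(4,5) assms(2-) by auto
    then show "p \<notin> nb u" "p \<notin> nb v" "l \<notin> nb u" "l \<notin> nb v"
      using nb_sym[of p u] nb_sym[of p v] nb_sym[of l u] nb_sym[of l v] by auto
  qed
  then show ?thesis using h unfolding hanging_def by auto
qed

text \<open>One pair is the one added last. The earlier tree has two disjoint hanging pairs, and the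
  one that avoids the attachment vertex \<open>r\<close> still hangs; if the earlier tree is a
  single edge, it hangs at \<open>p\<close> as a whole.\<close>

lemma two_hanging:
  "ptree nb T \<Longrightarrow> card T \<ge> 4 \<Longrightarrow>
   \<exists>u v w u' v' w'. hanging nb T u v w \<and> hanging nb T u' v' w' \<and> {u, v} \<inter> {u', v'} = {}"
proof (induction rule: ptree.induct)
  case (edge b a)
  then show ?case by simp
next
  case (add T p l r)
  let ?T = "insert p (insert l T)"
  have r: "r \<in> T" "r \<in> nb p" using add by auto
  have sy: "p \<in> nb l" "p \<in> nb r" using nb_sym[OF add.hyps(5)] nb_sym[OF r(2)] by auto
  have p: "nb p \<inter> ?T = {l, r}" using add nb_irr by auto
  have l: "nb l \<inter> ?T = {p}" using add nb_irr nb_sym by auto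
  have lr: "l \<noteq> r" using add r by blast
  have h0: "hanging nb ?T l p r" using p l lr unfolding hanging_def by blast
  have "\<exists>u v w. hanging nb ?T u v w \<and> u \<in> T \<and> v \<in> T"
  proof (cases "card T \<ge> 4")
    case True
    then obtain u v w u' v' w' where hh: "hanging nb T u v w" "hanging nb T u' v' w'"
       "{u, v} \<inter> {u', v'} = {}" using add.IH[OF True] by (elim exE conjE) (rule that)
    show ?thesis
    proof (cases "r \<in> {u, v}")
      case True
      then have "r \<noteq> u'" "r \<noteq> v'" using hh by auto
      then show ?thesis using hanging_extend[OF hh(2) add.hyps(6,7)] hangingD(4,5)[OF hh(2)] by blast
    next
      case False
      then show ?thesis using False hanging_extend[OF hh(1) add.hyps(6,7)] hangingD(4,5)[OF hh(1)] by blast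
    qed
  next
    case False
    then have c2: "card T = 2" using ptree_even[OF add.hyps(1)] ptree_card_ge2[OF add.hyps(1)]
      by (cases "card T = 3") auto
    obtain b where b: "b \<in> nb r" "b \<in> T" using ptree_nbr[OF add.hyps(1) r(1)] by blast
    then have "r \<noteq> b" using nb_irr by blast
    then have "T = {r, b}" using c2 r b ptree_fin[OF add.hyps(1)]
      by (intro card_seteq[symmetric]) auto
    moreover have "r \<in> nb b" by (rule nb_sym[OF b(1)])
    moreover have "b \<notin> nb p" using add.hyps(6) b r \<open>r \<noteq> b\<close> by auto
    moreover have "b \<notin> nb l" "r \<notin> nb l" using add.hyps b r by blast+
    ultimately have "hanging nb ?T b r p"
      unfolding hanging_def using b sy r nb_irr nb_sym[of p b] nb_sym[of l b] nb_sym[of l r]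
        add.hyps(2,3) by auto
    then show ?thesis using b r by blast
  qed
  then obtain u v w where "hanging nb ?T u v w" "u \<in> T" "v \<in> T" by blast
  then show ?case using h0 add.hyps by blast
qed

end

text \<open>Carries trees of a graph with vertices deleted back to the whole graph; \<open>W\<close>
  is the set of surviving vertices.\<close>

lemma ptree_cong:
  assumes "ptree nb' T" "\<And>v. nb' v \<inter> W = (if v \<in> W then nb v \<inter> W else {})" "T \<subseteq> W"
  shows "ptree nb T"
  using assms(1,3)
proof (induction rule: ptree.induct)
  case (edge b a)
  then have "b \<in> nb a" "a \<in> nb b" using assms(2)[of a] assms(2)[of b] by (auto split: if_splits)
  then show ?case using edge by (intro ptree.edge)
next
  case (add T p l r)
  have "nb p \<inter> W = nb' p \<inter> W" "nb l \<inter> W = nb' l \<inter> W" using add assms(2) by auto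
  then have "nb p \<inter> T = {r}" "nb l \<inter> T = {}" "l \<in> nb p" using add by blast+
  then show ?case using add by (intro ptree.add) auto
qed

lemma pforest_cong:
  assumes "pforest nb' F" "\<And>v. nb' v \<inter> W = (if v \<in> W then nb v \<inter> W else {})" "F \<subseteq> W"
  shows "pforest nb F"
  using assms(1,3)
proof (induction rule: pforest.induct)
  case empty
  show ?case by (rule pforest.empty)
next
  case (join F Y y0 z0)
  have eq: "nb v \<inter> F = nb' v \<inter> F" if "v \<in> W" for v using assms(2)[of v] that join.prems by auto
  \<comment> \<open>If \<open>y0\<close> lies outside \<open>Y\<close> there is no joining edge, but
    \<open>nb y0\<close> may meet \<open>F\<close> in the larger graph; any vertex of
    \<open>Y\<close> can replace \<open>y0\<close>.\<close>
  obtain y1 where y1: "\<forall>y\<in>Y - {y1}. nb y \<inter> F = {}" "nb y1 \<inter> F \<subseteq> {z0}"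
  proof (cases "y0 \<in> Y")
    case True
    then show ?thesis using that[of y0] join eq by blast
  next
    case False
    obtain y where "y \<in> Y" using join.hyps(2) by (cases rule: ptree.cases) auto
    then show ?thesis using that[of y] join eq False by blast
  qed
  have "ptree nb Y" using ptree_cong[OF join.hyps(2) assms(2)] join.prems by auto
  then show ?case using join y1 by (intro pforest.join) auto
qed

section \<open>Deleting vertices from a minimal counterexample\<close>

text \<open>The four cubic vertices of a copy of \<open>K\<^sub>4\<^sup>+\<close>. The vertex \<open>w\<close> may have a third neighbour; the copy
  is a component iff it has none.\<close>

definition k4p :: "('a \<Rightarrow> 'a set) \<Rightarrow> 'a \<Rightarrow> 'a \<Rightarrow> 'a \<Rightarrow> 'a \<Rightarrow> 'a \<Rightarrow> bool" where
  "k4p nb w a b c d \<longleftrightarrow> distinct [w, a, b, c, d] \<and>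
     nb a = {w, c, d} \<and> nb b = {w, c, d} \<and> nb c = {a, b, d} \<and> nb d = {a, b, c}"

definition k33 :: "('a \<Rightarrow> 'a set) \<Rightarrow> 'a \<Rightarrow> 'a \<Rightarrow> 'a \<Rightarrow> 'a \<Rightarrow> 'a \<Rightarrow> 'a \<Rightarrow> bool" where
  "k33 nb a b c x y z \<longleftrightarrow> distinct [a, b, c, x, y, z] \<and>
     nb a = {x, y, z} \<and> nb b = {x, y, z} \<and> nb c = {x, y, z} \<and>
     nb x = {a, b, c} \<and> nb y = {a, b, c} \<and> nb z = {a, b, c}"

text \<open>Deletions destroy connectedness, so the induction forbids the two exceptional components
  instead. A \<open>K33\<close> is a component because all its vertices are cubic.\<close>

definition good :: "('a \<Rightarrow> 'a set) \<Rightarrow> bool" where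
  "good nb \<longleftrightarrow> (\<forall>w a b c d. k4p nb w a b c d \<longrightarrow> nb w \<noteq> {a, b}) \<and>
     (\<forall>a b c x y z. \<not> k33 nb a b c x y z)"

definition delete :: "('a \<Rightarrow> 'a set) \<Rightarrow> 'a set \<Rightarrow> 'a \<Rightarrow> 'a set" where
  "delete nb X v = (if v \<in> X then {} else nb v - X)"

lemma wt_simps [simp]: "wt 0 = 0" "wt (Suc 0) = 3" "wt 2 = 2" "wt 3 = 3"
    "wt (Suc (Suc (Suc 0))) = 3"
  by (auto simp: wt_def)

lemma wt_le3: "d \<le> 3 \<Longrightarrow> wt d \<le> 3"
  by (auto simp: wt_def)

context subcubic_nbs
begin

lemma nb_mem: "x \<in> nb y \<Longrightarrow> x \<in> V" "x \<in> nb y \<Longrightarrow> y \<in> V"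
  using nb_sub[of y] nb_outside[of y] by auto

lemma nb_card_cases: "card (nb v) = 0 \<or> card (nb v) = 1 \<or> card (nb v) = 2 \<or> card (nb v) = 3"
  using nb_card[of v] by linarith

lemma wt_nb_le3: "wt (card (nb v)) \<le> 3"
  using wt_le3 nb_card by blast

lemma delete_nbs: "X \<subseteq> V \<Longrightarrow> subcubic_nbs (V - X) (delete nb X)"
proof
  show "finite (V - X)" using fin by simp
  show "delete nb X v \<subseteq> V - X" for v using nb_sub by (auto simp: delete_def)
  show "y \<in> delete nb X x" if "x \<in> delete nb X y" for x y
    using that nb_sym[of x y] by (auto simp: delete_def split: if_splits)
  show "x \<notin> delete nb X x" for x using nb_irr by (auto simp: delete_def)
  show "card (delete nb X x) \<le> 3" for x
  proof -
    have "card (delete nb X x) \<le> card (nb x)" by (intro card_mono) (auto simp: delete_def)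
    then show ?thesis using nb_card[of x] by linarith
  qed
qed

text \<open>This is why deletions create no new exceptional subgraphs: a vertex that is still cubic
  has lost no edge, so only the vertex \<open>w\<close> of \<open>k4p\<close> can have had a further
  neighbour before.\<close>

lemma delete_card3: "card (delete nb X v) = 3 \<Longrightarrow> delete nb X v = nb v"
  using nb_card[of v] by (intro card_seteq) (auto simp: delete_def)

lemma k4p_delete: "k4p (delete nb X) w a b c d \<Longrightarrow> k4p nb w a b c d"
proof -
  assume k: "k4p (delete nb X) w a b c d"
  have "card (delete nb X v) = 3" if "v \<in> {a, b, c, d}" for v
    using that k unfolding k4p_def by (elim insertE emptyE) simp_all
  then have "delete nb X v = nb v" if "v \<in> {a, b, c, d}" for v using that delete_card3 by blast
  then show ?thesis using k unfolding k4p_def by simp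
qed

lemma k33_delete: "k33 (delete nb X) a b c x y z \<Longrightarrow> k33 nb a b c x y z"
proof -
  assume k: "k33 (delete nb X) a b c x y z"
  have "card (delete nb X v) = 3" if "v \<in> {a, b, c, x, y, z}" for v
    using that k unfolding k33_def by (elim insertE emptyE) simp_all
  then have "delete nb X v = nb v" if "v \<in> {a, b, c, x, y, z}" for v using that delete_card3 by blast
  then show ?thesis using k unfolding k33_def by simp
qed

text \<open>A lost edge lowers the weight by at most 1, except that a leaf losing its only edge
  drops from 3 to 0.\<close>

lemma wt_loss:
  "wt (card (nb z)) \<le> wt (card (nb z - X)) + (if card (nb z) = 1 then 3 else 1) * card (nb z \<inter> X)"
proof -
  have "card (nb z) = card (nb z - X) + card (nb z \<inter> X)"
    using card_Int_Diff[of "nb z" X] by simp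
  then show ?thesis using nb_card_cases[of z] by (auto simp: wt_def)
qed

text \<open>Degrees 3 and 1 have equal weight, so turning a cubic vertex into a leaf is
  free.\<close>

lemma wt_loss_zero:
  assumes "card (nb z) = 3" "card (nb z \<inter> X) = 2"
  shows "wt (card (nb z)) \<le> wt (card (nb z - X))"
proof -
  have "card (nb z) = card (nb z - X) + card (nb z \<inter> X)"
    using card_Int_Diff[of "nb z" X] by simp
  then show ?thesis using assms by (simp add: wt_def)
qed

lemma sum_swap_nb:
  assumes "A \<subseteq> V" "B \<subseteq> V"
  shows "(\<Sum>z\<in>A. \<kappa> z * card (nb z \<inter> B)) = (\<Sum>x\<in>B. \<Sum>z\<in>nb x \<inter> A. \<kappa> z :: nat)"
proof -
  have f: "finite A" "finite B" using assms fin finite_subset by blast+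
  have "(\<Sum>z\<in>A. \<kappa> z * card (nb z \<inter> B)) = (\<Sum>z\<in>A. \<Sum>x\<in>B. if x \<in> nb z then \<kappa> z else 0)"
    using f by (intro sum.cong) (auto simp: sum.If_cases Int_commute)
  also have "\<dots> = (\<Sum>x\<in>B. \<Sum>z\<in>A. if x \<in> nb z then \<kappa> z else 0)" by (rule sum.swap)
  also have "\<dots> = (\<Sum>x\<in>B. \<Sum>z\<in>nb x \<inter> A. \<kappa> z)"
  proof (rule sum.cong[OF refl])
    fix x assume "x \<in> B"
    have "(\<Sum>z\<in>A. if x \<in> nb z then \<kappa> z else 0) = sum \<kappa> (A \<inter> {z. x \<in> nb z})"
      using f by (simp add: sum.If_cases)
    moreover have "A \<inter> {z. x \<in> nb z} = nb x \<inter> A" using nb_iff by auto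
    ultimately show "(\<Sum>z\<in>A. if x \<in> nb z then \<kappa> z else 0) = sum \<kappa> (nb x \<inter> A)" by simp
  qed
  finally show ?thesis .
qed

text \<open>The loss at an outside vertex \<open>z\<close> is charged to its edges into
  \<open>X\<close> at the price \<open>\<kappa> z\<close>, which turns the total cost into a sum
  over \<open>X\<close>. The price stays a parameter because it can be 0 where a cubic vertex
  becomes a leaf.\<close>

lemma deletion_cost:
  fixes \<kappa> :: "'a \<Rightarrow> nat"
  assumes X: "X \<subseteq> V"
    and k: "\<And>z. z \<in> V - X \<Longrightarrow> nb z \<inter> X \<noteq> {} \<Longrightarrow>
      wt (card (nb z)) \<le> wt (card (nb z - X)) + \<kappa> z * card (nb z \<inter> X)"
  shows "(\<Sum>v\<in>V. wt (card (nb v))) \<le> (\<Sum>v\<in>V - X. wt (card (nb v - X)))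
     + (\<Sum>x\<in>X. wt (card (nb x)) + (\<Sum>z\<in>nb x - X. \<kappa> z))"
proof -
  have k': "wt (card (nb z)) \<le> wt (card (nb z - X)) + \<kappa> z * card (nb z \<inter> X)" if "z \<in> V - X" for z
  proof (cases "nb z \<inter> X = {}")
    case True
    then have "nb z - X = nb z" by blast
    then show ?thesis by simp
  qed (use k that in blast)
  have "(\<Sum>v\<in>V. wt (card (nb v))) = (\<Sum>v\<in>V-X. wt (card (nb v))) + (\<Sum>v\<in>X. wt (card (nb v)))"
    using X fin by (simp add: sum.subset_diff)
  also have "(\<Sum>v\<in>V-X. wt (card (nb v))) \<le>
      (\<Sum>z\<in>V-X. wt (card (nb z - X)) + \<kappa> z * card (nb z \<inter> X))"
    by (intro sum_mono k')
  also have "\<dots> = (\<Sum>v\<in>V - X. wt (card (nb v - X))) + (\<Sum>x\<in>X. \<Sum>z\<in>nb x \<inter> (V - X). \<kappa> z)"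
    using X sum_swap_nb[of "V - X" X \<kappa>] by (simp add: sum.distrib)
  also have "(\<Sum>x\<in>X. \<Sum>z\<in>nb x \<inter> (V - X). \<kappa> z) = (\<Sum>x\<in>X. \<Sum>z\<in>nb x - X. \<kappa> z)"
  proof (intro sum.cong refl)
    show "nb x \<inter> (V - X) = nb x - X" for x using nb_sub by blast
  qed
  finally show ?thesis by (simp add: sum.distrib)
qed

end

text \<open>\<open>IH\<close> is phrased with \<open>nb\<close> instead of
  \<open>delete nb X\<close>, so that the forest of the remaining graph can be combined directly
  with a tree inside \<open>X\<close>.\<close>

locale minimal_counterexample = subcubic_nbs +
  assumes gd: "good nb"
    and no_forest: "\<not> (\<exists>F\<subseteq>V. pforest nb F \<and> (\<Sum>v\<in>V. wt (card (nb v))) \<le> 6 * card F)"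
    and IH: "X \<subseteq> V \<Longrightarrow> X \<noteq> {} \<Longrightarrow> good (delete nb X) \<Longrightarrow>
      \<exists>F\<subseteq>V - X. pforest nb F \<and> (\<Sum>v\<in>V - X. wt (card (nb v - X))) \<le> 6 * card F"
begin

lemma deletion_good:
  fixes \<kappa> :: "'a \<Rightarrow> nat"
  assumes X: "X \<subseteq> V" and g: "good (delete nb X)"
    and Y: "ptree nb Y" "Y \<subseteq> X" "\<And>y. y \<in> Y \<Longrightarrow> y \<noteq> y0 \<Longrightarrow> nb y \<subseteq> X" "nb y0 \<subseteq> insert z0 X"
    and k: "\<And>z. z \<in> V - X \<Longrightarrow> nb z \<inter> X \<noteq> {} \<Longrightarrow>
      wt (card (nb z)) \<le> wt (card (nb z - X)) + \<kappa> z * card (nb z \<inter> X)"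
  shows "6 * card Y < (\<Sum>x\<in>X. wt (card (nb x)) + (\<Sum>z\<in>nb x - X. \<kappa> z))"
proof (rule ccontr)
  assume c: "\<not> ?thesis"
  have "Y \<noteq> {}" using ptree_card_ge2[OF Y(1)] by auto
  then have "X \<noteq> {}" using Y by blast
  from IH[OF X this g] obtain F where F: "F \<subseteq> V - X" "pforest nb F"
    "(\<Sum>v\<in>V - X. wt (card (nb v - X))) \<le> 6 * card F" by blast
  have d: "Y \<inter> F = {}" using F Y by blast
  have "pforest nb (F \<union> Y)"
    by (rule pforest.join[OF F(2) Y(1) d, of y0 z0]) (use F Y in blast)+
  moreover have "F \<union> Y \<subseteq> V" using F Y X by blast
  moreover have "card (F \<union> Y) = card F + card Y"
    using d pforest_fin[OF F(2)] ptree_fin[OF Y(1)] by (intro card_Un_disjoint) auto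
  ultimately show False
    using no_forest deletion_cost[OF X k] F(3) c by fastforce
qed

lemma no_k4p: "\<not> k4p nb w a b c d"
proof
  assume k: "k4p nb w a b c d"
  note K = k[unfolded k4p_def]
  define X where "X = {a, b, c, d}"
  have in_nw: "a \<in> nb w" "b \<in> nb w" using K nb_sym[of w a] nb_sym[of w b] by auto
  have nin: "c \<notin> nb w" "d \<notin> nb w" using K nb_sym[of c w] nb_sym[of d w] by auto
  have "{a, b} \<subset> nb w" using gd k in_nw unfolding good_def by blast
  then have "card {a, b} < card (nb w)" by (intro psubset_card_mono) auto
  then have cw: "card (nb w) = 3" using K nb_card[of w] by simp
  have nwX: "nb w \<inter> X = {a, b}" using in_nw nin by (auto simp: X_def)
  have cwX: "card (nb w \<inter> X) = 2" using nwX K by simp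
  have cd: "card (nb w - X) = 1" using cw cwX by (simp add: card_Diff_subset_Int Int_commute)
  have XV: "X \<subseteq> V"
  proof -
    have "a \<in> V" "b \<in> V" "c \<in> V" "d \<in> V" using K nb_outside by blast+
    then show ?thesis by (simp add: X_def)
  qed
  have out: "nb z \<inter> X = {}" if "z \<notin> X" "z \<noteq> w" for z
  proof -
    have "x \<notin> nb z" if "x \<in> X" for x
      using nb_sym[of x z] K \<open>z \<notin> X\<close> \<open>z \<noteq> w\<close> that unfolding X_def by auto
    then show ?thesis by blast
  qed
  \<comment> \<open>Only \<open>w\<close> loses edges, and it keeps exactly one. It cannot become
    the degree 2 vertex of a new component \<open>K4_plus\<close>, and no other vertex has
    changed.\<close>
  have "good (delete nb X)"
    unfolding good_def
  proof (intro conjI allI impI notI)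
    fix w' a' b' c' d'
    assume k': "k4p (delete nb X) w' a' b' c' d'" and w': "delete nb X w' = {a', b'}"
    have "a' \<noteq> b'" using k' unfolding k4p_def by simp
    then have c2: "card (delete nb X w') = 2" using w' by simp
    then have "w' \<notin> X" by (auto simp: delete_def)
    moreover have "w' \<noteq> w" using c2 cd by (auto simp: delete_def split: if_splits)
    ultimately have "delete nb X w' = nb w'" using out[of w'] by (auto simp: delete_def)
    then show False using gd k4p_delete[OF k'] w' unfolding good_def by metis
  next
    fix a b c x y z assume "k33 (delete nb X) a b c x y z"
    then show False using k33_delete gd unfolding good_def by blast
  qed
  \<comment> \<open>The induced edge \<open>{a, c}\<close> leaves \<open>X\<close> only through
    \<open>a\<close> and \<open>w\<close>. The price is 0 since \<open>w\<close> drops from degree 3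
    to 1, so the cost is the weight 12 of the four deleted vertices.\<close>
  from deletion_good[OF XV this, of "{a, c}" a w "\<lambda>_. 0"]
  have "6 * card {a, c} < (\<Sum>x\<in>X. wt (card (nb x)))"
  proof -
    have "ptree nb {a, c}" by (rule ptree_edge) (use K in auto)
    moreover have "wt (card (nb z)) \<le> wt (card (nb z - X)) + 0 * card (nb z \<inter> X)"
      if "z \<in> V - X" "nb z \<inter> X \<noteq> {}" for z
      using out[of z] that wt_loss_zero[OF cw cwX] by auto
    ultimately show ?thesis
      using deletion_good[OF XV \<open>good (delete nb X)\<close>, of "{a, c}" a w "\<lambda>_. 0"] K
      by (auto simp: X_def)
  qed
  also have "\<dots> \<le> (\<Sum>x\<in>X. 3)" by (intro sum_mono wt_nb_le3)
  also have "\<dots> = 12" using K by (simp add: X_def)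
  finally show False using K by simp
qed

text \<open>With every \<open>k4p\<close> excluded, pendant or not, no deletion can leave an
  exceptional component. Goodness need not be checked again.\<close>

lemma good_delete: "good (delete nb X)"
  unfolding good_def using k4p_delete k33_delete no_k4p gd good_def by metis

lemma deletion:
  fixes \<kappa> :: "'a \<Rightarrow> nat"
  assumes X: "X \<subseteq> V"
    and Y: "ptree nb Y" "Y \<subseteq> X" "\<And>y. y \<in> Y \<Longrightarrow> y \<noteq> y0 \<Longrightarrow> nb y \<subseteq> X" "nb y0 \<subseteq> insert z0 X"
    and k: "\<And>z. z \<in> V - X \<Longrightarrow> nb z \<inter> X \<noteq> {} \<Longrightarrow>
      wt (card (nb z)) \<le> wt (card (nb z - X)) + \<kappa> z * card (nb z \<inter> X)"
  shows "6 * card Y < (\<Sum>x\<in>X. wt (card (nb x)) + (\<Sum>z\<in>nb x - X. \<kappa> z))"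
  using deletion_good[OF X good_delete Y k] by blast

abbreviation kap :: "'a \<Rightarrow> nat" where
  "kap z \<equiv> (if card (nb z) = 1 then 3 else 1)"

lemmas deletion_kap = deletion[where \<kappa> = kap, OF _ _ _ _ _ wt_loss]

section \<open>Excluding vertices of degree at most one\<close>

lemma no_isolated: "v \<in> V \<Longrightarrow> nb v \<noteq> {}"
proof
  assume v: "v \<in> V" "nb v = {}"
  from IH[of "{v}"] v(1) good_delete obtain F where F: "F \<subseteq> V - {v}" "pforest nb F"
    "(\<Sum>u\<in>V - {v}. wt (card (nb u - {v}))) \<le> 6 * card F" by blast
  have "nb u - {v} = nb u" for u using v(2) nb_sym[of v u] by auto
  moreover have "(\<Sum>u\<in>V. wt (card (nb u))) = (\<Sum>u\<in>V - {v}. wt (card (nb u)))"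
    using v fin by (simp add: sum.remove)
  ultimately show False using F no_forest by auto
qed

text \<open>The edge \<open>{x, y}\<close> gains 12. Deleting it costs at most 3 + 3 + 3 if
  \<open>x\<close> has degree at most 2; if \<open>q\<close> is another leaf at \<open>x\<close>,
  deleting \<open>{x, y, q}\<close> costs at most 9 + 3.\<close>

lemma leaf_support:
  assumes y: "nb y = {x}"
  obtains p q where "nb x = {y, p, q}" "distinct [x, y, p, q]" "card (nb p) \<ge> 2" "card (nb q) \<ge> 2"
proof -
  have yx: "y \<in> nb x" using y nb_sym[of x y] by auto
  have V: "x \<in> V" "y \<in> V" using y yx nb_sub by blast+
  have xy: "x \<noteq> y" using yx nb_irr by auto
  have ne: "p \<noteq> x" if "p \<in> nb x" for p using that nb_irr by auto
  have pt: "ptree nb {x, y}" by (rule ptree_edge[OF yx])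
  have c3: "card (nb x) = 3"
  proof (rule ccontr)
    assume "card (nb x) \<noteq> 3"
    then have "card (nb x - {y}) \<le> 1" using nb_card[of x] yx by simp
    then obtain p where p: "nb x - {y} \<subseteq> {p}"
      by (metis card_0_eq card_1_singletonE fin_nb finite_Diff le_Suc_eq le_zero_eq One_nat_def empty_subsetI order_refl)
    have "6 * card {x, y} < (\<Sum>v\<in>{x, y}. wt (card (nb v)) + (\<Sum>z\<in>nb v - {x, y}. kap z))"
      by (rule deletion_kap[of _ _ x p]) (use V pt y p in auto)
    also have "\<dots> = wt (card (nb x)) + (\<Sum>z\<in>nb x - {x, y}. kap z) + 3"
      using xy y by simp
    also have "(\<Sum>z\<in>nb x - {x, y}. kap z) \<le> (\<Sum>z\<in>{p}. kap z)"
      by (intro sum_mono2) (use p in auto)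
    also have "\<dots> \<le> 3" by simp
    finally show False using xy wt_nb_le3[of x] by simp
  qed
  then have "card (nb x - {y}) = 2" using yx by simp
  then obtain p q where pq: "nb x - {y} = {p, q}" "p \<noteq> q" by (meson card_2_iff)
  then have nx: "nb x = {y, p, q}" using yx by blast
  have dist: "distinct [x, y, p, q]" using pq xy ne[of p] ne[of q] nx by auto
  have ge2: "card (nb q) \<ge> 2" if n: "nb x = {y, p, q}" and d: "distinct [x, y, p, q]" for p q
  proof (rule ccontr)
    assume "\<not> ?thesis"
    moreover have "x \<in> nb q" using n nb_sym[of q x] by auto
    ultimately have q: "nb q = {x}" using card_le_Suc0_iff_eq[of "nb q"] by auto
    have "q \<in> V" using n nb_sub by blast
    have "6 * card {x, y} < (\<Sum>v\<in>{x, y, q}. wt (card (nb v)) + (\<Sum>z\<in>nb v - {x, y, q}. kap z))"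
      by (rule deletion_kap[of _ _ x p]) (use V pt y q n \<open>q \<in> V\<close> in auto)
    also have "\<dots> = 9 + (\<Sum>z\<in>nb x - {x, y, q}. kap z)"
      using d y n q c3 by simp
    also have "(\<Sum>z\<in>nb x - {x, y, q}. kap z) \<le> (\<Sum>z\<in>{p}. kap z)"
      by (intro sum_mono2) (use n in auto)
    also have "\<dots> \<le> 3" by simp
    finally show False using xy by simp
  qed
  have "card (nb q) \<ge> 2" using ge2[OF nx dist] .
  moreover have "card (nb p) \<ge> 2" by (rule ge2[of q p]) (use nx dist in auto)
  ultimately show ?thesis using that nx dist by blast
qed

text \<open>Delete \<open>{x, y, p}\<close> with the edge \<open>{x, y}\<close>: the weights are at
  most 9, the edge to \<open>q\<close> adds 1, and the at most two further edges at \<open>p\<close>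
  add 1 each, 12 in all, unless one of them ends in a leaf.\<close>

lemma leaf_next:
  assumes y: "nb y = {x}" and x: "nb x = {y, p, q}" and d: "distinct [x, y, p, q]"
    and q2: "card (nb q) \<ge> 2"
  obtains p' where "nb p' = {p}" "p' \<noteq> y"
proof (rule ccontr)
  assume no: "\<not> thesis"
  have V: "x \<in> V" "y \<in> V" "p \<in> V" using x y nb_sub by blast+
  have xp: "x \<in> nb p" using x nb_sym[of p x] by auto
  have nl: "kap z = 1" if "z \<in> nb p" "z \<noteq> x" for z
  proof -
    have "card (nb z) \<noteq> 1"
    proof
      assume "card (nb z) = 1"
      then obtain s where s: "nb z = {s}" by (rule card_1_singletonE)
      then have "s = p" using that nb_sym[of z p] by auto
      then have "nb z = {p}" using s by simp
      moreover have "z \<noteq> y" using y \<open>nb z = {p}\<close> d by auto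
      ultimately show False using no that(1) \<open>\<And>p'. \<lbrakk>nb p' = {p}; p' \<noteq> y\<rbrakk> \<Longrightarrow> thesis\<close> by blast
    qed
    then show ?thesis by simp
  qed
  have pt: "ptree nb {x, y}" by (rule ptree_edge) (use x in auto)
  have "6 * card {x, y} < (\<Sum>v\<in>{x, y, p}. wt (card (nb v)) + (\<Sum>z\<in>nb v - {x, y, p}. kap z))"
    by (rule deletion_kap[of _ _ x q]) (use V pt x y in auto)
  also have "\<dots> = wt (card (nb x)) + (\<Sum>z\<in>nb x - {x, y, p}. kap z) + 3
      + wt (card (nb p)) + (\<Sum>z\<in>nb p - {x, y, p}. kap z)"
    using d y by simp
  also have "(\<Sum>z\<in>nb x - {x, y, p}. kap z) = 1"
  proof -
    have "nb x - {x, y, p} = {q}" using x d by auto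
    then show ?thesis using q2 by simp
  qed
  also have "(\<Sum>z\<in>nb p - {x, y, p}. kap z) = (\<Sum>z\<in>nb p - {x, y, p}. 1)"
    by (intro sum.cong refl nl) auto
  also have "\<dots> = card (nb p - {x, y, p})" by simp
  also have "\<dots> \<le> card (nb p - {x})" by (intro card_mono) auto
  also have "\<dots> \<le> 2" using nb_card[of p] xp by simp
  finally show False using d wt_nb_le3[of x] wt_nb_le3[of p] by simp
qed

text \<open>The support \<open>x\<close> of a leaf has two neighbours \<open>p\<close>,
  \<open>q\<close> that carry leaves \<open>p'\<close>, \<open>q'\<close> themselves. The induced
  path \<open>y\<close>, \<open>x\<close>, \<open>p\<close>, \<open>p'\<close> gains 24, while
  deleting it together with \<open>q\<close> costs at most 15 for the five vertices, 1 for
  \<open>r\<close>, 3 for \<open>q'\<close> and 1 for \<open>s\<close>.\<close>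

lemma min_degree: "v \<in> V \<Longrightarrow> card (nb v) \<ge> 2"
proof (rule ccontr)
  fix y assume y: "y \<in> V" and c: "\<not> 2 \<le> card (nb y)"
  have "card (nb y) \<noteq> 0" using no_isolated[OF y] by simp
  then have "card (nb y) = 1" using c by linarith
  then obtain x where nx: "nb y = {x}" by (rule card_1_singletonE)
  from leaf_support[OF nx] obtain p q where pq: "nb x = {y, p, q}" "distinct [x, y, p, q]"
    "card (nb p) \<ge> 2" "card (nb q) \<ge> 2" by blast
  have qp: "nb x = {y, q, p}" "distinct [x, y, q, p]" using pq by auto
  from leaf_next[OF nx pq(1,2,4)] obtain p' where p': "nb p' = {p}" "p' \<noteq> y" by blast
  from leaf_next[OF nx qp pq(3)] obtain q' where q': "nb q' = {q}" "q' \<noteq> y" by blast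
  from leaf_support[OF p'(1)] obtain r0 r1 where r01: "nb p = {p', r0, r1}" "distinct [p, p', r0, r1]"
    "card (nb r0) \<ge> 2" "card (nb r1) \<ge> 2" by blast
  from leaf_support[OF q'(1)] obtain s0 s1 where s01: "nb q = {q', s0, s1}" "distinct [q, q', s0, s1]"
    "card (nb s0) \<ge> 2" "card (nb s1) \<ge> 2" by blast
  have c3x: "card (nb x) = 3" "card (nb p) = 3" "card (nb q) = 3" using pq r01 s01 by auto
  have "p' \<noteq> x" "q' \<noteq> x" using p' q' c3x by auto
  have xp: "x \<in> nb p" using pq nb_sym[of p x] by auto
  have xq: "x \<in> nb q" using pq nb_sym[of q x] by auto
  obtain r where r: "nb p = {p', x, r}" "card (nb r) \<ge> 2"
    using xp r01 \<open>p' \<noteq> x\<close> by (metis insertE insert_commute singletonD)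
  obtain s where s: "nb q = {q', x, s}" "card (nb s) \<ge> 2"
    using xq s01 \<open>q' \<noteq> x\<close> by (metis insertE insert_commute singletonD)
  have pq': "p' \<noteq> q" "p' \<noteq> p" using p' c3x by auto
  have V: "x \<in> V" "y \<in> V" "p \<in> V" "q \<in> V" "p' \<in> V"
    using pq(1) r(1) nb_mem[of y x] nb_mem[of p x] nb_mem[of q x] nb_mem[of p' p] by auto
  let ?Y = "{x, y, p, p'}"
  let ?X = "{x, y, p, p', q}"
  have "ptree nb {p, p'}" by (rule ptree_edge) (use r in auto)
  then have "ptree nb (insert x (insert y {p, p'}))"
    by (rule ptree.add[where r = p]) (use pq nx p' pq' \<open>p' \<noteq> x\<close> in auto)
  then have "6 * card ?Y < (\<Sum>v\<in>?X. wt (card (nb v)) + (\<Sum>z\<in>nb v - ?X. kap z))"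
    by (intro deletion_kap[of _ _ p r]) (use V pq nx p' r in auto)
  also have "\<dots> = (\<Sum>v\<in>?X. wt (card (nb v))) + (\<Sum>v\<in>?X. \<Sum>z\<in>nb v - ?X. kap z)"
    by (rule sum.distrib)
  also have "(\<Sum>v\<in>?X. wt (card (nb v))) \<le> (\<Sum>v\<in>?X. 3)" by (intro sum_mono wt_nb_le3)
  also have "\<dots> = 15" using pq pq' p' \<open>p' \<noteq> x\<close> by simp
  also have "(\<Sum>v\<in>?X. \<Sum>z\<in>nb v - ?X. kap z) = (\<Sum>z\<in>nb p - ?X. kap z) + (\<Sum>z\<in>nb q - ?X. kap z)"
  proof -
    define f where "f v = (\<Sum>z\<in>nb v - ?X. kap z)" for v
    have "nb x - ?X = {}" "nb y - ?X = {}" "nb p' - ?X = {}" using pq nx p' by auto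
    then have "f x = 0" "f y = 0" "f p' = 0" by (simp_all only: f_def sum.empty)
    moreover have "distinct [x, y, p, p', q]" using pq pq' p' \<open>p' \<noteq> x\<close> by auto
    ultimately have "sum f ?X = f p + f q" by simp
    then show ?thesis unfolding f_def .
  qed
  also have "(\<Sum>z\<in>nb p - ?X. kap z) \<le> (\<Sum>z\<in>{r}. kap z)"
    by (intro sum_mono2) (use r in auto)
  also have "\<dots> = 1" using r(2) by simp
  also have "(\<Sum>z\<in>nb q - ?X. kap z) \<le> (\<Sum>z\<in>{q', s}. kap z)"
    by (intro sum_mono2) (use s in auto)
  also have "\<dots> \<le> 4"
    using s(2) q' by (cases "q' = s") auto
  finally have "6 * card ?Y < 20" by simp
  moreover have "card ?Y = 4" using pq pq' p' \<open>p' \<noteq> x\<close> by simp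
  ultimately show False by simp
qed

lemma wt_nb: "v \<in> V \<Longrightarrow> wt (card (nb v)) = card (nb v)"
  using min_degree[of v] by (simp add: wt_def)

text \<open>Without leaves, weight is degree and every edge out of \<open>X\<close> has price
  1.\<close>

lemma deletion_count:
  assumes X: "X \<subseteq> V"
    and Y: "ptree nb Y" "Y \<subseteq> X" "\<And>y. y \<in> Y \<Longrightarrow> y \<noteq> y0 \<Longrightarrow> nb y \<subseteq> X" "nb y0 \<subseteq> insert z0 X"
  shows "6 * card Y < (\<Sum>x\<in>X. card (nb x) + card (nb x - X))"
proof -
  have "6 * card Y < (\<Sum>x\<in>X. wt (card (nb x)) + (\<Sum>z\<in>nb x - X. kap z))"
    by (rule deletion_kap[OF X Y])
  also have "\<dots> = (\<Sum>x\<in>X. card (nb x) + card (nb x - X))"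
  proof (intro sum.cong refl)
    fix x assume "x \<in> X"
    then have "wt (card (nb x)) = card (nb x)" using X wt_nb by blast
    moreover have "(\<Sum>z\<in>nb x - X. kap z) = (\<Sum>z\<in>nb x - X. 1)"
    proof (intro sum.cong refl)
      fix z assume "z \<in> nb x - X"
      then have "z \<in> V" using nb_sub by blast
      then show "kap z = 1" using min_degree[of z] by simp
    qed
    ultimately show "wt (card (nb x)) + (\<Sum>z\<in>nb x - X. kap z) = card (nb x) + card (nb x - X)" by simp
  qed
  finally show ?thesis .
qed

text \<open>Each vertex of \<open>X\<close> contributes its degree plus its outer degree; adding its
  inner degree gives twice the degree, at most 6. Hence a deletion succeeds as soon as
  \<open>X\<close> spans 3(|X| - |Y|) edges.\<close>

lemma deletion_edges:
  assumes X: "X \<subseteq> V"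
    and Y: "ptree nb Y" "Y \<subseteq> X" "\<And>y. y \<in> Y \<Longrightarrow> y \<noteq> y0 \<Longrightarrow> nb y \<subseteq> X" "nb y0 \<subseteq> insert z0 X"
  shows "6 * card Y + (\<Sum>x\<in>X. card (nb x \<inter> X)) < 6 * card X"
proof -
  have "6 * card Y + (\<Sum>x\<in>X. card (nb x \<inter> X)) <
    (\<Sum>x\<in>X. card (nb x) + card (nb x - X)) + (\<Sum>x\<in>X. card (nb x \<inter> X))"
    using deletion_count[OF assms] by simp
  also have "\<dots> = (\<Sum>x\<in>X. 2 * card (nb x))"
    unfolding sum.distrib[symmetric]
  proof (intro sum.cong refl)
    fix x
    have "card (nb x) = card (nb x - X) + card (nb x \<inter> X)"
      using card_Int_Diff[of "nb x" X] by simp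
    then show "card (nb x) + card (nb x - X) + card (nb x \<inter> X) = 2 * card (nb x)" by simp
  qed
  also have "\<dots> \<le> (\<Sum>x\<in>X. 6)" using nb_card by (intro sum_mono) (simp add: mult_le_mono2[of _ 3 2, simplified])
  finally show ?thesis by simp
qed

end

lemma card_ge_subset: "finite A \<Longrightarrow> B \<subseteq> A \<Longrightarrow> card B = n \<Longrightarrow> n \<le> card A"
  using card_mono by blast

context subcubic_nbs
begin

lemma ptree_path4:
  assumes "b \<in> nb a" "c \<in> nb b" "d \<in> nb c" "c \<notin> nb a" "d \<notin> nb a" "d \<notin> nb b" "distinct [a, b, c, d]"
  shows "ptree nb {a, b, c, d}"
proof -
  have "ptree nb {c, d}" by (rule ptree_edge[OF assms(3)])
  then have "ptree nb (insert b (insert a {c, d}))"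
    by (rule ptree.add[where r = c]) (use assms nb_sym[OF assms(1)] in auto)
  then show ?thesis by (simp add: insert_commute)
qed

lemma handshake: "finite S \<Longrightarrow> even (\<Sum>v\<in>S. card (nb v \<inter> S))"
proof (induction rule: finite_induct)
  case (insert a S)
  have step: "card (nb v \<inter> insert a S) = card (nb v \<inter> S) + (if v \<in> nb a then 1 else 0)" for v
  proof (cases "v \<in> nb a")
    case True
    then have "nb v \<inter> insert a S = insert a (nb v \<inter> S)" using nb_sym[OF True] by auto
    then show ?thesis using insert.hyps True by simp
  next
    case False
    then have "nb v \<inter> insert a S = nb v \<inter> S" using nb_sym[of a v] by auto
    then show ?thesis using False by simp
  qed
  have "(\<Sum>v\<in>S. if v \<in> nb a then 1 else 0) = card (nb a \<inter> S)"
    using insert.hyps by (simp add: sum.If_cases Int_commute)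
  then have "(\<Sum>v\<in>insert a S. card (nb v \<inter> insert a S)) =
      (\<Sum>v\<in>S. card (nb v \<inter> S)) + 2 * card (nb a \<inter> S)"
    using insert.hyps nb_irr[of a] by (simp add: step sum.distrib)
  then show ?case using insert.IH by simp
qed simp

end

context minimal_counterexample
begin

text \<open>If \<open>u, y, x, x'\<close> are deleted then \<open>v\<close> drops from degree 3 to 1 without any loss of weight, which
  is what makes the matching edge \<open>{u, x'}\<close> pay.\<close>

lemma no_shared_triple:
  assumes u: "nb u = {v, x, x'}" and y: "nb y = {v, x, x'}" and uy: "u \<noteq> y" and d: "distinct [v, x, x']"
    and v3: "card (nb v) = 3" and x': "nb x' \<subseteq> {u, y, x}"
  shows False
proof -
  have m: "u \<in> nb v" "y \<in> nb v" "u \<in> nb x" "y \<in> nb x" "u \<in> nb x'" "y \<in> nb x'"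
    using nb_sym[of v u] nb_sym[of v y] nb_sym[of x u] nb_sym[of x y] nb_sym[of x' u] nb_sym[of x' y]
      u y by auto
  have ne: "u \<noteq> v" "u \<noteq> x" "u \<noteq> x'" "y \<noteq> v" "y \<noteq> x" "y \<noteq> x'" using m nb_irr by auto
  have full: "nb s = {a, b, c}" if "{a, b, c} \<subseteq> nb s" "distinct [a, b, c]" for s a b c
  proof -
    have "card {a, b, c} = 3" using that by simp
    then show ?thesis using that(1) nb_card[of s] card_seteq[OF fin_nb that(1)] by auto
  qed
  show False
  proof (cases "x \<in> nb x'")
    case True
    then have "nb x' = {u, y, x}" using x' m by auto
    moreover have "nb x = {u, y, x'}"
      by (rule full) (use m nb_sym[OF True] ne uy in auto)
    ultimately have "k4p nb v u y x x'" unfolding k4p_def using u y ne uy d by auto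
    then show False using no_k4p by blast
  next
    case False
    then have nx': "nb x' = {u, y}" using x' m by auto
    show False
    proof (cases "v \<in> nb x")
      case True
      have "nb x = {u, y, v}" by (rule full) (use m True ne uy in auto)
      moreover have "nb v = {u, y, x}" by (rule full) (use m nb_sym[OF True] ne uy in auto)
      ultimately have "k4p nb x' u y v x" unfolding k4p_def using u y ne uy d nx' by auto
      then show False using no_k4p by blast
    next
      case vx: False
      let ?X = "{u, y, x, x'}"
      let ?k = "\<lambda>z. if z = v then 0 else 1 :: nat"
      have XV: "?X \<subseteq> V"
        using m nb_mem[of u v] nb_mem[of y v] nb_mem[of u x] nb_mem[of u x'] by auto
      have vX: "nb v \<inter> ?X = {u, y}"
        using m vx nx' ne d nb_sym[of x v] nb_sym[of x' v] by auto
      have k: "wt (card (nb z)) \<le> wt (card (nb z - ?X)) + ?k z * card (nb z \<inter> ?X)"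
        if "z \<in> V - ?X" for z
      proof (cases "z = v")
        case True
        then show ?thesis using wt_loss_zero[OF v3, of ?X] vX uy by simp
      next
        case False
        then show ?thesis using wt_loss[of z ?X] min_degree[of z] that by auto
      qed
      have "6 * card {u, x'} < (\<Sum>w\<in>?X. wt (card (nb w)) + (\<Sum>z\<in>nb w - ?X. ?k z))"
      proof (rule deletion[OF XV, where ?y0.0 = u and ?z0.0 = v])
        show "ptree nb {u, x'}" by (rule ptree_edge) (use u in auto)
      qed (use k u nx' in auto)
      \<comment> \<open>The edges to \<open>v\<close> are free, so \<open>u\<close> and
        \<open>y\<close> cost 3 each; \<open>x\<close> has at most one neighbour outside, and
        \<open>x'\<close> has degree 2 and none.\<close>
      also have "\<dots> \<le> 3 + 3 + 4 + 2"
      proof -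
        have a: "nb u - ?X = {v}" "nb y - ?X = {v}" using u y ne d uy by auto
        have b: "nb x' - ?X = {}" using nx' by auto
        have "(\<Sum>z\<in>nb x - ?X. ?k z) \<le> card (nb x - ?X)"
          using sum_bounded_above[of "nb x - ?X" ?k 1] by auto
        also have "\<dots> \<le> card (nb x - {u, y})" by (intro card_mono) auto
        also have "\<dots> \<le> 1" using nb_card[of x] m uy by (simp add: card_Diff_subset)
        finally have c: "(\<Sum>z\<in>nb x - ?X. ?k z) \<le> 1" .
        define f where "f w = wt (card (nb w)) + (\<Sum>z\<in>nb w - ?X. ?k z)" for w
        have "f u \<le> 3" "f y \<le> 3" using wt_nb_le3[of u] wt_nb_le3[of y] unfolding f_def a by simp_all
        moreover have "f x' \<le> 2" unfolding f_def b using uy by (simp add: nx' wt_def)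
        moreover have "f x \<le> 4" unfolding f_def using c wt_nb_le3[of x] by linarith
        ultimately have "sum f ?X \<le> 3 + 3 + 4 + 2" using ne uy d by simp
        then show ?thesis unfolding f_def .
      qed
      finally show False using ne by simp
    qed
  qed
qed

end

section \<open>A largest tree\<close>

locale maximal_tree = minimal_counterexample +
  fixes T :: "'a set"
  assumes T_ptree: "ptree nb T"
    and T_max: "ptree nb T' \<Longrightarrow> card T' \<le> card T"
begin

definition N :: "'a set" where
  "N = {v \<in> V - T. nb v \<inter> T \<noteq> {}}"

definition attached :: "'a \<Rightarrow> 'a \<Rightarrow> bool" where
  "attached e x \<longleftrightarrow> x \<notin> T \<and> nb x \<inter> T = {e}"

text \<open>The amount by which the vertex \<open>v\<close> of \<open>N\<close> lowers the cost of deleting \<open>T \<union> N\<close>. Although it is a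
  truncated subtraction, it is exact for \<open>v \<in> N\<close> (lemma \<open>slack_eq\<close>).\<close>

definition slack :: "'a \<Rightarrow> nat" where
  "slack v = 3 * card (nb v \<inter> T) - (card (nb v) + card (nb v - (T \<union> N)))"

lemma T_fin: "finite T" using T_ptree by (rule ptree_fin)
lemma T_sub: "T \<subseteq> V" using T_ptree by (rule ptree_sub)
lemma N_fin: "finite N" using fin by (simp add: N_def)

lemma N_iff: "v \<in> N \<longleftrightarrow> v \<notin> T \<and> nb v \<inter> T \<noteq> {}"
  using nb_outside[of v] by (auto simp: N_def)

lemma nb_in_N: "u \<in> T \<Longrightarrow> x \<in> nb u \<Longrightarrow> x \<notin> T \<Longrightarrow> x \<in> N"
  using nb_sym[of x u] by (auto simp: N_iff)

text \<open>Stated for every tree of the size of \<open>T\<close>, because exchanging a hanging pair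
  yields further largest trees.\<close>

lemma extension:
  assumes "ptree nb S" "card S = card T" "p \<notin> S" "l \<notin> S" "l \<in> nb p" "nb p \<inter> S = {r}" "nb l \<inter> S = {}"
  shows False
proof -
  have "p \<noteq> l" using assms(5) nb_irr by auto
  then have "ptree nb (insert p (insert l S))" using assms by (intro ptree.add)
  then have "card (insert p (insert l S)) \<le> card T" by (rule T_max)
  then show False using assms \<open>p \<noteq> l\<close> ptree_fin[OF assms(1)] by simp
qed

lemma attached_closed: "attached e x \<Longrightarrow> y \<in> nb x \<Longrightarrow> y \<notin> T \<Longrightarrow> y \<in> N"
  using extension[OF T_ptree refl, of x y e] by (auto simp: N_iff attached_def)

text \<open>The new vertices only have to avoid \<open>T - {u, v}\<close>, so one of them may be
  \<open>u\<close> or \<open>v\<close> again. Keeping one vertex of the pair and changing its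
  partner is an exchange too.\<close>

lemma swap:
  assumes h: "hanging nb T u v w" and "p \<notin> T - {u, v}" "l \<notin> T - {u, v}" "l \<in> nb p"
    "nb p \<inter> (T - {u, v}) = {r}" "nb l \<inter> (T - {u, v}) = {}"
  shows "ptree nb (insert p (insert l (T - {u, v})))" "card (insert p (insert l (T - {u, v}))) = card T"
proof -
  note hd = hangingD[OF h]
  have "p \<noteq> l" using assms nb_irr by auto
  then show "ptree nb (insert p (insert l (T - {u, v})))"
    using hanging_remove[OF T_ptree h] assms by (intro ptree.add)
  have "card (T - {u, v}) + 2 = card T"
    using hd T_fin card_Int_Diff[of T "{u, v}"] by (simp add: Int_absorb1)
  then show "card (insert p (insert l (T - {u, v}))) = card T"
    using assms T_fin \<open>p \<noteq> l\<close> by simp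
qed

lemma swap_extension:
  assumes h: "hanging nb T u v w" and "p \<notin> T - {u, v}" "l \<notin> T - {u, v}" "l \<in> nb p"
    "nb p \<inter> (T - {u, v}) = {r}" "nb l \<inter> (T - {u, v}) = {}"
    and "p' \<notin> insert p (insert l (T - {u, v}))" "l' \<notin> insert p (insert l (T - {u, v}))" "l' \<in> nb p'"
    "nb p' \<inter> insert p (insert l (T - {u, v})) = {r'}" "nb l' \<inter> insert p (insert l (T - {u, v})) = {}"
  shows False
  using extension[OF swap[OF assms(1-6)] assms(7-)] .

text \<open>One neighbour in \<open>T\<close>: no edge leaves \<open>T \<union> N\<close>, and the
  slack is 3 minus the degree. Two: at most one edge leaves, so degree plus outer degree is at most
  4, and the slack is at least 6 - 4. Three: it is 9 - 3.\<close>

lemma slack_eq: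
  assumes "v \<in> N"
  shows "slack v + (card (nb v) + card (nb v - (T \<union> N))) = 3 * card (nb v \<inter> T)"
    and "card (nb v) = card (nb v \<inter> T) + card (nb v \<inter> N) + card (nb v - (T \<union> N))"
    and "card (nb v \<inter> T) \<ge> 1"
    and "card (nb v \<inter> T) \<ge> 2 \<Longrightarrow> slack v \<ge> 2"
proof -
  have "card (nb v) = card (nb v \<inter> (T \<union> N)) + card (nb v - (T \<union> N))"
    by (rule card_Int_Diff) simp
  moreover have "nb v \<inter> (T \<union> N) = (nb v \<inter> T) \<union> (nb v \<inter> N)" by blast
  moreover have "card ((nb v \<inter> T) \<union> (nb v \<inter> N)) = card (nb v \<inter> T) + card (nb v \<inter> N)"
    by (rule card_Un_disjoint) (auto simp: N_iff)
  ultimately show sp: "card (nb v) = card (nb v \<inter> T) + card (nb v \<inter> N) + card (nb v - (T \<union> N))"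
    by simp
  have "nb v \<inter> T \<noteq> {}" using assms by (simp add: N_iff)
  then show g1: "card (nb v \<inter> T) \<ge> 1" by (simp add: Suc_le_eq card_gt_0_iff)
  show "slack v + (card (nb v) + card (nb v - (T \<union> N))) = 3 * card (nb v \<inter> T)"
  proof (cases "card (nb v \<inter> T) \<ge> 2")
    case True
    then show ?thesis using sp nb_card[of v] by (simp add: slack_def)
  next
    case False
    then have "card (nb v \<inter> T) = 1" using g1 by simp
    then obtain e where "nb v \<inter> T = {e}" by (rule card_1_singletonE)
    then have "attached e v" using assms by (simp add: attached_def N_iff)
    then have "nb v - (T \<union> N) = {}" using attached_closed by blast
    then have "card (nb v - (T \<union> N)) = 0" by (simp only: card.empty)
    then show ?thesis using nb_card[of v] \<open>card (nb v \<inter> T) = 1\<close> unfolding slack_def by linarith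
  qed
  then show "card (nb v \<inter> T) \<ge> 2 \<Longrightarrow> slack v \<ge> 2" using sp nb_card[of v] by linarith
qed

text \<open>Counting gives the bound 5; the handshake lemma for \<open>N\<close> makes the left-hand side even.\<close>

lemma slack_budget: "(\<Sum>v\<in>N. slack v) + 4 * (\<Sum>v\<in>T. 3 - card (nb v)) \<le> 4"
proof -
  let ?X = "T \<union> N"
  let ?D = "\<Sum>v\<in>T. card (nb v)"
  have XV: "?X \<subseteq> V" using T_sub by (auto simp: N_def)
  have TX: "nb v \<subseteq> ?X" if "v \<in> T" for v using nb_in_N[OF that] by blast
  have disj: "T \<inter> N = {}" by (auto simp: N_def)
  obtain t where t: "t \<in> T" using ptree_card_ge2[OF T_ptree] by fastforce
  have "6 * card T < (\<Sum>x\<in>?X. card (nb x) + card (nb x - ?X))"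
    by (rule deletion_count[OF XV T_ptree, where ?y0.0 = t and ?z0.0 = t]) (use TX t in auto)
  also have "\<dots> = (\<Sum>x\<in>T. card (nb x) + card (nb x - ?X)) + (\<Sum>x\<in>N. card (nb x) + card (nb x - ?X))"
    by (rule sum.union_disjoint) (use T_fin N_fin disj in auto)
  also have "(\<Sum>x\<in>T. card (nb x) + card (nb x - ?X)) = ?D"
  proof (rule sum.cong[OF refl])
    fix x assume "x \<in> T"
    then have "nb x - ?X = {}" using TX by blast
    then show "card (nb x) + card (nb x - ?X) = card (nb x)" by (simp only: card.empty)
  qed
  finally have 1: "6 * card T < ?D + (\<Sum>x\<in>N. card (nb x) + card (nb x - ?X))" .
  have "(\<Sum>v\<in>N. 1 * card (nb v \<inter> T)) = (\<Sum>x\<in>T. \<Sum>z\<in>nb x \<inter> N. 1)"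
    by (rule sum_swap_nb) (use T_sub in \<open>auto simp: N_def\<close>)
  then have "(\<Sum>v\<in>N. card (nb v \<inter> T)) = (\<Sum>x\<in>T. card (nb x \<inter> N))" by simp
  moreover have "?D = (\<Sum>x\<in>T. card (nb x \<inter> T) + card (nb x \<inter> N))"
  proof (rule sum.cong[OF refl])
    fix x assume "x \<in> T"
    then have "nb x = (nb x \<inter> T) \<union> (nb x \<inter> N)" using TX by blast
    then have "card (nb x) = card ((nb x \<inter> T) \<union> (nb x \<inter> N))" by simp
    also have "\<dots> = card (nb x \<inter> T) + card (nb x \<inter> N)"
      by (rule card_Un_disjoint) (use disj in auto)
    finally show "card (nb x) = card (nb x \<inter> T) + card (nb x \<inter> N)" .
  qed
  ultimately have 2: "(\<Sum>v\<in>N. card (nb v \<inter> T)) + 2 * card T = ?D + 2"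
    using ptree_degree_sum[OF T_ptree] by (simp add: sum.distrib)
  have 3: "(\<Sum>v\<in>N. slack v) + (\<Sum>x\<in>N. card (nb x) + card (nb x - ?X)) = 3 * (\<Sum>v\<in>N. card (nb v \<inter> T))"
    unfolding sum.distrib[symmetric] sum_distrib_left by (rule sum.cong[OF refl]) (rule slack_eq(1))
  have 4: "(\<Sum>v\<in>T. 3 - card (nb v)) + ?D = 3 * card T"
  proof -
    have "(\<Sum>v\<in>T. 3 - card (nb v)) + ?D = (\<Sum>v\<in>T. 3)"
      unfolding sum.distrib[symmetric] by (rule sum.cong[OF refl]) (use nb_card in simp)
    then show ?thesis by simp
  qed
  have 5: "(\<Sum>v\<in>N. card (nb v)) =
    (\<Sum>v\<in>N. card (nb v \<inter> T)) + (\<Sum>v\<in>N. card (nb v \<inter> N)) + (\<Sum>v\<in>N. card (nb v - ?X))"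
    unfolding sum.distrib[symmetric] by (rule sum.cong[OF refl]) (rule slack_eq(2))
  obtain k where k: "(\<Sum>v\<in>N. card (nb v \<inter> N)) = 2 * k" using handshake[OF N_fin] by blast
  have "(\<Sum>v\<in>N. slack v) + 4 * (\<Sum>v\<in>T. 3 - card (nb v)) \<le> 5"
    using 1 2 3 4 by linarith
  moreover have "(\<Sum>v\<in>N. slack v) + 2 * k + 2 * (\<Sum>v\<in>N. card (nb v - ?X)) = 2 * (\<Sum>v\<in>N. card (nb v \<inter> T))"
    using 3 5 k unfolding sum.distrib by linarith
  then have "even ((\<Sum>v\<in>N. slack v) + 2 * k + 2 * (\<Sum>v\<in>N. card (nb v - ?X)))" by simp
  then have "even (\<Sum>v\<in>N. slack v)" by simp
  then have "even ((\<Sum>v\<in>N. slack v) + 4 * (\<Sum>v\<in>T. 3 - card (nb v)))" by simp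
  moreover have "s \<le> 4" if "s \<le> 5" "even s" for s :: nat using that by presburger
  ultimately show ?thesis by blast
qed

lemma slack_subset: "A \<subseteq> N \<Longrightarrow> sum slack A \<le> 4"
  using slack_budget sum_mono2[OF N_fin, of A slack] by fastforce

text \<open>A single vertex of degree 2 in \<open>T\<close> uses up the whole budget of 4.\<close>

lemma degree_two_T:
  assumes c: "c \<in> T" "card (nb c) \<noteq> 3"
  shows "x \<in> N \<Longrightarrow> slack x = 0" "u \<in> T \<Longrightarrow> u \<noteq> c \<Longrightarrow> card (nb u) = 3"
proof -
  have "3 - card (nb c) \<ge> 1" using c nb_card[of c] by linarith
  moreover have s: "(\<Sum>v\<in>T. 3 - card (nb v)) = (3 - card (nb c)) + (\<Sum>v\<in>T - {c}. 3 - card (nb v))"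
    by (rule sum.remove[OF T_fin c(1)])
  ultimately have z: "(\<Sum>v\<in>N. slack v) = 0" "(\<Sum>v\<in>T - {c}. 3 - card (nb v)) = 0"
    using slack_budget by linarith+
  show "x \<in> N \<Longrightarrow> slack x = 0" using z(1) N_fin by simp
  have "\<forall>v\<in>T - {c}. 3 - card (nb v) = 0" using z(2) T_fin by simp
  then show "u \<in> T \<Longrightarrow> u \<noteq> c \<Longrightarrow> card (nb u) = 3" using nb_card[of u] by force
qed

lemma slack_attached2: "attached e x \<Longrightarrow> card (nb x) = 2 \<Longrightarrow> slack x = 1"
proof -
  assume a: "attached e x" and 2: "card (nb x) = 2"
  then have "x \<in> N" by (auto simp: attached_def N_iff)
  moreover have "nb x - (T \<union> N) = {}" using attached_closed[OF a] by blast
  moreover have "card (nb x \<inter> T) = 1" using a by (simp add: attached_def)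
  ultimately have "card (nb x - (T \<union> N)) = 0" "slack x + (card (nb x) + card (nb x - (T \<union> N))) = 3"
    using slack_eq(1)[of x] by (simp_all only: card.empty)
  then show ?thesis using 2 by linarith
qed

lemma attached_N: "attached e x \<Longrightarrow> x \<in> N"
  by (auto simp: attached_def N_iff)

lemma attached_unique: "attached e x \<Longrightarrow> f \<in> T \<Longrightarrow> x \<in> nb f \<Longrightarrow> f = e"
  using nb_sym[of x f] by (auto simp: attached_def)

lemma attached_mem: "attached e x \<Longrightarrow> e \<in> nb x" "attached e x \<Longrightarrow> e \<in> T" "attached e x \<Longrightarrow> x \<in> nb e"
  using nb_sym[of e x] by (auto simp: attached_def)

text \<open>Three neighbours in \<open>T\<close> would mean slack 6, beyond the budget.\<close>

lemma N_cases:
  assumes "x \<in> N"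
  obtains e where "attached e x" | a b where "nb x \<inter> T = {a, b}" "a \<noteq> b" "x \<notin> T"
proof -
  have c: "card (nb x \<inter> T) \<le> 2"
  proof (rule ccontr)
    assume n: "\<not> ?thesis"
    have "slack x \<le> 4" using slack_subset[of "{x}"] assms by simp
    then show False using slack_eq(1,2)[OF assms] n nb_card[of x] by linarith
  qed
  have "card (nb x \<inter> T) = 1 \<or> card (nb x \<inter> T) = 2" using c slack_eq(3)[OF assms] by linarith
  then show ?thesis
  proof
    assume "card (nb x \<inter> T) = 1"
    then obtain e where "nb x \<inter> T = {e}" by (rule card_1_singletonE)
    then show ?thesis using that(1) assms by (auto simp: attached_def N_iff)
  next
    assume "card (nb x \<inter> T) = 2"
    then show ?thesis using that(2) assms by (auto simp: card_2_iff N_iff)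
  qed
qed

lemma card3I: "{a, b, c} \<subseteq> nb s \<Longrightarrow> distinct [a, b, c] \<Longrightarrow> nb s = {a, b, c}"
proof -
  assume s: "{a, b, c} \<subseteq> nb s" and d: "distinct [a, b, c]"
  have "card {a, b, c} = 3" using d by simp
  then show ?thesis using s nb_card[of s] card_seteq[OF fin_nb s] by auto
qed

lemma nb3E:
  assumes "card (nb v) = 3" "a \<in> nb v" "b \<in> nb v" "a \<noteq> b"
  obtains c where "nb v = {a, b, c}" "distinct [v, a, b, c]"
proof -
  have "card (nb v - {a, b}) = 1" using assms by (simp add: card_Diff_subset)
  then obtain c where c: "nb v - {a, b} = {c}" by (rule card_1_singletonE)
  then have "nb v = {a, b, c}" using assms by blast
  moreover have "c \<noteq> a" "c \<noteq> b" using c by auto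
  moreover have "v \<notin> nb v" by (rule nb_irr)
  ultimately show ?thesis using that[of c] assms by auto
qed

lemma nb3E1:
  assumes "card (nb v) = 3" "a \<in> nb v"
  obtains b c where "nb v = {a, b, c}" "distinct [v, a, b, c]"
proof -
  have "card (nb v - {a}) = 2" using assms by simp
  then obtain b where "b \<in> nb v" "b \<noteq> a" by (auto simp: card_2_iff)
  then show ?thesis using nb3E[OF assms, of b] that by metis
qed

end

section \<open>Hanging pairs\<close>

context maximal_tree
begin

definition double :: "'a \<Rightarrow> bool" where
  "double d \<longleftrightarrow> d \<notin> T \<and> card (nb d \<inter> T) = 2"

lemma double_N: "double d \<Longrightarrow> d \<in> N"
  by (auto simp: double_def N_iff)

lemma double_iff: "double d \<longleftrightarrow> d \<notin> T \<and> (\<exists>a b. nb d \<inter> T = {a, b} \<and> a \<noteq> b)"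
  by (auto simp: double_def card_2_iff)

lemma N_attached_or_double: "x \<in> N \<Longrightarrow> \<not> double x \<Longrightarrow> \<exists>e. attached e x"
  by (rule N_cases[of x]) (auto simp: double_iff)

lemma double_not_attached: "double d \<Longrightarrow> \<not> attached e d"
proof
  assume "double d" "attached e d"
  then have "card {e} = 2" unfolding double_def attached_def by metis
  then show False by simp
qed

lemma attachedD: "attached e x \<Longrightarrow> z \<in> nb x \<Longrightarrow> z \<in> T \<Longrightarrow> z = e" "attached e x \<Longrightarrow> x \<notin> T"
  unfolding attached_def by blast+

lemma hanging_T:
  "hanging nb T u v w \<Longrightarrow> z \<in> nb u \<Longrightarrow> z \<in> T \<Longrightarrow> z = v"
  "hanging nb T u v w \<Longrightarrow> z \<in> nb v \<Longrightarrow> z \<in> T \<Longrightarrow> z = u \<or> z = w"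
  unfolding hanging_def by blast+

lemma double_slack: "double d \<Longrightarrow> slack d \<ge> 2"
  using slack_eq(4)[of d] double_N[of d] by (simp add: double_def)

lemma double_slack_inner: "double d \<Longrightarrow> nb d \<subseteq> T \<union> N \<Longrightarrow> slack d + card (nb d) = 6"
proof -
  assume d: "double d" and s: "nb d \<subseteq> T \<union> N"
  have "nb d - (T \<union> N) = {}" using s by blast
  then have "card (nb d - (T \<union> N)) = 0" by (simp only: card.empty)
  moreover have "slack d + (card (nb d) + card (nb d - (T \<union> N))) = 3 * card (nb d \<inter> T)"
    by (rule slack_eq(1)[OF double_N[OF d]])
  moreover have "card (nb d \<inter> T) = 2" using d by (simp add: double_def)
  ultimately show ?thesis by linarith
qed

lemma attached_card: "attached e x \<Longrightarrow> card (nb x) = 2 \<or> card (nb x) = 3"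
  using min_degree[of x] nb_card[of x] nb_mem(2)[of e x] attached_mem(1)[of e x] by linarith

section \<open>Largest trees with only two vertices\<close>

lemma no_path4:
  assumes "card T = 2" "b \<in> nb a" "c \<in> nb b" "d \<in> nb c" "c \<notin> nb a" "d \<notin> nb a" "d \<notin> nb b"
    "distinct [a, b, c, d]"
  shows False
proof -
  have "ptree nb {a, b, c, d}" using assms by (intro ptree_path4)
  then have "card {a, b, c, d} \<le> 2" using T_max assms(1) by metis
  then show False using assms(8) by simp
qed

text \<open>The budget is exhausted, so there are no doubles and all attached vertices are cubic.
  Excluding the induced path \<open>x\<close>, \<open>u\<close>, \<open>v\<close>, \<open>y\<close>
  joins \<open>x\<close> to both outer neighbours of \<open>v\<close>, and the result is a
  \<open>K4_plus\<close> with \<open>u\<close> as subdividing vertex.\<close>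

lemma tree2_deg2:
  assumes T: "T = {u, v}" and uv: "v \<in> nb u" and c: "card (nb u) = 2"
  shows False
proof -
  have ne: "u \<noteq> v" using uv nb_irr by auto
  have T2: "card T = 2" using T ne by simp
  have "card (nb v) = 3" using degree_two_T(2)[of u v] c T ne by simp
  then obtain y y' where nv: "nb v = {u, y, y'}" "distinct [v, u, y, y']"
    using nb3E1[of v u] nb_sym[OF uv] by metis
  obtain x where nu: "nb u = {v, x}" "x \<noteq> v"
    using c uv by (metis card_2_iff insert_commute insertE singletonD)
  have xu: "x \<noteq> u" using nu nb_irr by auto
  have sl: "slack z = 0" if "z \<in> N" for z using degree_two_T(1)[of u z] c T that by simp
  then have nd: "\<not> double z" for z using double_slack[of z] double_N[of z] by force
  have Nx: "x \<in> N" "y \<in> N" "y' \<in> N"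
    using nb_in_N[of u x] nb_in_N[of v y] nb_in_N[of v y'] T nu nv xu by auto
  have ax: "attached u x"
    using N_attached_or_double[OF Nx(1) nd] attached_unique[of _ x u] nu T by auto
  have ay: "attached v y" "attached v y'"
    using N_attached_or_double[OF Nx(2) nd] attached_unique[of _ y v]
      N_attached_or_double[OF Nx(3) nd] attached_unique[of _ y' v] nv T by auto
  have xy: "z \<in> nb x" if "attached v z" for z
  proof (rule ccontr)
    assume "z \<notin> nb x"
    moreover have "z \<notin> nb u" using attached_unique[OF that, of u] T ne by auto
    moreover have "v \<notin> nb x" using attachedD(1)[OF ax, of v] ne T by auto
    ultimately show False
      using no_path4[OF T2, of u x v z] attached_mem[OF ax] uv attached_mem[OF that] ne T xu nu attachedD(2)[OF ax] attachedD(2)[OF that]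
      by auto
  qed
  have nx: "nb x = {u, y, y'}" by (rule card3I) (use xy ay attached_mem[OF ax] nv in auto)
  have Nsub: "z \<in> {x, y, y'}" if "z \<in> N" for z
  proof -
    have "z \<notin> T" "nb z \<inter> T \<noteq> {}" using that unfolding N_iff by auto
    then obtain t where "t \<in> nb z" "t \<in> T" "z \<notin> T" by blast
    then show ?thesis using T nu nv nb_sym[of t z] by auto
  qed
  have third: "nb s = {v, x, t}" if s: "attached v s" and st: "{s, t} = {y, y'}" for s t
  proof -
    have "card (nb s) = 3" using attached_card[OF s] slack_attached2[OF s] sl[OF attached_N[OF s]] by auto
    moreover have "x \<in> nb s" using xy[OF s] nb_sym by blast
    moreover have "v \<in> nb s" using attached_mem[OF s] by simp
    moreover have "v \<noteq> x" using nu by auto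
    ultimately obtain r where r: "nb s = {v, x, r}" "distinct [s, v, x, r]" using nb3E[of s v x] by metis
    have "r \<notin> T" using r attachedD(1)[OF s, of r] by auto
    then have "r \<in> N" using attached_closed[OF s, of r] r by auto
    then have "r = t" using Nsub[of r] r st by auto
    then show ?thesis using r by simp
  qed
  have "k4p nb u v x y y'" unfolding k4p_def
    using nv nx third[OF ay(1), of y'] third[OF ay(2), of y] ne nu xu by auto
  then show False using no_k4p by blast
qed

text \<open>If no induced path has four vertices, each outer neighbour of \<open>u\<close> is
  adjacent to each of \<open>v\<close>. This is \<open>K33\<close> with sides
  \<open>{u, r, r'}\<close> and \<open>{v, p, p'}\<close>.\<close>

lemma tree2_disjoint:
  assumes T: "T = {u, v}" and nu: "nb u = {v, p, p'}" and nv: "nb v = {u, r, r'}"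
    and d: "distinct [u, v, p, p', r, r']"
  shows False
proof -
  have T2: "card T = 2" using T d by simp
  have a: "attached u p" "attached u p'" "attached v r" "attached v r'"
    using nb_sym[of p u] nb_sym[of p' u] nb_sym[of r v] nb_sym[of r' v]
      nb_sym[of v p] nb_sym[of v p'] nb_sym[of u r] nb_sym[of u r'] nu nv d
    unfolding attached_def unfolding T by auto
  have e: "z \<in> nb x" if "attached u x" "attached v z" for x z
  proof (rule ccontr)
    assume "z \<notin> nb x"
    moreover have "z \<notin> nb u" using attached_unique[OF that(2), of u] T d by auto
    moreover have "v \<notin> nb x" using attachedD(1)[OF that(1), of v] d T by auto
    moreover have "z \<noteq> x" using \<open>v \<notin> nb x\<close> attached_mem(1)[OF that(2)] by auto
    ultimately show False
      using no_path4[OF T2, of u x v z] attached_mem[OF that(1)] attached_mem[OF that(2)] attachedD(2)[OF that(1)] attachedD(2)[OF that(2)] d T nu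
      by auto
  qed
  have "nb r = {v, p, p'}" "nb r' = {v, p, p'}"
    by (rule card3I; use nb_sym[OF e[OF a(1) a(3)]] nb_sym[OF e[OF a(2) a(3)]]
      nb_sym[OF e[OF a(1) a(4)]] nb_sym[OF e[OF a(2) a(4)]] attached_mem(1)[OF a(3)] attached_mem(1)[OF a(4)] d in auto)+
  moreover have "nb p = {u, r, r'}" "nb p' = {u, r, r'}"
    by (rule card3I; use e[OF a(1) a(3)] e[OF a(2) a(3)] e[OF a(1) a(4)] e[OF a(2) a(4)]
      attached_mem(1)[OF a(1)] attached_mem(1)[OF a(2)] d in auto)+
  ultimately have "k33 nb u r r' v p p'" unfolding k33_def using nu nv d by auto
  then show False using gd unfolding good_def by blast
qed

text \<open>The edge between \<open>a\<close> and \<open>d\<close> completes a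
  \<open>K4_plus\<close> with subdividing vertex \<open>b\<close>.\<close>

lemma tree2_one_common_adj:
  assumes nu: "nb u = {v, d, a}" and nv: "nb v = {u, d, b}"
    and dd: "distinct [u, v, d, a, b]" and ab: "b \<in> nb a" and da: "d \<in> nb a"
    and nbb: "nb b \<subseteq> {v, a, d}"
  shows False
proof -
  have m: "u \<in> nb d" "v \<in> nb d" "u \<in> nb a" "v \<in> nb b" "a \<in> nb d" "a \<in> nb b"
    using nb_sym[of d u] nb_sym[of d v] nb_sym[of a u] nb_sym[of b v] nb_sym[OF da] nb_sym[OF ab] nu nv
    by auto
  have nd: "nb d = {u, v, a}" by (rule card3I) (use m dd in auto)
  moreover have na: "nb a = {u, b, d}" by (rule card3I) (use m dd ab da in auto)
  moreover have "d \<notin> nb b" using nb_sym[of d b] nd dd by auto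
  ultimately have "k4p nb b v a u d" unfolding k4p_def using nu nv dd by auto
  then show False using no_k4p by blast
qed

text \<open>Here \<open>a\<close> and \<open>b\<close> are adjacent and, not being adjacent to
  \<open>d\<close>, have degree 2, which uses 2 of the budget. If \<open>d\<close> has no further
  neighbour, its slack is 4, too much; a further neighbour \<open>z\<close> gives the induced path
  \<open>z\<close>, \<open>d\<close>, \<open>u\<close>, \<open>a\<close>.\<close>

lemma tree2_one_common:
  assumes T: "T = {u, v}" and nu: "nb u = {v, d, a}" and nv: "nb v = {u, d, b}"
    and dd: "distinct [u, v, d, a, b]"
  shows False
proof -
  have T2: "card T = 2" using T dd by simp
  have aa: "attached u a" "attached v b"
    using nb_sym[of a u] nb_sym[of b v] nb_sym[of v a] nb_sym[of u b] nu nv dd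
    unfolding attached_def unfolding T by auto
  have dT: "nb d \<inter> T = {u, v}" using nb_sym[of d u] nb_sym[of d v] nu nv T by auto
  then have dbl: "double d" unfolding double_def using dd T by auto
  have ab: "b \<in> nb a"
  proof (rule ccontr)
    assume "b \<notin> nb a"
    moreover have "v \<notin> nb a" using nb_sym[of v a] nv dd by auto
    ultimately show False using no_path4[OF T2, of u a v b] attached_mem(1)[OF aa(1)] nu nv dd by auto
  qed
  have Nsub: "z \<in> {d, a, b}" if "z \<in> N" for z
  proof -
    have "z \<notin> T" "nb z \<inter> T \<noteq> {}" using that unfolding N_iff by auto
    then obtain t where "t \<in> nb z" "t \<in> T" "z \<notin> T" by blast
    then show ?thesis using T nu nv nb_sym[of t z] by auto
  qed
  have na: "nb a \<subseteq> {u, b, d}"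
  proof
    fix z assume z: "z \<in> nb a"
    show "z \<in> {u, b, d}"
      using attached_closed[OF aa(1) z] Nsub[of z] z nb_irr attachedD(1)[OF aa(1) z] by auto
  qed
  have nbb: "nb b \<subseteq> {v, a, d}"
  proof
    fix z assume z: "z \<in> nb b"
    show "z \<in> {v, a, d}"
      using attached_closed[OF aa(2) z] Nsub[of z] z nb_irr attachedD(1)[OF aa(2) z] by auto
  qed
  have nda: "d \<notin> nb a" using tree2_one_common_adj[OF nu nv dd ab _ nbb] by blast
  have ndb: "d \<notin> nb b"
    using tree2_one_common_adj[OF nv nu _ nb_sym[OF ab]] na dd by (auto simp: insert_commute)
  have "nb a = {u, b}" "nb b = {v, a}"
    using na nda nbb ndb attached_mem(1)[OF aa(1)] attached_mem(1)[OF aa(2)] ab nb_sym[OF ab] by blast+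
  then have s1: "slack a = 1" "slack b = 1"
    using slack_attached2[OF aa(1)] slack_attached2[OF aa(2)] dd by auto
  have sum: "slack d + slack a + slack b \<le> 4"
    using slack_subset[of "{d, a, b}"] double_N[OF dbl] attached_N[OF aa(1)] attached_N[OF aa(2)] dd by simp
  show False
  proof (cases "nb d \<subseteq> T")
    case True
    then have "nb d = {u, v}" using dT by blast
    then have "slack d + 2 = 6" using double_slack_inner[OF dbl] True dd by auto
    then show False using sum s1 by linarith
  next
    case False
    then obtain z where z: "z \<in> nb d" "z \<notin> T" by blast
    have "z \<noteq> d" using z nb_irr by auto
    have "a \<notin> nb z" using nb_sym[of a z] \<open>nb a = {u, b}\<close> z ndb nb_sym[of z d] T by auto
    moreover have "a \<notin> nb d" using nda nb_sym[of a d] by auto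
    moreover have "z \<noteq> a" using z nda nb_sym[of z d] \<open>a \<notin> nb d\<close> by auto
    moreover have "u \<notin> nb z" using nb_sym[of u z] nu z \<open>z \<noteq> d\<close> \<open>z \<noteq> a\<close> T by auto
    ultimately show False
      using no_path4[OF T2, of d z u a] nb_sym[OF z(1)] dT nu dd z \<open>z \<noteq> d\<close> T by auto
  qed
qed

text \<open>Two doubles exhaust the budget with slack 2 each, which requires an outside neighbour of
  both. The two outside neighbours coincide, as otherwise \<open>z\<close>, \<open>d\<close>,
  \<open>u\<close>, \<open>e\<close> is an induced path; a common one subdivides a
  \<open>K4_plus\<close>.\<close>

lemma tree2_two_common:
  assumes T: "T = {u, v}" and nu: "nb u = {v, d, e}" and nv: "nb v = {u, d, e}"
    and dd: "distinct [u, v, d, e]"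
  shows False
proof -
  have T2: "card T = 2" using T dd by simp
  have dT: "nb x \<inter> T = {u, v}" "double x" if "x \<in> {d, e}" for x
  proof -
    show "nb x \<inter> T = {u, v}" using that nb_sym[of x u] nb_sym[of x v] nu nv T by auto
    then show "double x" unfolding double_def using dd T that by auto
  qed
  have sum: "slack d + slack e \<le> 4"
    using slack_subset[of "{d, e}"] double_N[OF dT(2)] dd by simp
  then have s2: "slack x \<le> 2" if "x \<in> {d, e}" for x
    using that double_slack[OF dT(2), of d] double_slack[OF dT(2), of e] by auto
  have out: "\<exists>z. nb x = {u, v, z} \<and> z \<notin> T \<union> N" if "x \<in> {d, e}" for x
  proof -
    have "\<not> nb x \<subseteq> T \<union> N" using double_slack_inner[OF dT(2)[OF that]] s2[OF that] nb_card[of x] by force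
    then obtain z where z: "z \<in> nb x" "z \<notin> T \<union> N" by blast
    have "nb x = {u, v, z}" by (rule card3I) (use dT(1)[OF that] z T dd in auto)
    then show ?thesis using z by blast
  qed
  obtain z where z: "nb d = {u, v, z}" "z \<notin> T \<union> N" using out[of d] by auto
  obtain z' where z': "nb e = {u, v, z'}" "z' \<notin> T \<union> N" using out[of e] by auto
  have ne: "z \<noteq> d" "z \<noteq> e" using z(2) double_N[OF dT(2)] by auto
  have "z = z'"
  proof (rule ccontr)
    assume "z \<noteq> z'"
    then have "e \<notin> nb z" using nb_sym[of e z] z' z T by auto
    moreover have "e \<notin> nb d" using z ne dd by auto
    moreover have "u \<notin> nb z" using nb_sym[of u z] nu z ne T by auto
    ultimately show False
      using no_path4[OF T2, of d z u e] nb_sym[of z d] z nu dd ne T by auto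
  qed
  then have "k4p nb z d e u v" unfolding k4p_def using z z' nu nv dd ne T by auto
  then show False using no_k4p by blast
qed

lemma card_T_ge4: "card T \<ge> 4"
proof (rule ccontr)
  assume "\<not> ?thesis"
  then have T2: "card T = 2" using ptree_even[OF T_ptree] ptree_card_ge2[OF T_ptree]
    by (cases "card T = 3") auto
  then obtain u v where T: "T = {u, v}" "u \<noteq> v" by (meson card_2_iff)
  then have "nb u \<inter> T \<noteq> {}" using ptree_nbr[OF T_ptree, of u] by simp
  then have uv: "v \<in> nb u" using T nb_irr by auto
  have V: "u \<in> V" "v \<in> V" using T T_sub by auto
  have "card (nb u) \<noteq> 2" using tree2_deg2[OF T(1) uv] by blast
  moreover have "card (nb v) \<noteq> 2" using tree2_deg2[of v u] T(1) nb_sym[OF uv] by (auto simp: insert_commute)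
  ultimately have c3: "card (nb u) = 3" "card (nb v) = 3"
    using min_degree[OF V(1)] min_degree[OF V(2)] nb_card[of u] nb_card[of v] by linarith+
  obtain p p' where nu: "nb u = {v, p, p'}" "distinct [u, v, p, p']" using nb3E1[OF c3(1) uv] by metis
  obtain r r' where nv: "nb v = {u, r, r'}" "distinct [v, u, r, r']"
    using nb3E1[OF c3(2) nb_sym[OF uv]] by metis
  have cv: "nb v = {u, r', r}" "nb u = {v, p', p}" using nu nv by auto
  consider (1) "p = r \<and> p' = r'" | "p = r' \<and> p' = r" | "p = r \<and> p' \<noteq> r'" | "p = r' \<and> p' \<noteq> r"
    | "p' = r \<and> p \<noteq> r'" | "p' = r' \<and> p \<noteq> r" | "{p, p'} \<inter> {r, r'} = {}" by blast
  then show False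
  proof cases
    case 1 then show ?thesis using tree2_two_common[OF T(1) nu(1)] nv nu by auto
  next
    case 2 then show ?thesis using tree2_two_common[OF T(1) nu(1)] nv cv nu by auto
  next
    case 3 then show ?thesis using tree2_one_common[OF T(1) nu(1)] nv nu by auto
  next
    case 4 then show ?thesis using tree2_one_common[OF T(1) nu(1)] nv cv nu by auto
  next
    case 5 then show ?thesis using tree2_one_common[OF T(1) cv(2)] nv nu by auto
  next
    case 6 then show ?thesis using tree2_one_common[OF T(1) cv(2)] nv cv nu by auto
  next
    case 7 then show ?thesis using tree2_disjoint[OF T(1) nu(1) nv(1)] nu nv by auto
  qed
qed

text \<open>Otherwise \<open>T \<union> {x, y}\<close> is a larger tree, in which \<open>v\<close>
  is matched with \<open>y\<close> and \<open>u\<close> with \<open>x\<close>.\<close>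

lemma hanging_attached_adj:
  assumes h: "hanging nb T u v w" and x: "attached u x" and y: "attached v y"
  shows "y \<in> nb x"
proof (rule ccontr)
  assume "y \<notin> nb x"
  note hd = hangingD[OF h]
  have yu: "y \<notin> nb u" using attached_unique[OF y hd(4)] hd(7) by blast
  have xy: "x \<notin> T" "y \<notin> T" "x \<noteq> y" using attachedD(2)[OF x] attachedD(2)[OF y] attachedD(1)[OF x, of v] attached_mem(1)[OF y] hd(5,7) by auto
  show False
  proof (rule swap_extension[OF h, of v y w u x v])
    show "nb v \<inter> (T - {u, v}) = {w}" using hd by auto
    show "nb y \<inter> (T - {u, v}) = {}" using attachedD(1)[OF y] by blast
    show "nb u \<inter> insert v (insert y (T - {u, v})) = {v}" using hd yu by auto
    show "nb x \<inter> insert v (insert y (T - {u, v})) = {}"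
      using attachedD(1)[OF x] \<open>y \<notin> nb x\<close> hd(5,7) by blast
  qed (use xy attached_mem(3)[OF x] attached_mem(3)[OF y] hd in auto)
qed

text \<open>The common form of the small reductions: an induced tree on four vertices among seven
  vertices spanning nine edges, where 6 * 4 + 18 reaches 6 * 7.\<close>

lemma deletion7:
  assumes "X \<subseteq> V" "ptree nb Y" "Y \<subseteq> X" "\<And>y. y \<in> Y \<Longrightarrow> y \<noteq> y0 \<Longrightarrow> nb y \<subseteq> X" "nb y0 \<subseteq> insert z0 X"
    and "card X = 7" "card Y = 4" "18 \<le> (\<Sum>x\<in>X. card (nb x \<inter> X))"
  shows False
  using deletion_edges[OF assms(1-5)] assms(6-) by simp

text \<open>The forced configuration is \<open>K\<^sub>3\<^sub>,\<^sub>3\<close> minus an edge, attached to the rest by two edges. It contains an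
  induced path on four vertices, which can be deleted together with one further vertex.\<close>

lemma hanging_attached:
  assumes h: "hanging nb T u v w" and nu: "nb u = {v, x1, x2}" and nv: "nb v = {u, w, y}"
    and x12: "x1 \<noteq> x2" and a1: "attached u x1" and a2: "attached u x2" and ay: "attached v y"
  shows False
proof -
  note hd = hangingD[OF h]
  have nT: "x1 \<notin> T" "x2 \<notin> T" "y \<notin> T" using attachedD(2) a1 a2 ay by auto
  have yx: "y \<in> nb x1" "y \<in> nb x2" using hanging_attached_adj[OF h] a1 a2 ay by auto
  have dist: "distinct [u, v, w, y, x1, x2]"
    using hd nT x12 yx nb_irr by auto
  have ux: "u \<in> nb x1" "u \<in> nb x2" using attached_mem(1) a1 a2 by auto
  have ny: "nb y = {v, x1, x2}"
    by (rule card3I) (use attached_mem(1)[OF ay] nb_sym[OF yx(1)] nb_sym[OF yx(2)] dist in auto)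
  have v3: "card (nb v) = 3" using nv dist by simp
  have ny': "nb y = {v, x2, x1}" "nb u = {v, x2, x1}" using ny nu by auto
  have "\<not> nb x2 \<subseteq> {u, y, x1}"
    using no_shared_triple[OF nu ny _ _ v3] dist by auto
  then obtain z2 where z2: "z2 \<in> nb x2" "z2 \<notin> {u, y, x1}" by blast
  have "\<not> nb x1 \<subseteq> {u, y, x2}"
    using no_shared_triple[OF ny'(2) ny'(1) _ _ v3] dist by auto
  then obtain z1 where z1: "z1 \<in> nb x1" "z1 \<notin> {u, y, x2}" by blast
  have n1: "nb x1 = {u, y, z1}" by (rule card3I) (use ux yx z1 dist in auto)
  have n2: "nb x2 = {u, y, z2}" by (rule card3I) (use ux yx z2 dist in auto)
  have key: False
    if x12: "x1 \<noteq> x2" and a1: "attached u x1" and a2: "attached u x2"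
      and n1: "nb x1 = {u, y, z1}" and n2: "nb x2 = {u, y, z2}" and z1: "z1 \<notin> {u, y, x2}"
      and z2: "z2 \<notin> {u, y, x1}" and nu: "nb u = {v, x1, x2}" and ny: "nb y = {v, x1, x2}"
      and dist: "distinct [u, v, w, y, x1, x2]" and nT: "x1 \<notin> T" "x2 \<notin> T"
      and az: "attached e z1" for x1 x2 z1 z2 e
  proof -
    have zT: "z1 \<notin> T" "z1 \<noteq> x1" "z1 \<noteq> x2"
      using attachedD(2)[OF az] z1 n1 nb_irr[of x1] by auto
    have zu: "z1 \<notin> nb u" using nu zT hd by auto
    have zv: "z1 \<notin> nb v" using nv zT hd z1 by auto
    have e: "e \<noteq> u" "e \<noteq> v" using attached_mem[OF az] zu zv by auto
    have xz: "x1 \<in> nb z1" using nb_sym[of z1 x1] n1 by auto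
    \<comment> \<open>Otherwise exchange \<open>{u, v}\<close> for \<open>{z1, x1}\<close>, hanging
      at \<open>e\<close>, and then add \<open>u\<close> at \<open>x1\<close> with the leaf
      \<open>x2\<close>.\<close>
    have "z1 \<in> nb x2"
    proof (rule ccontr)
      assume c: "z1 \<notin> nb x2"
      then have "z1 \<noteq> z2" using n2 by auto
      have z2T: "z2 \<notin> T" using attachedD(1)[OF a2, of z2] n2 z2 by auto
      show False
      proof (rule swap_extension[OF h, of z1 x1 e u x2 x1])
        show "nb z1 \<inter> (T - {u, v}) = {e}" using attachedD(1)[OF az] attached_mem(1,2)[OF az] e by blast
        show "nb x1 \<inter> (T - {u, v}) = {}" using attachedD(1)[OF a1] by blast
        show "nb u \<inter> insert z1 (insert x1 (T - {u, v})) = {x1}" using nu zu nT dist by auto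
        show "nb x2 \<inter> insert z1 (insert x1 (T - {u, v})) = {}"
          using n2 \<open>z1 \<noteq> z2\<close> z2T nT \<open>y \<notin> T\<close> z1 z2 dist by auto
      qed (use zT nT xz dist z1 nu in auto)
    qed
    then have zx2: "x2 \<in> nb z1" by (rule nb_sym)
    have nz: "nb z1 = {e, x1, x2}"
      by (rule card3I) (use xz zx2 attached_mem[OF az] nT x12 in auto)
    have wz: "z1 \<noteq> w" "z1 \<noteq> v" "z1 \<noteq> u" using zT hd by auto
    \<comment> \<open>\<open>K33\<close> minus an edge has only eight edges; \<open>w\<close> is
      added to contribute the ninth through \<open>v\<close>.\<close>
    let ?X = "{u, v, y, x1, x2, z1, w}"
    let ?Y = "{v, u, x1, z1}"
    have XV: "?X \<subseteq> V"
    proof -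
      have "u \<in> V" "v \<in> V" "w \<in> V" using hd T_sub by auto
      moreover have "y \<in> V" "x1 \<in> V" "x2 \<in> V" "z1 \<in> V"
        using nb_mem[of y v] nb_mem[of x1 u] nb_mem[of x2 u] nb_mem[of z1 x1] nv nu n1 by auto
      ultimately show ?thesis by simp
    qed
    have xv: "x1 \<notin> nb v" "z1 \<notin> nb v" "z1 \<notin> nb u" using nv dist zv zu by auto
    have dY: "distinct [v, u, x1, z1]" using dist wz zT by auto
    have pY: "ptree nb ?Y" by (rule ptree_path4) (use nv nu n1 xv dY in auto)
    define f where "f x = card (nb x \<inter> ?X)" for x
    have "3 \<le> f u" unfolding f_def by (rule card_ge_subset[of _ "{v, x1, x2}"]) (use nu dist in auto)
    moreover have "3 \<le> f v" unfolding f_def by (rule card_ge_subset[of _ "{u, w, y}"]) (use nv dist in auto)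
    moreover have "3 \<le> f y" unfolding f_def by (rule card_ge_subset[of _ "{v, x1, x2}"]) (use ny dist in auto)
    moreover have "3 \<le> f x1" unfolding f_def by (rule card_ge_subset[of _ "{u, y, z1}"]) (use n1 dist z1 in auto)
    moreover have "3 \<le> f x2" unfolding f_def
      by (rule card_ge_subset[of _ "{u, y, z1}"]) (use \<open>z1 \<in> nb x2\<close> n2 dist z1 in auto)
    moreover have "2 \<le> f z1" unfolding f_def by (rule card_ge_subset[of _ "{x1, x2}"]) (use nz dist in auto)
    moreover have "1 \<le> f w" unfolding f_def by (rule card_ge_subset[of _ "{v}"]) (use hd in auto)
    moreover have dX: "distinct [u, v, y, x1, x2, z1, w]" using dist wz zT z1 by auto
    ultimately have "18 \<le> sum f ?X" by simp
    then have S: "18 \<le> (\<Sum>x\<in>?X. card (nb x \<inter> ?X))" unfolding f_def .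
    show False
      by (rule deletion7[OF XV pY, where ?y0.0 = z1 and ?z0.0 = e, OF _ _ _ _ _ S])
        (use nu nv n1 nz dX in auto)
  qed
  have "\<not> attached e z1" for e
    using key[OF x12 a1 a2 n1 n2 z1(2) z2(2) nu ny dist nT(1,2)] by blast
  moreover have "\<not> attached e z2" for e
    using key[OF _ a2 a1 n2 n1 z2(2) z1(2) ny'(2,1) _ nT(2,1)] dist by auto
  moreover have zN: "z1 \<in> N" "z2 \<in> N"
    using attached_closed[OF a1 z1(1)] attached_closed[OF a2 z2(1)] z1 z2
      attachedD(1)[OF a1 z1(1)] attachedD(1)[OF a2 z2(1)] by auto
  ultimately have db: "double z1" "double z2" using N_attached_or_double by blast+
  have zx: "x1 \<in> nb z1" "x2 \<in> nb z2" using nb_sym[OF z1(1)] nb_sym[OF z2(1)] by auto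
  \<comment> \<open>The neighbour \<open>x\<close> takes the third place at \<open>z\<close>, so no
    edge leaves \<open>T \<union> N\<close> and the slack is at least 3. As \<open>x1\<close> and
    \<open>x2\<close> differ, so do \<open>z1\<close> and \<open>z2\<close>, and together they
    exceed the budget.\<close>
  have inner: "slack z \<ge> 3 \<and> nb z - T \<subseteq> {x}" if dz: "double z" and x: "x \<in> nb z" "x \<in> N" for z x
  proof -
    have "card (nb z \<inter> T) = 2" "x \<notin> T" using dz x by (auto simp: double_def N_iff)
    then have "card (nb z - T) \<le> 1" using card_Int_Diff[of "nb z" T] nb_card[of z] by simp
    moreover have "x \<in> nb z - T" using x \<open>x \<notin> T\<close> by simp
    ultimately have s: "nb z - T \<subseteq> {x}"
      using card_le_Suc0_iff_eq[of "nb z - T"] by auto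
    then have "nb z \<subseteq> T \<union> N" using x by auto
    then show ?thesis using double_slack_inner[OF dz] nb_card[of z] s by linarith
  qed
  have i: "slack z1 \<ge> 3" "slack z2 \<ge> 3" "nb z1 - T \<subseteq> {x1}"
    using inner[OF db(1) zx(1) attached_N[OF a1]] inner[OF db(2) zx(2) attached_N[OF a2]] by auto
  then have "z1 \<noteq> z2" using zx nT x12 by auto
  then have "slack z1 + slack z2 \<le> 4" using slack_subset[of "{z1, z2}"] zN by simp
  then show False using i by linarith
qed

lemma hanging_nbs:
  assumes h: "hanging nb T u v w" and c: "card (nb u) = 3" "card (nb v) = 3"
  obtains x1 x2 y where "nb u = {v, x1, x2}" "x1 \<noteq> x2" "nb v = {u, w, y}"
    "x1 \<in> N" "x2 \<in> N" "y \<in> N" "y \<noteq> w" "y \<noteq> u"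
proof -
  note hd = hangingD[OF h]
  obtain x1 x2 where u: "nb u = {v, x1, x2}" "distinct [u, v, x1, x2]" using nb3E1[OF c(1) hd(9)] by metis
  obtain y where y: "nb v = {u, w, y}" "distinct [v, u, w, y]" using nb3E[OF c(2) hd(10,11,3)] by metis
  have "x1 \<notin> T" "x2 \<notin> T" using hanging_T(1)[OF h, of x1] hanging_T(1)[OF h, of x2] u by auto
  moreover have "y \<notin> T" using hanging_T(2)[OF h, of y] y by auto
  ultimately have "x1 \<in> N" "x2 \<in> N" "y \<in> N"
    using nb_in_N[OF hd(4)] nb_in_N[OF hd(5)] u y by auto
  then show ?thesis using that[of x1 x2 y] u y by auto
qed

text \<open>Without a double all outer neighbours of the pair are attached, which is the
  configuration just excluded. Every end of \<open>T\<close> thus has to claim a share of the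
  budget.\<close>

lemma hanging_double:
  assumes h: "hanging nb T u v w" and c: "card (nb u) = 3" "card (nb v) = 3"
  shows "\<exists>d. double d \<and> d \<in> nb u \<union> nb v"
proof (rule ccontr)
  assume n: "\<not> ?thesis"
  note hd = hangingD[OF h]
  from hanging_nbs[OF h c] obtain x1 x2 y where x: "nb u = {v, x1, x2}" "x1 \<noteq> x2" "nb v = {u, w, y}"
    "x1 \<in> N" "x2 \<in> N" "y \<in> N" by metis
  have "\<exists>e. attached e z" if "z \<in> {x1, x2, y}" for z
    using N_attached_or_double[of z] n x that by auto
  then have "attached u x1" "attached u x2" "attached v y"
    using attached_unique[of _ _ u] attached_unique[of _ _ v] hd(4,5) x by (metis insertCI)+
  then show False using hanging_attached[OF h x(1,3,2)] by blast
qed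

text \<open>A vertex \<open>c\<close> of degree 2 leaves no budget for doubles, so every hanging
  pair would have to contain \<open>c\<close>; but two of them are disjoint.\<close>

lemma T_degree3: "c \<in> T \<Longrightarrow> card (nb c) = 3"
proof (rule ccontr)
  assume c: "c \<in> T" "card (nb c) \<noteq> 3"
  obtain u v w u' v' w' where h: "hanging nb T u v w" "hanging nb T u' v' w'" "{u, v} \<inter> {u', v'} = {}"
    using two_hanging[OF T_ptree card_T_ge4] by (elim exE conjE) (rule that)
  have nd: "\<not> double d" for d using double_slack[of d] degree_two_T(1)[OF c, of d] double_N[of d] by auto
  have "c \<in> {u, v}" if "hanging nb T u v w" for u v w
    using hanging_double[OF that] hangingD(4,5)[OF that] degree_two_T(2)[OF c] nd by blast
  then show False using h by blast
qed

lemmas hanging_nbs' = hanging_nbs[OF _ T_degree3 T_degree3]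

lemma hanging_double': "hanging nb T u v w \<Longrightarrow> \<exists>d. double d \<and> d \<in> nb u \<union> nb v"
  using hanging_double[of u v w] T_degree3 hangingD(4,5)[of T u v w] by blast

section \<open>Vertices with two neighbours in the tree\<close>

lemma attached_hanging_T:
  assumes "attached e x" shows "nb x \<inter> (T - {u, v}) = (if e = u \<or> e = v then {} else {e})"
  using assms unfolding attached_def by auto

lemma outside_N: "z \<notin> T \<Longrightarrow> z \<notin> N \<Longrightarrow> t \<in> T \<Longrightarrow> t \<notin> nb z"
  by (auto simp: N_iff)

lemma double_nb:
  assumes "double d" "a \<in> nb d" "a \<in> T" "b \<in> nb d" "b \<in> T" "a \<noteq> b"
  shows "nb d \<inter> T = {a, b}"
proof -
  have "{a, b} \<subseteq> nb d \<inter> T" using assms by simp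
  moreover have "card (nb d \<inter> T) = 2" "card {a, b} = 2" using assms by (auto simp: double_def)
  ultimately show ?thesis using card_seteq[of "nb d \<inter> T" "{a, b}"] by simp
qed

lemma double_other:
  assumes "double d" "a \<in> nb d" "a \<in> T"
  obtains b where "nb d \<inter> T = {a, b}" "b \<noteq> a" "b \<in> T" "b \<in> nb d"
proof -
  have "card (nb d \<inter> T - {a}) = 1" using assms by (simp add: double_def)
  then obtain b where b: "nb d \<inter> T - {a} = {b}" by (rule card_1_singletonE)
  then have "b \<in> nb d" "b \<in> T" "b \<noteq> a" by auto
  then show ?thesis using that[of b] double_nb[OF assms(1-3)] by auto
qed

section \<open>Doubles with a neighbour outside \<open>T \<union> N\<close>\<close>

lemma double_outgoing:
  assumes "double d" "z \<in> nb d" "z \<notin> T \<union> N"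
  shows "x \<in> nb d \<Longrightarrow> x \<in> T \<or> x = z"
proof -
  have "card (nb d - T) \<le> 1"
    using assms card_Int_Diff[of "nb d" T] nb_card[of d] by (simp add: double_def)
  moreover have "z \<in> nb d - T" using assms by simp
  ultimately show "x \<in> nb d \<Longrightarrow> x \<in> T \<or> x = z"
    using card_le_Suc0_iff_eq[of "nb d - T"] by auto
qed

lemma not_double_attached:
  assumes "x \<in> nb t" "t \<in> T" "x \<notin> T" "\<not> double x"
  shows "attached t x"
  using N_attached_or_double[OF nb_in_N[OF assms(2,1,3)] assms(4)] attached_unique[OF _ assms(2,1)]
  by auto

text \<open>Exchange \<open>{u, v}\<close> for \<open>{d, z}\<close>, hanging at \<open>b\<close>.
  In the new tree \<open>v\<close> sees only \<open>w\<close> and \<open>u\<close> sees only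
  \<open>d\<close>, so either one could be added together with an attached neighbour.\<close>

lemma outgoing_leaf:
  assumes h: "hanging nb T u v w" and d: "double d" and z: "z \<in> nb d" "z \<notin> T \<union> N"
    and du: "d \<in> nb u" and dv: "d \<notin> nb v"
  shows "y \<in> nb v \<Longrightarrow> y \<noteq> u \<Longrightarrow> y \<noteq> w \<Longrightarrow> double y"
    and "x \<in> nb u \<Longrightarrow> x \<noteq> v \<Longrightarrow> x \<noteq> d \<Longrightarrow> double x"
proof -
  note hd = hangingD[OF h]
  note out = double_outgoing[OF d z]
  obtain b where b: "nb d \<inter> T = {u, b}" "b \<noteq> u" "b \<in> T" "b \<in> nb d"
    using double_other[OF d nb_sym[OF du] hd(4)] by metis
  have bv: "b \<noteq> v" using dv nb_sym[OF b(4)] by auto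
  have zT: "z \<notin> T" "z \<notin> N" using z by auto
  have dT: "d \<notin> T" using d by (simp add: double_def)
  note zn = outside_N[OF zT]
  have zuv: "z \<notin> nb u" "z \<notin> nb v" using zn[OF hd(4)] zn[OF hd(5)] nb_sym[of z] by blast+
  have p: "nb d \<inter> (T - {u, v}) = {b}" "nb z \<inter> (T - {u, v}) = {}" using b bv zn by blast+
  have step: False
    if "attached t x" "t = u \<or> t = v" "x \<noteq> d" "nb t \<inter> insert d (insert z (T - {u, v})) = {r}" for t x r
  proof (rule swap_extension[OF h, of d z b t x r])
    have xT: "x \<notin> T" by (rule attachedD(2)[OF that(1)])
    have xz: "x \<noteq> z" using attached_N[OF that(1)] zT by blast
    have "d \<notin> nb x" using out[of x] xT xz nb_sym[of d x] by blast
    moreover have "z \<notin> nb x" using attached_closed[OF that(1), of z] zT by blast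
    moreover have "nb x \<inter> (T - {u, v}) = {}" using attached_hanging_T[OF that(1), of u v] that(2) by auto
    ultimately show "nb x \<inter> insert d (insert z (T - {u, v})) = {}" by blast
    show "x \<notin> insert d (insert z (T - {u, v}))" using xT xz that(3) by blast
    show "t \<notin> insert d (insert z (T - {u, v}))" using that(2) hd(4,5) dT zT by blast
  qed (use p z(1) zT dT that(4) attached_mem(3)[OF that(1)] in auto)
  show "double y" if y: "y \<in> nb v" "y \<noteq> u" "y \<noteq> w"
  proof (rule ccontr)
    assume "\<not> double y"
    moreover have "y \<notin> T" using hanging_T(2)[OF h y(1)] y by blast
    ultimately have "attached v y" using not_double_attached[OF y(1) hd(5)] by blast
    moreover have "nb v \<inter> insert d (insert z (T - {u, v})) = {w}"
      using hd(2) hd(3) hd(8) dv zuv by auto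
    moreover have "y \<noteq> d" using y dv by blast
    ultimately show False using step[of v y w] by blast
  qed
  show "double x" if x: "x \<in> nb u" "x \<noteq> v" "x \<noteq> d"
  proof (rule ccontr)
    assume "\<not> double x"
    moreover have "x \<notin> T" using hanging_T(1)[OF h x(1)] x by blast
    ultimately have "attached u x" using not_double_attached[OF x(1) hd(4)] by blast
    moreover have "nb u \<inter> insert d (insert z (T - {u, v})) = {d}"
      using hanging_T(1)[OF h] du zuv by blast
    ultimately show False using step[of u x d] x by blast
  qed
qed

text \<open>Exchange \<open>{u, v}\<close> for \<open>{d, z}\<close>; then \<open>s\<close>, which
  hangs at \<open>e\<close>, can be added with the leaf \<open>x\<close>. That \<open>s\<close> is
  not adjacent to \<open>u\<close> ensures that \<open>e\<close> survives the exchange.\<close>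

lemma outgoing_stem:
  assumes h: "hanging nb T u v w" and d: "double d" and z: "z \<in> nb d" "z \<notin> T \<union> N"
    and dv: "d \<in> nb v" and du: "d \<notin> nb u"
    and x: "attached u x" and s: "s \<in> nb x" "attached e s" "s \<notin> nb u"
  shows False
proof -
  note hd = hangingD[OF h]
  note out = double_outgoing[OF d z]
  obtain b where b: "nb d \<inter> T = {v, b}" "b \<noteq> v" "b \<in> T" "b \<in> nb d"
    using double_other[OF d nb_sym[OF dv] hd(5)] by metis
  have bu: "b \<noteq> u" using du nb_sym[OF b(4)] by auto
  have zT: "z \<notin> T" "z \<notin> N" using z by auto
  have dT: "d \<notin> T" using d by (simp add: double_def)
  have sd: "s \<noteq> d" using double_not_attached[OF d] s(2) by blast
  have nv: "nb v = {u, w, d}"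
    by (rule card3I) (use hd dv dT in auto)
  have sT: "s \<notin> T" "x \<notin> T" using attachedD(2) s(2) x by blast+
  have e: "e \<noteq> u" "e \<noteq> v" using attached_mem(3)[OF s(2)] s(3) nv sT sd hd(4,6) by auto
  have sz: "s \<noteq> z" "x \<noteq> z" using attached_N[OF s(2)] attached_N[OF x] zT by auto
  have xd: "x \<noteq> d" using attached_mem(3)[OF x] du by blast
  have dn: "d \<notin> nb s" "d \<notin> nb x"
    using out[of s] out[of x] sT sz nb_sym[of d s] nb_sym[of d x] by blast+
  have zn: "z \<notin> nb s" "z \<notin> nb x"
    using attached_closed[OF s(2), of z] attached_closed[OF x, of z] zT by blast+
  show False
  proof (rule swap_extension[OF h, of d z b s x e])
    show "nb d \<inter> (T - {u, v}) = {b}" using b bu by blast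
    show "nb z \<inter> (T - {u, v}) = {}" using outside_N[OF zT] by blast
    show "nb s \<inter> insert d (insert z (T - {u, v})) = {e}"
      using attached_hanging_T[OF s(2), of u v] e dn zn by auto
    show "nb x \<inter> insert d (insert z (T - {u, v})) = {}"
      using attached_hanging_T[OF x, of u v] dn zn by auto
  qed (use sT sz sd xd zT dT z(1) nb_sym[OF s(1)] in auto)
qed

text \<open>Both tree neighbours of \<open>d\<close> belong to the pair, so \<open>{d, z}\<close>
  would not be connected to the rest. Exchanging \<open>u\<close> for \<open>d\<close> as the
  partner of \<open>v\<close> works instead, and \<open>s\<close>, \<open>x\<close> can again be
  added.\<close>

lemma outgoing_full:
  assumes h: "hanging nb T u v w" and d: "double d" and z: "z \<in> nb d" "z \<notin> T \<union> N"
    and dv: "d \<in> nb v" and du: "d \<in> nb u"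
    and x: "attached u x" and s: "s \<in> nb x" "attached e s"
  shows False
proof -
  note hd = hangingD[OF h]
  note out = double_outgoing[OF d z]
  have zT: "z \<notin> T" "z \<notin> N" using z by auto
  have dT: "d \<notin> T" using d by (simp add: double_def)
  have dn: "nb d \<inter> T = {u, v}"
    by (rule double_nb[OF d]) (use nb_sym[OF du] nb_sym[OF dv] hd in auto)
  have sd: "s \<noteq> d" "x \<noteq> d" using double_not_attached[OF d] s(2) x by blast+
  have nv: "nb v = {u, w, d}" by (rule card3I) (use hd dv dT in auto)
  have sT: "s \<notin> T" "x \<notin> T" using attachedD(2) s(2) x by blast+
  have nu: "nb u = {v, d, x}" by (rule card3I) (use hd du dT sd sT attached_mem(3)[OF x] in auto)
  have e: "e \<noteq> u" "e \<noteq> v" using attached_mem(3)[OF s(2)] nu nv sT sd hd(4,5,6) s(1) nb_irr[of x] by auto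
  have sz: "s \<noteq> z" "x \<noteq> z" using attached_N[OF s(2)] attached_N[OF x] zT by auto
  have dn': "d \<notin> nb s" "d \<notin> nb x"
    using out[of s] out[of x] sT sz nb_sym[of d s] nb_sym[of d x] by blast+
  have vn: "v \<notin> nb s" "v \<notin> nb x"
    using attachedD(1)[OF s(2), of v] attachedD(1)[OF x, of v] e hd(5,7) by blast+
  show False
  proof (rule swap_extension[OF h, of v d w s x e])
    show "nb v \<inter> (T - {u, v}) = {w}" using nv dT hd by auto
    show "nb d \<inter> (T - {u, v}) = {}" using dn by blast
    show "nb s \<inter> insert v (insert d (T - {u, v})) = {e}"
      using attached_hanging_T[OF s(2), of u v] e dn' vn by auto
    show "nb x \<inter> insert v (insert d (T - {u, v})) = {}"
      using attached_hanging_T[OF x, of u v] dn' vn by auto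
  qed (use sT sd dT dv hd nb_sym[OF s(1)] in auto)
qed

text \<open>A neighbour of \<open>x\<close> other than \<open>u\<close> and \<open>x'\<close> could
  play the part of \<open>s\<close> in \<open>outgoing_stem\<close>.\<close>

lemma outgoing_stem_card:
  assumes h: "hanging nb T u v w" and d: "double d" and z: "z \<in> nb d" "z \<notin> T \<union> N"
    and dv: "d \<in> nb v" and du: "d \<notin> nb u" and nu: "nb u = {v, x, x'}" and x: "attached u x"
    and nd: "\<And>s. s \<in> nb x \<Longrightarrow> \<not> double s"
  shows "card (nb x) = 2"
proof (rule ccontr)
  assume "card (nb x) \<noteq> 2"
  then have "card (nb x) = 3" using attached_card[OF x] by blast
  then obtain s s' where s: "nb x = {u, s, s'}" "distinct [x, u, s, s']"
    using nb3E1[OF _ attached_mem(1)[OF x]] by metis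
  obtain r where r: "r \<in> nb x" "r \<noteq> u" "r \<noteq> x'" using s by (cases "s = x'") auto
  have rT: "r \<notin> T" using attachedD(1)[OF x r(1)] r by blast
  have "r \<noteq> v" using rT hangingD(5)[OF h] by blast
  moreover have "r \<noteq> x" using r(1) nb_irr by blast
  ultimately have ru: "r \<notin> nb u" using nu r by auto
  obtain e where "attached e r"
    using N_attached_or_double[OF attached_closed[OF x r(1) rT] nd[OF r(1)]] by blast
  then show False using outgoing_stem[OF h d z dv du x r(1) _ ru] by blast
qed

text \<open>Two doubles leave no budget: both have slack exactly 2 and hence an outside neighbour,
  and all attached vertices are cubic. Then at each hanging pair one double has its two tree
  neighbours exactly in the pair and the other is adjacent to the leaf. Two disjoint pairs cannot
  both be served in this way.\<close>

lemma two_doubles: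
  assumes d1: "double d1" and d2: "double d2" and ne: "d1 \<noteq> d2"
  shows False
proof -
  have dN: "d1 \<in> N" "d2 \<in> N" using double_N d1 d2 by auto
  have s3: "slack d1 + slack d2 + slack x \<le> 4" if "x \<in> N" "x \<noteq> d1" "x \<noteq> d2" for x
    using slack_subset[of "{d1, d2, x}"] that dN ne by simp
  have s2: "slack d1 + slack d2 \<le> 4" using slack_subset[of "{d1, d2}"] dN ne by simp
  have g2: "2 \<le> slack d1" "2 \<le> slack d2" using double_slack d1 d2 by auto
  have only: "x = d1 \<or> x = d2" if "double x" for x
    using s3[OF double_N[OF that]] double_slack[OF that] g2 by fastforce
  have out: "\<exists>z. z \<in> nb d \<and> z \<notin> T \<union> N" if "double d" for d
  proof (rule ccontr)
    assume "\<not> ?thesis"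
    then have "slack d + card (nb d) = 6" by (intro double_slack_inner[OF that]) blast
    moreover have "slack d \<le> 2" using only[OF that] s2 g2 by auto
    ultimately show False using nb_card[of d] by linarith
  qed
  have nbd: "\<not> double s" if "x \<in> nb s" "x \<in> N" for s x
  proof
    assume s: "double s"
    then obtain z where "z \<in> nb s" "z \<notin> T \<union> N" using out by blast
    then show False using double_outgoing[OF s, of z x] that N_iff[of x] by blast
  qed
  have a3: "card (nb x) = 3" if "attached e x" for e x
  proof -
    have "slack x = 0" using s3[OF attached_N[OF that]] g2 double_not_attached[OF d1] double_not_attached[OF d2] that
      by fastforce
    then show ?thesis using attached_card[OF that] slack_attached2[OF that] by auto
  qed
  have main: "\<exists>d d'. double d \<and> double d' \<and> d \<noteq> d' \<and> nb d \<inter> T = {u, v} \<and> u \<in> nb d'"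
    if h: "hanging nb T u v w" for u v w
  proof -
    note hd = hangingD[OF h]
    obtain d where d: "double d" "d \<in> nb u \<union> nb v" using hanging_double'[OF h] by blast
    obtain z where z: "z \<in> nb d" "z \<notin> T \<union> N" using out[OF d(1)] by blast
    have dT: "d \<notin> T" using d by (simp add: double_def)
    from hanging_nbs'[OF h hd(4,5)] obtain x1 x2 y where x: "nb u = {v, x1, x2}" "x1 \<noteq> x2"
      "nb v = {u, w, y}" "x1 \<in> N" "x2 \<in> N" "y \<in> N" "y \<noteq> w" "y \<noteq> u" by metis
    have xv: "x1 \<notin> T" "x2 \<notin> T" "x1 \<noteq> v" "x2 \<noteq> v" using x(4,5) hd(5) by (auto simp: N_iff)
    consider (leaf) "d \<in> nb u" "d \<notin> nb v" | (stem) "d \<in> nb v" "d \<notin> nb u"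
      | (full) "d \<in> nb u" "d \<in> nb v" using d by blast
    then show ?thesis
    proof cases
      case leaf
      have "double y" using outgoing_leaf(1)[OF h d(1) z leaf, of y] x by auto
      moreover obtain x where x': "x \<in> nb u" "x \<noteq> v" "x \<noteq> d" using x xv by (cases "x1 = d") auto
      then have "double x" using outgoing_leaf(2)[OF h d(1) z leaf] by blast
      moreover have "y \<noteq> d" using leaf x by auto
      ultimately have "x = y" "double y" "y \<noteq> d" using only[of x] only[of y] only[OF d(1)] x' by auto
      moreover have "nb y \<inter> T = {u, v}"
        by (rule double_nb) (use \<open>double y\<close> \<open>x = y\<close> nb_sym[OF x'(1)] x(3) nb_sym[of y v] hd in auto)
      ultimately show ?thesis using d(1) nb_sym[OF leaf(1)] by blast
    next
      case stem
      \<comment> \<open>At most one outer neighbour of \<open>u\<close> is the other double. The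
        remaining one is attached and must have degree 2, for which no slack is left.\<close>
      have "\<exists>x x'. nb u = {v, x, x'} \<and> x \<noteq> v \<and> x \<notin> T \<and> \<not> double x"
      proof (cases "double x1")
        case True
        have "x1 \<noteq> d" "x2 \<noteq> d" using stem x by auto
        then have "\<not> double x2" using only[of x1] only[of x2] only[OF d(1)] True x(2) by auto
        then show ?thesis using x(1) xv by (intro exI[of _ x2] exI[of _ x1]) auto
      next
        case False
        then show ?thesis using x(1) xv by blast
      qed
      then obtain x x' where xx: "nb u = {v, x, x'}" "x \<noteq> v" "x \<notin> T" "\<not> double x" by blast
      have ax: "attached u x" using not_double_attached[of x u] xx hd(4) by auto
      have "card (nb x) = 2"
      proof (rule outgoing_stem_card[OF h d(1) z stem xx(1) ax])
        show "\<not> double s" if "s \<in> nb x" for s using nbd[OF nb_sym[OF that] attached_N[OF ax]] .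
      qed
      then show ?thesis using a3[OF ax] by simp
    next
      case full
      have dn: "nb d \<inter> T = {u, v}"
        by (rule double_nb[OF d(1)]) (use nb_sym[OF full(1)] nb_sym[OF full(2)] hd in auto)
      obtain x where x': "x \<in> nb u" "x \<noteq> v" "x \<noteq> d" "x \<notin> T" using x xv by (cases "x1 = d") auto
      have "double x"
      proof (rule ccontr)
        assume "\<not> double x"
        then have ax: "attached u x" using not_double_attached[OF x'(1) hd(4) x'(4)] by blast
        obtain s s' where s: "nb x = {u, s, s'}" "distinct [x, u, s, s']"
          using nb3E1[OF a3[OF ax] attached_mem(1)[OF ax]] by metis
        have sx: "s \<in> nb x" using s by simp
        have sT: "s \<notin> T" using attachedD(1)[OF ax sx] s by auto
        have "\<not> double s" using nbd[OF nb_sym[OF sx] attached_N[OF ax]] .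
        then obtain e where "attached e s"
          using N_attached_or_double[OF attached_closed[OF ax sx sT]] by blast
        then show False using outgoing_full[OF h d(1) z full(2,1) ax sx] by blast
      qed
      then show ?thesis using d(1) dn x' nb_sym[OF x'(1)] by blast
    qed
  qed
  obtain u v w u' v' w' where h: "hanging nb T u v w" "hanging nb T u' v' w'" "{u, v} \<inter> {u', v'} = {}"
    using two_hanging[OF T_ptree card_T_ge4] by (elim exE conjE) (rule that)
  obtain d d' where d: "double d" "double d'" "d \<noteq> d'" "nb d \<inter> T = {u, v}" "u \<in> nb d'"
    using main[OF h(1)] by blast
  obtain e e' where e: "double e" "double e'" "e \<noteq> e'" "nb e \<inter> T = {u', v'}" "u' \<in> nb e'"
    using main[OF h(2)] by blast
  have "e \<noteq> d" using d(4) e(4) h(3) by blast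
  then have "e = d'" using only d e by metis
  then have "u \<in> {u', v'}" using d(5) e(4) hangingD(4)[OF h(1)] by blast
  then show False using h(3) by blast
qed

text \<open>The only double serves two disjoint pairs, so it has one neighbour in each; that
  neighbour is not the leaf, since this would force a second double. Hence both outer neighbours of
  each leaf have degree 2, and these four vertices plus \<open>d\<close> use at least 6.\<close>

lemma single_double_outgoing:
  assumes d: "double d" and z: "z \<in> nb d" "z \<notin> T \<union> N"
  shows False
proof -
  have only: "x = d" if "double x" for x using two_doubles[OF d that] by blast
  have main: "\<exists>x1 x2. x1 \<noteq> x2 \<and> attached u x1 \<and> attached u x2 \<and> slack x1 = 1 \<and> slack x2 = 1"
    if h: "hanging nb T u v w" and once: "\<not> (d \<in> nb u \<and> d \<in> nb v)" for u v w
  proof -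
    note hd = hangingD[OF h]
    have "d \<in> nb u \<union> nb v" using hanging_double'[OF h] only by blast
    from hanging_nbs'[OF h hd(4,5)] obtain x1 x2 y where x: "nb u = {v, x1, x2}" "x1 \<noteq> x2"
      "nb v = {u, w, y}" "x1 \<in> N" "x2 \<in> N" "y \<in> N" "y \<noteq> w" "y \<noteq> u" by metis
    have "d \<notin> nb u"
    proof
      assume du: "d \<in> nb u"
      then have dv: "d \<notin> nb v" using once by blast
      then have "double y" using outgoing_leaf(1)[OF h d z du dv, of y] x by auto
      then show False using only[of y] dv x by auto
    qed
    then have dd: "d \<in> nb v" "d \<notin> nb u" using \<open>d \<in> nb u \<union> nb v\<close> by auto
    have "x1 \<notin> T" "x2 \<notin> T" using x(4,5) by (auto simp: N_iff)
    moreover have "\<not> double x1" "\<not> double x2" using only[of x1] only[of x2] dd x by auto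
    ultimately have a: "attached u x1" "attached u x2"
      using not_double_attached[of x1 u] not_double_attached[of x2 u] x hd(4) by auto
    have nd: "\<not> double s" if "attached u x" "s \<in> nb x" for s x
    proof
      assume "double s"
      then have "x \<in> nb d" using only nb_sym[OF that(2)] by blast
      then show False using double_outgoing[OF d z, of x] attached_N[OF that(1)] z attachedD(2)[OF that(1)] by blast
    qed
    have "card (nb x1) = 2" using outgoing_stem_card[OF h d z dd x(1) a(1)] nd[OF a(1)] by blast
    moreover have "nb u = {v, x2, x1}" using x by auto
    then have "card (nb x2) = 2" using outgoing_stem_card[OF h d z dd _ a(2)] nd[OF a(2)] by blast
    ultimately show ?thesis using a slack_attached2 x(2) by blast
  qed
  obtain u v w u' v' w' where h: "hanging nb T u v w" "hanging nb T u' v' w'" "{u, v} \<inter> {u', v'} = {}"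
    using two_hanging[OF T_ptree card_T_ge4] by (elim exE conjE) (rule that)
  have once: "\<not> (d \<in> nb u \<and> d \<in> nb v)"
    if h: "hanging nb T u v w" "hanging nb T u' v' w'" "{u, v} \<inter> {u', v'} = {}" for u v w u' v' w'
  proof
    assume a: "d \<in> nb u \<and> d \<in> nb v"
    note hd = hangingD[OF h(1)]
    have "nb d \<inter> T = {u, v}" by (rule double_nb[OF d]) (use nb_sym[of d u] nb_sym[of d v] a hd in auto)
    moreover have "d \<in> nb u' \<union> nb v'" using hanging_double'[OF h(2)] only by blast
    then have "u' \<in> nb d \<or> v' \<in> nb d" using nb_sym by blast
    ultimately show False using h(3) hangingD(4,5)[OF h(2)] by blast
  qed
  have "{u', v'} \<inter> {u, v} = {}" using h(3) by blast
  then obtain x1 x2 y1 y2 where x: "x1 \<noteq> x2" "attached u x1" "attached u x2" "slack x1 = 1" "slack x2 = 1"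
    and y: "y1 \<noteq> y2" "attached u' y1" "attached u' y2" "slack y1 = 1" "slack y2 = 1"
    using main[OF h(1) once[OF h]] main[OF h(2) once[OF h(2,1)]] by metis
  have uu: "u \<noteq> u'" using h(3) by blast
  have xy: "p \<noteq> q" if "attached u p" "attached u' q" for p q
    using that uu attached_unique[OF that(1) attached_mem(2)[OF that(2)]] attached_mem(3)[OF that(2)] by blast
  have "sum slack {d, x1, x2, y1, y2} \<le> 4"
    by (rule slack_subset) (use double_N[OF d] attached_N x y in auto)
  moreover have "distinct [d, x1, x2, y1, y2]"
    using x(1) y(1) xy[OF x(2) y(2)] xy[OF x(2) y(3)] xy[OF x(3) y(2)] xy[OF x(3) y(3)]
      double_not_attached[OF d] x(2,3) y(2,3) by auto
  ultimately have "slack d + 4 \<le> 4" using x y by simp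
  then show False using double_slack[OF d] by simp
qed

end

lemma card_insert_insert:
  "finite A \<Longrightarrow> a \<notin> A \<Longrightarrow> b \<notin> A \<Longrightarrow> a \<noteq> b \<Longrightarrow> card (insert a (insert b A)) = card A + 2"
  by simp

context maximal_tree
begin

section \<open>A single double without neighbours outside \<open>T \<union> N\<close>\<close>

lemma card3_in:
  "nb s = {a, b, c} \<Longrightarrow> a \<noteq> b \<Longrightarrow> a \<noteq> c \<Longrightarrow> b \<noteq> c \<Longrightarrow> a \<in> X \<Longrightarrow> b \<in> X \<Longrightarrow> c \<in> X
   \<Longrightarrow> 3 \<le> card (nb s \<inter> X)"
  by (rule card_ge_subset[of _ "{a, b, c}"]) auto

lemma card2_in:
  "a \<in> nb s \<Longrightarrow> b \<in> nb s \<Longrightarrow> a \<noteq> b \<Longrightarrow> a \<in> X \<Longrightarrow> b \<in> X \<Longrightarrow> 2 \<le> card (nb s \<inter> X)"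
  by (rule card_ge_subset[of _ "{a, b}"]) auto

lemma card1_in: "a \<in> nb s \<Longrightarrow> a \<in> X \<Longrightarrow> 1 \<le> card (nb s \<inter> X)"
  by (rule card_ge_subset[of _ "{a}"]) auto

text \<open>Otherwise \<open>T \<union> {x, y}\<close> is a larger tree: the leaves \<open>u\<close>
  and \<open>q\<close> are matched with \<open>x\<close> and \<open>y\<close>, and
  \<open>T - {u, q}\<close> has a perfect matching of its own.\<close>

lemma leaf_pair_adj:
  assumes S: "ptree nb (T - {u, q})" and uq: "u \<in> T" "q \<in> T" "u \<noteq> q"
    and u: "nb u \<inter> T = {v}" "v \<noteq> q" and q: "nb q \<inter> T = {w}" "w \<noteq> u"
    and x: "attached u x" and y: "attached q y"
  shows "y \<in> nb x"
proof (rule ccontr)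
  assume nyx: "y \<notin> nb x"
  let ?S = "T - {u, q}"
  let ?A = "insert u (insert x ?S)"
  have xy: "x \<notin> T" "y \<notin> T" "x \<noteq> y"
    using attachedD(2)[OF x] attachedD(2)[OF y] attached_unique[OF x uq(2)] attached_mem(3)[OF y] uq(3) by blast+
  have ux: "u \<noteq> x" "q \<noteq> y" using xy uq by auto
  have vu: "v \<noteq> u" "w \<noteq> q" using u(1) q(1) nb_irr by blast+
  have "nb u \<inter> ?S = {v}" using u vu by blast
  moreover have "nb x \<inter> ?S = {}" using attached_hanging_T[OF x, of u q] by auto
  ultimately have A: "ptree nb ?A"
    using ptree.add[OF S, of u x v] attached_mem(3)[OF x] xy ux by auto
  have "card ?S + 2 = card T"
    using uq T_fin card_Int_Diff[of T "{u, q}"] by (simp add: Int_absorb1)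
  then have cA: "card ?A = card T" using T_fin ux xy by simp
  have uq': "u \<notin> nb q"
  proof
    assume "u \<in> nb q"
    then have "u \<in> nb q \<inter> T" using uq(1) by simp
    then show False using q by simp
  qed
  have "x \<notin> nb q" using attached_unique[OF x uq(2)] uq(3) by blast
  moreover have "u \<notin> nb y" using attachedD(1)[OF y, of u] uq by blast
  moreover have "x \<notin> nb y" using nyx nb_sym[of x y] by blast
  ultimately show False
    using extension[OF A cA, of q y w] attached_mem(3)[OF y] xy ux uq q vu uq'
      attached_hanging_T[OF y, of u q] by auto
qed

text \<open>The 4-cycle on \<open>x1\<close>, \<open>x2\<close>, \<open>y1\<close>,
  \<open>y2\<close>, the two edges each to \<open>u\<close> and \<open>q\<close>, and the edge
  between \<open>u\<close> and \<open>v\<close> are nine edges. The induced path \<open>u\<close>,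
  \<open>x1\<close>, \<open>y1\<close>, \<open>q\<close> leaves the set at most through
  \<open>w\<close>.\<close>

lemma bipartite_reduction:
  assumes u: "nb u = {v, x1, x2}" and q: "nb q = {w, y1, y2}"
    and e: "y1 \<in> nb x1" "y1 \<in> nb x2" "y2 \<in> nb x1" "y2 \<in> nb x2"
    and d: "distinct [u, v, x1, x2, y1, y2, q]"
  shows False
proof -
  have n1: "nb x1 = {u, y1, y2}" by (rule card3I) (use e nb_sym[of x1 u] u d in auto)
  have n2: "nb x2 = {u, y1, y2}" by (rule card3I) (use e nb_sym[of x2 u] u d in auto)
  have m1: "nb y1 = {q, x1, x2}"
    by (rule card3I) (use nb_sym[OF e(1)] nb_sym[OF e(2)] nb_sym[of y1 q] q d in auto)
  have m2: "nb y2 = {q, x1, x2}"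
    by (rule card3I) (use nb_sym[OF e(3)] nb_sym[OF e(4)] nb_sym[of y2 q] q d in auto)
  let ?X = "{u, v, x1, x2, y1, y2, q}"
  let ?Y = "{u, x1, y1, q}"
  have XV: "?X \<subseteq> V"
    using nb_mem[of v u] nb_mem[of x1 u] nb_mem[of x2 u] nb_mem[of y1 q] nb_mem[of y2 q] u q by auto
  have pY: "ptree nb ?Y"
    by (rule ptree_path4) (use u n1 m1 d in auto)
  define f where "f x = card (nb x \<inter> ?X)" for x
  have "3 \<le> f u" unfolding f_def by (rule card3_in[of _ v x1 x2]) (use u d in simp_all)
  moreover have "3 \<le> f x1" unfolding f_def by (rule card3_in[of _ u y1 y2]) (use n1 d in simp_all)
  moreover have "3 \<le> f x2" unfolding f_def by (rule card3_in[of _ u y1 y2]) (use n2 d in simp_all)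
  moreover have "3 \<le> f y1" unfolding f_def by (rule card3_in[of _ q x1 x2]) (use m1 d in \<open>simp_all add: eq_commute[of q]\<close>)
  moreover have "3 \<le> f y2" unfolding f_def by (rule card3_in[of _ q x1 x2]) (use m2 d in \<open>simp_all add: eq_commute[of q]\<close>)
  moreover have "2 \<le> f q" unfolding f_def by (rule card2_in[of y1 _ y2]) (use q d in simp_all)
  moreover have "1 \<le> f v" unfolding f_def by (rule card1_in[of u]) (use nb_sym[of v u] u in simp_all)
  ultimately have "18 \<le> sum f ?X" using d by simp
  then have S: "18 \<le> (\<Sum>x\<in>?X. card (nb x \<inter> ?X))" unfolding f_def .
  show False
    by (rule deletion7[OF XV pY, where ?y0.0 = q and ?z0.0 = w, OF _ _ _ _ _ S])
      (use u q n1 m1 d in auto)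
qed

text \<open>Exchange \<open>{u, v}\<close> for \<open>{d, u}\<close>: now \<open>u\<close> is a leaf
  hanging at \<open>d\<close>, and \<open>x\<close> with leaf \<open>y\<close> can be added at
  \<open>u\<close>. By \<open>noTd\<close>, neither \<open>x\<close> nor \<open>y\<close> is
  adjacent to \<open>d\<close>.\<close>

lemma inner_leaf:
  assumes h: "hanging nb T u v w" and d: "double d" and only: "\<And>x. double x \<Longrightarrow> x = d"
    and noTd: "\<And>x. x \<in> nb d \<Longrightarrow> x \<in> nb u \<union> nb v \<Longrightarrow> x \<in> T"
    and du: "d \<in> nb u" and dv: "d \<notin> nb v"
  shows False
proof -
  note hd = hangingD[OF h]
  have dT: "d \<notin> T" using d by (simp add: double_def)
  obtain b where b: "nb d \<inter> T = {u, b}" "b \<noteq> u" "b \<in> T" "b \<in> nb d"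
    using double_other[OF d nb_sym[OF du] hd(4)] by metis
  have bv: "b \<noteq> v" using dv nb_sym[OF b(4)] by auto
  from hanging_nbs'[OF h hd(4,5)] obtain x1 x2 y where x: "nb u = {v, x1, x2}" "x1 \<noteq> x2"
    "nb v = {u, w, y}" "x1 \<in> N" "x2 \<in> N" "y \<in> N" "y \<noteq> w" "y \<noteq> u" by metis
  have NT: "x1 \<notin> T" "x2 \<notin> T" "y \<notin> T" using x by (auto simp: N_iff)
  obtain x where x': "x \<in> nb u" "x \<noteq> v" "x \<noteq> d" "x \<notin> T"
    using x NT hd(5) by (cases "x1 = d") auto
  have ax: "attached u x" using not_double_attached[OF x'(1) hd(4) x'(4)] only x'(3) by blast
  have yv: "y \<in> nb v" "y \<noteq> d" using x dv by auto
  have ay: "attached v y" using not_double_attached[OF yv(1) hd(5) NT(3)] only yv(2) by blast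
  have xy: "y \<in> nb x" by (rule hanging_attached_adj[OF h ax ay])
  have dn: "d \<notin> nb x" "d \<notin> nb y" using noTd[of x] noTd[of y] nb_sym[of d x] nb_sym[of d y] x' yv NT by blast+
  have uy: "u \<notin> nb y" using attachedD(1)[OF ay, of u] hd by blast
  show False
  proof (rule swap_extension[OF h, of d u b x y u])
    show "nb d \<inter> (T - {u, v}) = {b}" using b bv by blast
    show "nb u \<inter> (T - {u, v}) = {}" using hanging_T(1)[OF h] by blast
    show "nb x \<inter> insert d (insert u (T - {u, v})) = {u}"
      using attached_hanging_T[OF ax, of u v] attached_mem(1)[OF ax] dn by auto
    show "nb y \<inter> insert d (insert u (T - {u, v})) = {}"
      using attached_hanging_T[OF ay, of u v] uy dn by auto
  qed (use dT nb_sym[OF du] xy x' yv NT hd in auto)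
qed

text \<open>\<open>T\<close> is a path \<open>u\<close>, \<open>v\<close>, \<open>w\<close>,
  \<open>q\<close>, and without its ends it is still a matched edge, so outer neighbours attached at
  opposite ends are adjacent. If \<open>d\<close> is not adjacent to \<open>q\<close>,
  \<open>bipartite_reduction\<close> applies; otherwise the other outer neighbour of
  \<open>q\<close> gets the four neighbours \<open>q\<close>, \<open>x1\<close>, \<open>x2\<close>
  and \<open>g\<close>.\<close>

lemma inner_stem_small:
  assumes h: "hanging nb T u v w" and T4: "card T = 4"
    and d: "double d" and only: "\<And>x. double x \<Longrightarrow> x = d"
    and nv: "nb v = {u, w, d}" and nu: "nb u = {v, x1, x2}" "x1 \<noteq> x2"
    and ax: "attached u x1" "attached u x2"
  shows False
proof -
  note hd = hangingD[OF h]
  let ?T1 = "T - {u, v}"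
  have dT: "d \<notin> T" using d by (simp add: double_def)
  have T1: "ptree nb ?T1" by (rule hanging_remove[OF T_ptree h])
  have wT1: "w \<in> ?T1" using hd by auto
  have "card ?T1 = 2" using hd(4,5,7) T4 card_Diff_subset[of "{u, v}" T] by simp
  obtain q where q: "q \<in> nb w" "q \<in> ?T1" using ptree_nbr[OF T1 wT1] by blast
  have qw: "q \<noteq> w" using q nb_irr by auto
  have "{w, q} = ?T1"
    by (rule card_seteq) (use q wT1 qw T_fin \<open>card ?T1 = 2\<close> in auto)
  then have T: "T = {u, v, w, q}" using hd by blast
  have qT: "q \<in> T" "q \<noteq> u" "q \<noteq> v" using q by auto
  have quv: "q \<notin> nb u" "q \<notin> nb v" using hanging_T[OF h, of q] qT qw by auto
  have nqT: "nb q \<inter> T = {w}"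
    using T quv nb_sym[of u q] nb_sym[of v q] nb_irr[of q] nb_sym[OF q(1)] by auto
  have nwT: "nb w \<inter> T = {v, q}" using T hd q nb_irr[of w] by auto
  have hq: "hanging nb T q w v" unfolding hanging_def using nqT nwT qT by auto
  have Suq: "T - {u, q} = {w, v}" using T hd qT qw by auto
  have adj: "y \<in> nb x" if "attached u x" "attached q y" for x y
  proof (rule leaf_pair_adj[OF _ hd(4) qT(1) _ hd(1) _ nqT])
    show "ptree nb (T - {u, q})" unfolding Suq by (rule ptree_edge[OF hd(11)[THEN nb_sym]])
  qed (use qT hd that in auto)
  from hanging_nbs'[OF hq qT(1) hd(6)] obtain y1 y2 g where y: "nb q = {w, y1, y2}" "y1 \<noteq> y2"
    "nb w = {q, v, g}" "y1 \<in> N" "y2 \<in> N" "g \<in> N" "g \<noteq> v" "g \<noteq> q" by metis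
  have NT: "y1 \<notin> T" "y2 \<notin> T" "g \<notin> T" using y by (auto simp: N_iff)
  have xT: "x1 \<notin> T" "x2 \<notin> T" using attachedD(2) ax by auto
  show False
  proof (cases "d \<in> nb q")
    case False
    then have ay: "attached q y1" "attached q y2"
      using not_double_attached[of y1 q] not_double_attached[of y2 q] only y(1) NT qT by auto
    have ne: "x \<noteq> z" if "attached u x" "attached q z" for x z
      using attached_unique[OF that(1) qT(1)] attached_mem(3)[OF that(2)] qT(2) by blast
    show False
    proof (rule bipartite_reduction[OF nu(1) y(1)])
      show "distinct [u, v, x1, x2, y1, y2, q]"
        using nu y hd xT NT qT ne ax ay by auto
    qed (use adj ax ay in auto)
  next
    case True
    have "\<exists>y. y \<in> nb q \<and> y \<noteq> w \<and> y \<noteq> d \<and> y \<notin> T" using y NT hd(6) by (cases "y1 = d") auto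
    then obtain y where yy: "y \<in> nb q" "y \<noteq> w" "y \<noteq> d" "y \<notin> T" by blast
    have ay: "attached q y" using not_double_attached[OF yy(1) qT(1) yy(4)] only yy(3) by blast
    have dn: "nb d \<inter> T = {v, q}"
      by (rule double_nb[OF d]) (use nv nb_sym[of d v] nb_sym[OF True] hd qT in auto)
    have "g \<noteq> d"
    proof
      assume "g = d"
      then have "w \<in> nb d" using y(3) nb_sym[of d w] by simp
      then have "w \<in> {v, q}" unfolding dn[symmetric] using hd(6) by simp
      then show False using hd(8) qw by auto
    qed
    then have ag: "attached w g" using not_double_attached[of g w] only y(3) NT hd(6) by auto
    have "g \<in> nb y" by (rule hanging_attached_adj[OF hq ay ag])
    moreover have "x1 \<in> nb y" "x2 \<in> nb y" using adj ax ay nb_sym by blast+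
    moreover have "g \<noteq> x1" "g \<noteq> x2"
      using attached_unique[OF ax(1) hd(6) attached_mem(3)] attached_unique[OF ax(2) hd(6) attached_mem(3)] ag hd(3) by blast+
    ultimately have "nb y = {g, x1, x2}" by (intro card3I) (use nu in auto)
    moreover have "q \<in> nb y" by (rule attached_mem(1)[OF ay])
    ultimately show False using qT NT xT by auto
  qed
qed

text \<open>Both \<open>v\<close> and \<open>q\<close> are attached to \<open>w\<close>. Matching
  \<open>w\<close> with \<open>v\<close> shows that \<open>T\<close> without the leaves
  \<open>u\<close> and \<open>q\<close> is again a tree of the required kind, so
  \<open>leaf_pair_adj\<close> leads to \<open>bipartite_reduction\<close>.\<close>

lemma inner_stem_alpha:
  assumes h: "hanging nb T u v w" and h1: "hanging nb (T - {u, v}) q w k"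
    and only: "\<And>x. double x \<Longrightarrow> x = d" and dq: "d \<notin> nb q"
    and nv: "nb v = {u, w, d}" "d \<notin> T" and nu: "nb u = {v, x1, x2}" "x1 \<noteq> x2"
    and ax: "attached u x1" "attached u x2"
  shows False
proof -
  note hd = hangingD[OF h]
  note hd1 = hangingD[OF h1]
  let ?T1 = "T - {u, v}"
  let ?T2 = "?T1 - {q, w}"
  have T1: "ptree nb ?T1" by (rule hanging_remove[OF T_ptree h])
  have T2: "ptree nb ?T2" by (rule hanging_remove[OF T1 h1])
  have qT: "q \<in> T" "q \<noteq> u" "q \<noteq> v" "q \<noteq> w" using hd1 by auto
  have kT: "k \<in> T" "k \<noteq> u" "k \<noteq> v" "k \<noteq> w" "k \<noteq> q" using hd1 by auto
  have quv: "q \<notin> nb u" "q \<notin> nb v" using hanging_T[OF h, of q] qT by auto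
  have nqT: "nb q \<inter> T = {w}" using hd1(1) nb_sym[of u q] nb_sym[of v q] quv by blast
  have nvT2: "nb v \<inter> ?T2 = {}" using hd(2) by blast
  have nwT2: "nb w \<inter> ?T2 = {k}" using hd1(2) kT hd1(6) by blast
  have "ptree nb (insert w (insert v ?T2))"
    using ptree.add[OF T2, of w v k] nvT2 nwT2 hd by auto
  moreover have Suq: "T - {u, q} = insert w (insert v ?T2)" using hd qT by auto
  ultimately have S: "ptree nb (T - {u, q})" by simp
  have adj: "y \<in> nb x" if "attached u x" "attached q y" for x y
    by (rule leaf_pair_adj[OF S hd(4) qT(1) _ hd(1) _ nqT]) (use qT hd that in auto)
  obtain y1 y2 where y: "nb q = {w, y1, y2}" "distinct [q, w, y1, y2]"
    using nb3E1[OF T_degree3[OF qT(1)] hd1(9)] by metis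
  have "t = w" if "t \<in> nb q" "t \<in> T" for t using nqT that by blast
  from this[of y1] this[of y2] have NT: "y1 \<notin> T" "y2 \<notin> T" using y by auto
  have ay: "attached q y1" "attached q y2"
    using not_double_attached[of y1 q] not_double_attached[of y2 q] only y(1) NT qT dq by auto
  have xT: "x1 \<notin> T" "x2 \<notin> T" using attachedD(2) ax by auto
  have ne: "x \<noteq> z" if "attached u x" "attached q z" for x z
    using attached_unique[OF that(1) qT(1)] attached_mem(3)[OF that(2)] qT(2) by blast
  show False
  proof (rule bipartite_reduction[OF nu(1) y(1)])
    show "distinct [u, v, x1, x2, y1, y2, q]" using nu y hd xT NT qT ne ax ay by auto
  qed (use adj ax ay in auto)
qed

text \<open>\<open>T\<close> ends in a path \<open>u\<close>, \<open>v\<close>, \<open>w\<close>,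
  \<open>q\<close> attached at \<open>k\<close>. The matching can be shifted along it:
  \<open>q\<close> takes the outer vertex \<open>y\<close> as partner, which frees \<open>w\<close>,
  \<open>v\<close> and \<open>u\<close> for other pairs.\<close>

lemma inner_stem_beta:
  assumes h: "hanging nb T u v w" and h1: "hanging nb (T - {u, v}) w q k"
    and d: "double d" and only: "\<And>x. double x \<Longrightarrow> x = d" and dq: "d \<notin> nb q" "d \<notin> nb w"
    and nv: "nb v = {u, w, d}" "d \<notin> T" and nu: "nb u = {v, x1, x2}" "x1 \<noteq> x2"
    and ax: "attached u x1" "attached u x2" and dx: "d \<notin> nb x1" "d \<notin> nb x2"
    and cx: "\<not> (card (nb x1) = 2 \<and> card (nb x2) = 2)"
  shows False
proof -
  note hd = hangingD[OF h]
  note hd1 = hangingD[OF h1]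
  let ?T1 = "T - {u, v}"
  let ?T2 = "?T1 - {w, q}"
  have T1: "ptree nb ?T1" by (rule hanging_remove[OF T_ptree h])
  have T2: "ptree nb ?T2" by (rule hanging_remove[OF T1 h1])
  have qT: "q \<in> T" "q \<noteq> u" "q \<noteq> v" "q \<noteq> w" using hd1 by auto
  have kT: "k \<in> T" "k \<noteq> u" "k \<noteq> v" "k \<noteq> w" "k \<noteq> q" using hd1 by auto
  have wT: "w \<in> T" "w \<noteq> u" "w \<noteq> v" using hd by auto
  have cT2: "card ?T2 + 4 = card T"
  proof -
    have "T - ?T2 = {u, v, w, q}" "?T2 \<subseteq> T" using hd qT by auto
    then show ?thesis using card_Diff_subset[of ?T2 T] T_fin card_mono[of T ?T2] hd qT wT by auto
  qed
  have quv: "q \<notin> nb u" "q \<notin> nb v" using hanging_T[OF h, of q] qT by auto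
  have nqT: "nb q \<inter> T = {w, k}" using hd1(2) nb_sym[of u q] nb_sym[of v q] quv by blast
  have nwT: "nb w \<inter> T = {v, q}" using hd1(1) hd by blast
  obtain y where nq: "nb q = {w, k, y}" "distinct [q, w, k, y]"
    using nb3E[OF T_degree3[OF qT(1)] hd1(10,11,3)] by metis
  obtain g where nw: "nb w = {v, q, g}" "distinct [w, v, q, g]"
    using nb3E[OF T_degree3[OF wT(1)] hd(12) hd1(9)] qT by metis
  have "t = w \<or> t = k" if "t \<in> nb q" "t \<in> T" for t using nqT that by blast
  moreover have "t = v \<or> t = q" if "t \<in> nb w" "t \<in> T" for t using nwT that by blast
  ultimately have NT: "y \<notin> T" "g \<notin> T" using nq nw by auto
  have xT: "x1 \<notin> T" "x2 \<notin> T" using attachedD(2) ax by auto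
  have ay: "attached q y" using not_double_attached[of y q] only dq nq NT qT by auto
  have ag: "attached w g" using not_double_attached[of g w] only dq nw NT wT by auto
  have gy: "g \<noteq> y" using attached_unique[OF ay wT(1)] nw qT by auto
  have yx: "y \<noteq> x" if "attached u x" for x using attached_unique[OF that qT(1)] nq qT by auto
  have gx: "g \<noteq> x" if "attached u x" for x using attached_unique[OF that wT(1)] nw wT by auto
  have yu: "y \<notin> nb u" using attached_unique[OF ay hd(4)] qT by blast
  have yw: "y \<notin> nb w" using attached_unique[OF ay wT(1)] qT by blast
  have yd: "y \<noteq> d" using nq dq by auto
  let ?A = "insert q (insert y ?T2)"
  have A: "ptree nb ?A"
  proof (rule ptree.add[OF T2])
    show "nb q \<inter> ?T2 = {k}" using nqT kT qT by blast
    show "nb y \<inter> ?T2 = {}" using attachedD(1)[OF ay] by blast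
  qed (use nq NT in auto)
  have cA: "card ?A + 2 = card T" using cT2 T_fin NT nq by simp
  \<comment> \<open>Otherwise \<open>T \<union> {x, y}\<close> is a tree, matched by
    \<open>q\<close> with \<open>y\<close>, \<open>w\<close> with \<open>v\<close>, and
    \<open>u\<close> with \<open>x\<close>.\<close>
  have yadj: "y \<in> nb x" if ax: "attached u x" for x
  proof (rule ccontr)
    assume yx': "y \<notin> nb x"
    let ?B = "insert w (insert v ?A)"
    have xT: "x \<notin> T" by (rule attachedD(2)[OF ax])
    have wv: "w \<notin> ?A" "v \<notin> ?A" using hd qT NT by auto
    have B: "ptree nb ?B"
    proof (rule ptree.add[OF A])
      show "nb w \<inter> ?A = {q}" using nw hd1 yw NT by auto
      show "nb v \<inter> ?A = {}" using nv hd qT yd NT by auto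
    qed (use wv hd in auto)
    have "card ?B = card ?A + 2" by (rule card_insert_insert) (use wv T_fin hd(8) in auto)
    then have cB: "card ?B = card T" using cA by linarith
    show False
    proof (rule extension[OF B cB, of u x v])
      show "nb u \<inter> ?B = {v}" using hanging_T(1)[OF h] hd yu qT by blast
      show "nb x \<inter> ?B = {}" using attachedD(1)[OF ax] yx' hd qT by blast
    qed (use xT NT yx[OF ax] qT wT hd attached_mem(3)[OF ax] in auto)
  qed
  have ny: "nb y = {q, x1, x2}"
    by (rule card3I) (use nb_sym[OF yadj[OF ax(1)]] nb_sym[OF yadj[OF ax(2)]] attached_mem(1)[OF ay]
        xT qT nu in auto)
  have sdist: "distinct [u, v, w, q, k, y, x1, x2]"
    using hd qT kT nq NT xT nu yx ax by auto
  show False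
  proof (cases "x2 \<in> nb x1")
    case True
    have n1: "nb x1 = {u, y, x2}"
      by (rule card3I) (use True yadj[OF ax(1)] attached_mem(1)[OF ax(1)] sdist in auto)
    have n2: "nb x2 = {u, y, x1}"
      by (rule card3I) (use nb_sym[OF True] yadj[OF ax(2)] attached_mem(1)[OF ax(2)] sdist in auto)
    \<comment> \<open>The nine edges are the five among \<open>u\<close>, \<open>x1\<close>,
      \<open>x2\<close>, \<open>y\<close> and the path from \<open>u\<close> through
      \<open>v\<close>, \<open>w\<close>, \<open>q\<close> to \<open>y\<close>.\<close>
    let ?X = "{u, y, x1, x2, v, q, w}"
    let ?Y = "{v, u, x1, y}"
    have XV: "?X \<subseteq> V"
      using T_sub hd qT nb_mem[of y q] nb_mem[of x1 u] nb_mem[of x2 u] nq nu by auto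
    have pY: "ptree nb ?Y"
      by (rule ptree_path4) (use nv nu n1 sdist yu yd ax double_not_attached[OF d] in auto)
    define f where "f x = card (nb x \<inter> ?X)" for x
    have "3 \<le> f u" unfolding f_def by (rule card3_in[of _ v x1 x2]) (use nu sdist in simp_all)
    moreover have "3 \<le> f y" unfolding f_def by (rule card3_in[of _ q x1 x2]) (use ny sdist in simp_all)
    moreover have "3 \<le> f x1" unfolding f_def by (rule card3_in[of _ u y x2]) (use n1 sdist in simp_all)
    moreover have "3 \<le> f x2" unfolding f_def by (rule card3_in[of _ u y x1]) (use n2 sdist in simp_all)
    moreover have "2 \<le> f v" unfolding f_def by (rule card2_in[of u _ w]) (use nv sdist in simp_all)
    moreover have "2 \<le> f q" unfolding f_def by (rule card2_in[of w _ y]) (use nq sdist in simp_all)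
    moreover have "2 \<le> f w" unfolding f_def by (rule card2_in[of v _ q]) (use nw sdist in simp_all)
    moreover have "distinct [u, y, x1, x2, v, q, w]" using sdist by auto
    ultimately have "18 \<le> sum f ?X" by simp
    then have S: "18 \<le> (\<Sum>x\<in>?X. card (nb x \<inter> ?X))" unfolding f_def .
    show False
      by (rule deletion7[OF XV pY, where ?y0.0 = v and ?z0.0 = d, OF _ _ _ _ _ S])
        (use nu nv n1 ny sdist in auto)
  next
    case False
    have key: False
      if ax: "attached u x1" "attached u x2" and nu: "nb u = {v, x1, x2}"
        and ny: "nb y = {q, x1, x2}" and sdist: "distinct [u, v, w, q, k, y, x1, x2]"
        and x12: "x2 \<notin> nb x1" and c3: "card (nb x1) = 3" and dx: "d \<notin> nb x1" for x1 x2
    proof -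
      have xT: "x1 \<notin> T" "x2 \<notin> T" using attachedD(2) ax by auto
      obtain s where n1: "nb x1 = {u, y, s}" "distinct [x1, u, y, s]"
        using nb3E[OF c3 attached_mem(1)[OF ax(1)] yadj[OF ax(1)]] sdist by auto
      have sx: "s \<in> nb x1" using n1 by simp
      have sT: "s \<notin> T" using attachedD(1)[OF ax(1) sx] n1 by auto
      have "\<not> double s" using only dx sx by blast
      then obtain e where as: "attached e s"
        using N_attached_or_double[OF attached_closed[OF ax(1) sx sT]] by blast
      have s2: "s \<noteq> x2" using x12 sx by blast
      have su: "s \<notin> nb u" using nu sT s2 n1 hd by auto
      have "s \<noteq> d" using sx dx by blast
      then have sv: "s \<notin> nb v" using nv sT hd by auto
      have e: "e \<noteq> u" "e \<noteq> v" using attached_mem(3)[OF as] su sv by auto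
      \<comment> \<open>As before, \<open>{u, v}\<close> could otherwise be exchanged for
        \<open>{s, x1}\<close> and \<open>u\<close> added with the leaf \<open>x2\<close>.\<close>
      have sx2: "s \<in> nb x2"
      proof (rule ccontr)
        assume c: "s \<notin> nb x2"
        have x21: "x1 \<notin> nb x2" using x12 nb_sym by blast
        show False
        proof (rule swap_extension[OF h, of s x1 e u x2 x1])
          show "nb s \<inter> (T - {u, v}) = {e}" using attached_hanging_T[OF as, of u v] e by auto
          show "nb x1 \<inter> (T - {u, v}) = {}" using attachedD(1)[OF ax(1)] by blast
          show "nb u \<inter> insert s (insert x1 (T - {u, v})) = {x1}"
            using hanging_T(1)[OF h] su nu by blast
          show "nb x2 \<inter> insert s (insert x1 (T - {u, v})) = {}"
            using attachedD(1)[OF ax(2)] c x21 by blast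
        qed (use sT xT s2 n1 nb_sym[OF sx] nu sdist in auto)
      qed
      have n2: "nb x2 = {u, y, s}"
        by (rule card3I) (use sx2 yadj[OF ax(2)] attached_mem(1)[OF ax(2)] n1 sdist in auto)
      have ns: "nb s = {e, x1, x2}"
        by (rule card3I) (use nb_sym[OF sx] nb_sym[OF sx2] attached_mem(1,2)[OF as] xT sdist in auto)
      show False
      proof (cases "g = s")
        case gs: False
        \<comment> \<open>Route the tree through \<open>y\<close> instead: \<open>x1\<close> with
          leaf \<open>u\<close> hangs at \<open>y\<close>, while \<open>v\<close> is left out, so
          that \<open>w\<close> can be added at \<open>q\<close> with the leaf
          \<open>g\<close>.\<close>
        let ?C = "insert x1 (insert u ?A)"
        have xu: "x1 \<notin> ?A" "u \<notin> ?A" using xT sdist NT hd by auto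
        have C: "ptree nb ?C"
        proof (rule ptree.add[OF A])
          show "nb x1 \<inter> ?A = {y}" using n1 sT qT hd by auto
          show "nb u \<inter> ?A = {}" using hanging_T(1)[OF h] yu qT by blast
        qed (use xu n1 sdist in auto)
        have "card ?C = card ?A + 2" by (rule card_insert_insert) (use xu T_fin sdist in auto)
        then have cC: "card ?C = card T" using cA by linarith
        have gne: "g \<noteq> x1" "g \<noteq> x2" using gx ax by blast+
        have gu: "g \<noteq> u" "g \<noteq> q" using NT hd(4) qT(1) by blast+
        have vC: "v \<notin> ?C" using sdist by auto
        have gC: "g \<notin> ?C" using gne gu gy NT(2) by blast
        have wC: "w \<notin> ?C" using sdist by auto
        show False
        proof (rule extension[OF C cC wC gC])
          show "g \<in> nb w" using nw(1) by simp
          show "nb w \<inter> ?C = {q}" unfolding nw(1) using vC gC by blast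
          have "u \<notin> nb g" using attachedD(1)[OF ag, of u] hd(4) wT(2) by blast
          moreover have "x1 \<notin> nb g" using nb_sym[of x1 g] n1(1) gs gy gu by auto
          moreover have "y \<notin> nb g" using nb_sym[of y g] ny gne gu by auto
          moreover have "q \<notin> nb g" using attachedD(1)[OF ag, of q] qT(1,4) by blast
          ultimately show "nb g \<inter> ?C = {}" using attachedD(1)[OF ag] by blast
        qed
      next
        case True
        then have ew: "e = w" using attached_unique[OF as wT(1)] nw by auto
        \<comment> \<open>Now \<open>s\<close> is adjacent to \<open>w\<close>. The nine edges are
          the 4-cycle on \<open>x1\<close>, \<open>x2\<close>, \<open>y\<close>, \<open>s\<close>,
          the two from \<open>u\<close> to it, and the path \<open>u\<close>, \<open>v\<close>,
          \<open>w\<close>, \<open>s\<close>.\<close>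
        let ?X = "{v, w, u, y, s, x1, x2}"
        let ?Y = "{w, s, x1, u}"
        have XV: "?X \<subseteq> V"
          using T_sub hd nb_mem[of y q] nb_mem[of x1 u] nb_mem[of x2 u] nb_mem[of s x1] nq nu n1 by auto
        have dX: "distinct [v, w, u, y, s, x1, x2]" using sdist n1 s2 sT hd by auto
        have pY: "ptree nb ?Y"
          by (rule ptree_path4) (use nw True ns ew n1 dX sT sdist gx ax in auto)
        define f where "f x = card (nb x \<inter> ?X)" for x
        have "2 \<le> f v" unfolding f_def by (rule card2_in[of w _ u]) (use nv dX in simp_all)
        moreover have "2 \<le> f w" unfolding f_def by (rule card2_in[of v _ s]) (use nw True dX in simp_all)
        moreover have "3 \<le> f u" unfolding f_def by (rule card3_in[of _ v x1 x2]) (use nu dX in simp_all)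
        moreover have "2 \<le> f y" unfolding f_def by (rule card2_in[of x1 _ x2]) (use ny dX in simp_all)
        moreover have "3 \<le> f s" unfolding f_def by (rule card3_in[of _ w x1 x2]) (use ns ew dX in simp_all)
        moreover have "3 \<le> f x1" unfolding f_def by (rule card3_in[of _ u y s]) (use n1 dX in simp_all)
        moreover have "3 \<le> f x2" unfolding f_def by (rule card3_in[of _ u y s]) (use n2 dX in simp_all)
        ultimately have "18 \<le> sum f ?X" using dX by simp
        then have S: "18 \<le> (\<Sum>x\<in>?X. card (nb x \<inter> ?X))" unfolding f_def .
        show False
          by (rule deletion7[OF XV pY, where ?y0.0 = w and ?z0.0 = q, OF _ _ _ _ _ S])
            (use nu nw n1 ns ew True dX in auto)
      qed
    qed
    have False': "x1 \<notin> nb x2" using False nb_sym by blast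
    have "card (nb x1) = 3 \<or> card (nb x2) = 3" using cx attached_card ax by blast
    then show False
    proof
      assume "card (nb x1) = 3"
      then show False using key[OF ax nu(1) ny sdist False _ dx(1)] by blast
    next
      assume c: "card (nb x2) = 3"
      have "nb u = {v, x2, x1}" "nb y = {q, x2, x1}" "distinct [u, v, w, q, k, y, x2, x1]"
        using nu ny sdist by auto
      then show False using key[OF ax(2,1) _ _ _ False' c dx(2)] by blast
    qed
  qed
qed

text \<open>The tree neighbours of \<open>d\<close> are one vertex in each of the two pairs, and
  \<open>inner_leaf\<close> makes the first of them \<open>v\<close>. The structure next to the pair
  decides the rest: once \<open>{u, v}\<close> is removed, some new hanging pair contains
  \<open>w\<close>, either as partner or as leaf.\<close>

lemma single_double_inner:
  assumes h: "hanging nb T u v w" and h': "hanging nb T u' v' w'" and disj: "{u, v} \<inter> {u', v'} = {}"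
    and d: "double d" and only: "\<And>x. double x \<Longrightarrow> x = d" and inner: "nb d \<subseteq> T \<union> N"
    and noTd: "\<And>x. x \<in> nb d \<Longrightarrow> x \<in> nb u \<union> nb v \<Longrightarrow> x \<in> T"
  shows False
proof -
  note hd = hangingD[OF h]
  have dT: "d \<notin> T" using d by (simp add: double_def)
  have touch: "\<exists>t \<in> {u, v}. t \<in> nb d" if "hanging nb T u v w" for u v w
    using hanging_double'[OF that] only nb_sym[of d u] nb_sym[of d v] by blast
  obtain b where b: "b \<in> {u', v'}" "b \<in> nb d" using touch[OF h'] by blast
  have bT: "b \<in> T" "b \<notin> {u, v}" using b hangingD(4,5)[OF h'] disj by auto
  have three: False if "t \<in> nb d" "t \<in> T" "s \<in> nb d" "s \<in> T" "r \<in> nb d" "r \<in> T" "distinct [t, s, r]" for t s r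
  proof -
    have "nb d \<inter> T = {t, s}" by (rule double_nb[OF d]) (use that in auto)
    then show False using that by auto
  qed
  have "d \<notin> nb u"
  proof
    assume du: "d \<in> nb u"
    have "d \<notin> nb v"
      using three[of u v b] du bT b(2) hd nb_sym[of d u] nb_sym[of d v] by auto
    then show False using inner_leaf[OF h d only noTd du] by blast
  qed
  moreover have "d \<in> nb u \<union> nb v" using hanging_double'[OF h] only by blast
  ultimately have du: "d \<notin> nb u" and dv: "d \<in> nb v" by auto
  have dnT: "nb d \<inter> T = {v, b}" by (rule double_nb[OF d]) (use dv nb_sym[OF dv] b bT hd in auto)
  from hanging_nbs'[OF h hd(4,5)] obtain x1 x2 y where x: "nb u = {v, x1, x2}" "x1 \<noteq> x2"
    "nb v = {u, w, y}" "x1 \<in> N" "x2 \<in> N" "y \<in> N" "y \<noteq> w" "y \<noteq> u" by metis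
  have NT: "x1 \<notin> T" "x2 \<notin> T" using x by (auto simp: N_iff)
  have nv: "nb v = {u, w, d}" using x(3) dv dT hd by auto
  have ax: "attached u x1" "attached u x2"
    using not_double_attached[of x1 u] not_double_attached[of x2 u] only x(1) NT hd(4) du by auto
  have dx: "d \<notin> nb x1" "d \<notin> nb x2"
    using noTd[of x1] noTd[of x2] NT x(1) nb_sym[of d x1] nb_sym[of d x2] by auto
  \<comment> \<open>A double without outside neighbours has slack at least 3, which leaves room for
    at most one attached vertex of degree 2.\<close>
  have cx: "\<not> (card (nb x1) = 2 \<and> card (nb x2) = 2)"
  proof
    assume "card (nb x1) = 2 \<and> card (nb x2) = 2"
    then have "slack x1 = 1" "slack x2 = 1" using slack_attached2 ax by auto
    moreover have "slack d + card (nb d) = 6" by (rule double_slack_inner[OF d inner])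
    then have "slack d \<ge> 3" using nb_card[of d] by linarith
    moreover have "sum slack {d, x1, x2} \<le> 4"
      by (rule slack_subset) (use double_N[OF d] x in auto)
    moreover have "distinct [d, x1, x2]" using x du by auto
    ultimately show False by simp
  qed
  show False
  proof (cases "card T = 4")
    case True
    then show False using inner_stem_small[OF h _ d only nv x(1,2) ax] by blast
  next
    case False
    let ?T1 = "T - {u, v}"
    have T1: "ptree nb ?T1" by (rule hanging_remove[OF T_ptree h])
    have "card ?T1 + 2 = card T" using hd T_fin card_Int_Diff[of T "{u, v}"] by (simp add: Int_absorb1)
    then have c4: "card ?T1 \<ge> 4" using False card_T_ge4 ptree_even[OF T_ptree] by presburger
    obtain u1 v1 w1 u2 v2 w2 where k: "hanging nb ?T1 u1 v1 w1" "hanging nb ?T1 u2 v2 w2"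
      "{u1, v1} \<inter> {u2, v2} = {}"
      using two_hanging[OF T1 c4] by (elim exE conjE) (rule that)
    \<comment> \<open>A pair that hangs in \<open>T - {u, v}\<close> and avoids \<open>w\<close>
      hangs in \<open>T\<close> as well and must see \<open>d\<close>. Besides \<open>v\<close>,
      only \<open>b\<close> is available in \<open>T\<close>, so two disjoint pairs cannot both
      avoid \<open>w\<close>.\<close>
    have tch: "\<exists>t \<in> {p, q}. t \<in> nb d \<and> t \<in> T \<and> t \<noteq> v"
      if k: "hanging nb ?T1 p q r" and w: "w \<notin> {p, q}" for p q r
    proof -
      have "hanging nb (insert v (insert u ?T1)) p q r"
        by (rule hanging_extend[OF k, of v w u]) (use hd w in auto)
      moreover have "insert v (insert u ?T1) = T" using hd by auto
      ultimately have "hanging nb T p q r" by simp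
      from touch[OF this] show ?thesis using hangingD(4,5)[OF k] by auto
    qed
    have "w \<in> {u1, v1} \<or> w \<in> {u2, v2}"
    proof (rule ccontr)
      assume "\<not> ?thesis"
      then obtain t s where ts: "t \<in> {u1, v1}" "t \<in> nb d" "t \<in> T" "t \<noteq> v"
        "s \<in> {u2, v2}" "s \<in> nb d" "s \<in> T" "s \<noteq> v" using tch[OF k(1)] tch[OF k(2)] by blast
      then have "t \<noteq> s" using k(3) by blast
      then show False using three[of v t s] ts nb_sym[OF dv] hd by auto
    qed
    then obtain p q r where k': "hanging nb ?T1 p q r" "w = p \<or> w = q" using k by blast
    note kd = hangingD[OF k'(1)]
    note hd' = hangingD[OF h']
    have Tn: "nb t \<inter> T = nb t \<inter> ?T1" if "t \<in> ?T1" "t \<noteq> w" for t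
    proof -
      have "t \<notin> nb u" "t \<notin> nb v" using hanging_T[OF h, of t] that by auto
      then have "u \<notin> nb t" "v \<notin> nb t" using nb_sym by blast+
      then show ?thesis by blast
    qed
    have wn: "nb w \<inter> T = insert v (nb w \<inter> ?T1)" using hd by blast
    have cw: "card (nb w \<inter> T) = Suc (card (nb w \<inter> ?T1))" unfolding wn by (simp add: T_fin)
    have c1: "card (nb u' \<inter> T) = 1" unfolding hd'(1) by simp
    have c2: "card (nb v' \<inter> T) = 2" unfolding hd'(2) using hd'(3) by simp
    show False
    proof (cases "w = q")
      case True
      have ne: "p \<noteq> w" using kd True by auto
      have np: "nb p \<inter> T = {w}" using Tn[OF kd(4) ne] kd(1) True by simp
      have w3: "card (nb w \<inter> T) = 3" using cw kd(2,3) True by simp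
      \<comment> \<open>The leaf \<open>p\<close> could only be \<open>u'\<close>, with
        \<open>w\<close> as its partner \<open>v'\<close>; but \<open>w\<close> has three neighbours
        in \<open>T\<close> and \<open>v'\<close> only two.\<close>
      have "b \<noteq> p"
      proof
        assume "b = p"
        then consider "p = u'" | "p = v'" using b by blast
        then show False
        proof cases
          case 1
          then have "w = v'" using np hd'(1) by auto
          then show False using c2 w3 by simp
        next
          case 2
          then show False using np c2 by simp
        qed
      qed
      then have "d \<notin> nb p" using dnT kd(4) nb_sym[of d p] by blast
      then show False using inner_stem_alpha[OF h _ only _ nv dT x(1,2) ax] k'(1) True by blast
    next
      case False
      then have wp: "w = p" using k'(2) by blast
      have qw: "q \<noteq> w" using False by blast
      have nq: "nb q \<inter> T = {w, r}" using Tn[OF kd(5) qw] kd(2) wp by simp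
      have nw: "nb w \<inter> T = {v, q}" using wn kd(1) wp by simp
      have nonleaf: "u' \<noteq> w" "u' \<noteq> q" using c1 nq nw kd(3) wp kd(5) by auto
      have T2: "ptree nb (?T1 - {w, q})" using hanging_remove[OF T1 k'(1)] wp by simp
      \<comment> \<open>Neither \<open>w\<close> nor \<open>q\<close> is a leaf of \<open>T\<close>,
        so \<open>b\<close> could only be \<open>v'\<close>, with the leaf \<open>u'\<close> among
        its tree neighbours. Those of \<open>w\<close> are \<open>v\<close>, which is in the other
        pair, and \<open>q\<close>; those of \<open>q\<close> are \<open>w\<close> and
        \<open>r\<close>, and \<open>r\<close> has another neighbour in the remaining tree.\<close>
      have bw: "b \<noteq> w"
      proof
        assume bw: "b = w"
        then have "v' = w" using b nonleaf by blast
        then have "u' \<in> {v, q}" using nw hd'(2) by blast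
        then have "u' = v" using nonleaf by blast
        then show False using disj by blast
      qed
      have bq: "b \<noteq> q"
      proof
        assume bq: "b = q"
        then have vq: "v' = q" using b nonleaf by blast
        then have "u' \<in> {w, r}" using nq hd'(2) by blast
        then have ur: "u' = r" using nonleaf by blast
        have "r \<in> ?T1 - {w, q}" using kd wp by auto
        then obtain t where "t \<in> nb r" "t \<in> ?T1 - {w, q}" using ptree_nbr[OF T2] by blast
        then show False using hanging_T(1)[OF h', of t] ur vq by auto
      qed
      have "t = v \<or> t = b" if "d \<in> nb t" "t \<in> T" for t
        using dnT nb_sym[OF that(1)] that(2) by blast
      from this[of w] this[of q] have "d \<notin> nb w" "d \<notin> nb q" using bw bq hd(6,8) kd(5) by auto
      then show False
        using inner_stem_beta[OF h _ d only _ _ nv dT x(1,2) ax dx cx] k'(1) wp by blast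
    qed
  qed
qed

text \<open>The double has at most one neighbour outside \<open>T\<close>. Such a vertex is attached
  to at most one of two disjoint hanging pairs, so the other pair satisfies the condition
  \<open>noTd\<close> of \<open>single_double_inner\<close>.\<close>

lemma contradiction: False
proof -
  obtain u v w u' v' w' where h: "hanging nb T u v w" "hanging nb T u' v' w'" "{u, v} \<inter> {u', v'} = {}"
    using two_hanging[OF T_ptree card_T_ge4] by (elim exE conjE) (rule that)
  obtain d where d: "double d" using hanging_double'[OF h(1)] by blast
  have only: "x = d" if "double x" for x using two_doubles[OF d that] by blast
  have inner: "nb d \<subseteq> T \<union> N" using single_double_outgoing[OF d] by blast
  have dc: "card (nb d \<inter> T) = 2" using d by (simp add: double_def)
  then have c1: "card (nb d - T) \<le> 1" using card_Int_Diff[of "nb d" T] nb_card[of d] by simp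
  show False
  proof (cases "\<exists>x. x \<in> nb d \<and> x \<in> nb u \<union> nb v \<and> x \<notin> T")
    case False
    then show False using single_double_inner[OF h d only inner] by blast
  next
    case True
    then obtain g where g: "g \<in> nb d" "g \<in> nb u \<union> nb v" "g \<notin> T" by blast
    have "g \<noteq> d" using g nb_irr by blast
    then have nd: "\<not> double g" using only by blast
    obtain e where e: "e \<in> {u, v}" "attached e g"
      using not_double_attached[of g u] not_double_attached[of g v] g nd hangingD(4,5)[OF h(1)] by blast
    have "x \<in> T" if x: "x \<in> nb d" "x \<in> nb u' \<union> nb v'" for x
    proof (rule ccontr)
      assume xT: "x \<notin> T"
      then have "x = g" using card_le_Suc0_iff_eq[of "nb d - T"] c1 x g by auto
      then have "u' = e \<or> v' = e"
        using attached_unique[OF e(2), of u'] attached_unique[OF e(2), of v'] x hangingD(4,5)[OF h(2)] by blast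
      then show False using e(1) h(3) by blast
    qed
    moreover have "{u', v'} \<inter> {u, v} = {}" using h(3) by blast
    ultimately show False using single_double_inner[OF h(2,1) _ d only inner] by blast
  qed
qed

end

section \<open>The induction on the number of vertices\<close>

lemma (in minimal_counterexample) contradiction: False
proof -
  have "V \<noteq> {}"
  proof
    assume "V = {}"
    then show False using no_forest pforest.empty[of nb] by auto
  qed
  then obtain v b where "b \<in> nb v" using no_isolated by blast
  then have ex: "ptree nb {v, b}" by (rule ptree_edge)
  have "\<exists>T. ptree nb T \<and> (\<forall>S. ptree nb S \<longrightarrow> card S \<le> card T)"
  proof (rule ex_has_greatest_nat[where b = "Suc (card V)"])
    show "ptree nb {v, b}" by (rule ex)
    show "\<forall>S. ptree nb S \<longrightarrow> card S < Suc (card V)"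
      using ptree_sub card_mono[OF fin] by (simp add: less_Suc_eq_le)
  qed
  then obtain T where T: "ptree nb T" "\<And>S. ptree nb S \<Longrightarrow> card S \<le> card T" by blast
  interpret maximal_tree V nb T by unfold_locales (use T in auto)
  show False by (rule contradiction)
qed

theorem forest_bound:
  assumes "subcubic_nbs V nb" "good nb"
  shows "\<exists>F\<subseteq>V. pforest nb F \<and> (\<Sum>v\<in>V. wt (card (nb v))) \<le> 6 * card F"
  using assms
proof (induction "card V" arbitrary: V nb rule: less_induct)
  case less
  interpret subcubic_nbs V nb by (rule less.prems(1))
  show ?case
  proof (rule ccontr)
    assume no: "\<not> ?case"
    interpret minimal_counterexample V nb
    proof unfold_locales
      show "good nb" by (rule less.prems(2))
      show "\<not> (\<exists>F\<subseteq>V. pforest nb F \<and> (\<Sum>v\<in>V. wt (card (nb v))) \<le> 6 * card F)" by (rule no)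
      fix X assume X: "X \<subseteq> V" "X \<noteq> {}" and g: "good (delete nb X)"
      have "card (V - X) < card V" by (rule psubset_card_mono[OF fin]) (use X in auto)
      from less.hyps[OF this delete_nbs[OF X(1)] g] obtain F where F: "F \<subseteq> V - X"
        "pforest (delete nb X) F" "(\<Sum>v\<in>V - X. wt (card (delete nb X v))) \<le> 6 * card F" by blast
      have "pforest nb F"
      proof (rule pforest_cong[OF F(2) _ F(1)])
        show "delete nb X v \<inter> (V - X) = (if v \<in> V - X then nb v \<inter> (V - X) else {})" for v
          using nb_outside[of v] by (auto simp: delete_def)
      qed
      moreover have "(\<Sum>v\<in>V - X. wt (card (nb v - X))) = (\<Sum>v\<in>V - X. wt (card (delete nb X v)))"
        by (intro sum.cong) (auto simp: delete_def)
      ultimately show "\<exists>F\<subseteq>V - X. pforest nb F \<and> (\<Sum>v\<in>V - X. wt (card (nb v - X))) \<le> 6 * card F"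
        using F by auto
    qed
    show False by (rule contradiction)
  qed
qed

section \<open>From neighbourhoods to graphs\<close>

definition nbs :: "'a ugraph \<Rightarrow> 'a \<Rightarrow> 'a set" where
  "nbs G v = {u. {u, v} \<in> edges G}"

lemma nbs_comm: "x \<in> nbs G y \<longleftrightarrow> {y, x} \<in> edges G"
  by (simp add: nbs_def insert_commute)

lemma card_nbs:
  assumes "simple_graph G"
  shows "card (nbs G v) = degree G v"
proof -
  have "{e \<in> edges G. v \<in> e} = (\<lambda>u. {u, v}) ` nbs G v"
  proof (intro set_eqI iffI)
    fix e assume e: "e \<in> {e \<in> edges G. v \<in> e}"
    then have "card e = 2" using assms by (auto simp: simple_graph_def)
    then obtain u where "e = {u, v}" using e by (auto simp: card_2_iff)
    then show "e \<in> (\<lambda>u. {u, v}) ` nbs G v" using e by (auto simp: nbs_def)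
  qed (auto simp: nbs_def)
  moreover have "inj_on (\<lambda>u. {u, v}) (nbs G v)" by (auto simp: inj_on_def doubleton_eq_iff)
  ultimately show ?thesis by (simp add: degree_def card_image)
qed

lemma subcubic_nbs_graph:
  assumes s: "simple_graph G" and "subcubic G"
  shows "subcubic_nbs (verts G) (nbs G)"
proof
  have e: "x \<in> verts G \<and> y \<in> verts G \<and> x \<noteq> y" if "{x, y} \<in> edges G" for x y
  proof -
    have "{x, y} \<subseteq> verts G \<and> card {x, y} = 2" using s that unfolding simple_graph_def by blast
    then show ?thesis by (cases "x = y") auto
  qed
  show "finite (verts G)" using s by (simp add: simple_graph_def)
  show "nbs G v \<subseteq> verts G" for v using e by (auto simp: nbs_def)
  show "y \<in> nbs G x" if "x \<in> nbs G y" for x y using that by (simp add: nbs_def insert_commute)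
  show "x \<notin> nbs G x" for x using e[of x x] by (auto simp: nbs_def)
  show "card (nbs G x) \<le> 3" for x
  proof (cases "x \<in> verts G")
    case True
    then show ?thesis using assms(2) card_nbs[OF s] by (simp add: subcubic_def)
  next
    case False
    then have "nbs G x = {}" using e by (auto simp: nbs_def)
    then show ?thesis by simp
  qed
qed

lemma connected_closed:
  assumes "connected_graph G" and S: "S \<subseteq> verts G" "S \<noteq> {}" "\<And>v. v \<in> S \<Longrightarrow> nbs G v \<subseteq> S"
  shows "verts G = S"
proof
  show "verts G \<subseteq> S"
  proof
    fix y assume y: "y \<in> verts G"
    obtain x where x: "x \<in> S" using S by blast
    then have "(x, y) \<in> {(x, y). {x, y} \<in> edges G}\<^sup>*"
      using assms(1) S(1) y unfolding connected_graph_def by blast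
    then show "y \<in> S"
    proof (induction rule: rtrancl_induct)
      case (step y z)
      then have "z \<in> nbs G y" by (simp add: nbs_comm)
      then show ?case using S(3) step.IH by blast
    qed (rule x)
  qed
qed (rule S(1))

lemma k4p_iso:
  assumes "simple_graph G" "connected_graph G" "subcubic G"
    and k: "k4p (nbs G) w a b c d" and w: "nbs G w = {a, b}"
  shows "graph_iso G K4_plus"
proof -
  interpret subcubic_nbs "verts G" "nbs G" by (rule subcubic_nbs_graph) fact+
  note K = k[unfolded k4p_def]
  have dist: "a \<noteq> b" "a \<noteq> c" "a \<noteq> d" "a \<noteq> w" "b \<noteq> c" "b \<noteq> d" "b \<noteq> w" "c \<noteq> d" "c \<noteq> w" "d \<noteq> w"
    using K by auto
  have n: "nbs G a = {w, c, d}" "nbs G b = {w, c, d}" "nbs G c = {a, b, d}" "nbs G d = {a, b, c}"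
    using K by auto
  have V: "verts G = {a, b, c, d, w}"
  proof (rule connected_closed[OF assms(2)])
    show "{a, b, c, d, w} \<subseteq> verts G"
      using nb_mem[of a w] nb_mem[of b w] nb_mem[of c a] nb_mem[of d a] w n by auto
    show "nbs G v \<subseteq> {a, b, c, d, w}" if "v \<in> {a, b, c, d, w}" for v
      using that n w by auto
  qed simp
  \<comment> \<open>In \<open>K4_plus\<close> the subdivided edge joins 0 and 1, and 4 is the new
    vertex; hence \<open>a\<close>, \<open>b\<close> and \<open>w\<close> go there.\<close>
  define f :: "'a \<Rightarrow> nat" where
    "f x = (if x = a then 0 else if x = b then 1 else if x = c then 2 else if x = d then 3 else 4)" for x
  have f: "f a = 0" "f b = 1" "f c = 2" "f d = 3" "f w = 4"
    using dist by (auto simp: f_def)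
  have "bij_betw f (verts G) (verts K4_plus)"
    unfolding V bij_betw_def
  proof
    show "inj_on f {a, b, c, d, w}" unfolding inj_on_def using f by simp
    show "f ` {a, b, c, d, w} = verts K4_plus"
      using f by (auto simp: K4_plus_def subdivide_edge_def complete_graph_def)
  qed
  moreover have "{x, y} \<in> edges G \<longleftrightarrow> {f x, f y} \<in> edges K4_plus"
    if "x \<in> verts G" "y \<in> verts G" for x y
  proof -
    have c2: "card {i, j} = 2 \<longleftrightarrow> i \<noteq> j" for i j :: nat by (cases "i = j") auto
    have e: "{i, j} \<in> edges K4_plus \<longleftrightarrow> {i, j} \<subseteq> {0, 1, 2, 3} \<and> i \<noteq> j \<and> {i, j} \<noteq> {0, 1}
        \<or> {i, j} = {0, 4} \<or> {i, j} = {4, 1}" for i j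
      unfolding K4_plus_def subdivide_edge_def complete_graph_def ugraph.simps
        Un_iff Diff_iff insert_iff[of "{i, j}"] empty_iff mem_Collect_eq c2
      by (simp only: conj_assoc simp_thms)
    have "x \<in> {a, b, c, d, w}" "y \<in> {a, b, c, d, w}" using that V by auto
    then show ?thesis unfolding nbs_comm[of _ G, symmetric] e
      by (elim insertE emptyE) (simp_all add: f n w dist dist[symmetric] doubleton_eq_iff)
  qed
  ultimately show ?thesis unfolding graph_iso_def by blast
qed

lemma k33_iso:
  assumes "simple_graph G" "connected_graph G" "subcubic G"
    and k: "k33 (nbs G) a b c x y z"
  shows "graph_iso G K33"
proof -
  interpret subcubic_nbs "verts G" "nbs G" by (rule subcubic_nbs_graph) fact+
  note K = k[unfolded k33_def]
  have dist: "a \<noteq> b" "a \<noteq> c" "a \<noteq> x" "a \<noteq> y" "a \<noteq> z" "b \<noteq> c" "b \<noteq> x" "b \<noteq> y" "b \<noteq> z"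
    "c \<noteq> x" "c \<noteq> y" "c \<noteq> z" "x \<noteq> y" "x \<noteq> z" "y \<noteq> z"
    using K by auto
  have n: "nbs G a = {x, y, z}" "nbs G b = {x, y, z}" "nbs G c = {x, y, z}"
    "nbs G x = {a, b, c}" "nbs G y = {a, b, c}" "nbs G z = {a, b, c}"
    using K by auto
  have V: "verts G = {a, b, c, x, y, z}"
  proof (rule connected_closed[OF assms(2)])
    show "{a, b, c, x, y, z} \<subseteq> verts G"
      using nb_mem[of a x] nb_mem[of b x] nb_mem[of c x] nb_mem[of x a] nb_mem[of y a] nb_mem[of z a] n
      by auto
    show "nbs G v \<subseteq> {a, b, c, x, y, z}" if "v \<in> {a, b, c, x, y, z}" for v
      using that n by auto
  qed simp
  define f :: "'a \<Rightarrow> nat" where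
    "f v = (if v = a then 0 else if v = b then 1 else if v = c then 2 else if v = x then 3
      else if v = y then 4 else 5)" for v
  have f: "f a = 0" "f b = 1" "f c = 2" "f x = 3" "f y = 4" "f z = 5"
    using dist by (auto simp: f_def)
  have "bij_betw f (verts G) (verts K33)"
    unfolding V bij_betw_def
  proof
    show "inj_on f {a, b, c, x, y, z}" unfolding inj_on_def using f by simp
    show "f ` {a, b, c, x, y, z} = verts K33"
      using f by (auto simp: K33_def complete_bipartite_graph_def)
  qed
  moreover have "{p, q} \<in> edges G \<longleftrightarrow> {f p, f q} \<in> edges K33"
    if "p \<in> verts G" "q \<in> verts G" for p q
  proof -
    have e: "{i, j} \<in> edges K33 \<longleftrightarrow> i \<in> {0, 1, 2} \<and> j \<in> {3, 4, 5} \<or> j \<in> {0, 1, 2} \<and> i \<in> {3, 4, 5}"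
      for i j :: nat
      unfolding K33_def complete_bipartite_graph_def ugraph.simps mem_Collect_eq doubleton_eq_iff
      by blast
    have "p \<in> {a, b, c, x, y, z}" "q \<in> {a, b, c, x, y, z}" using that V by auto
    then show ?thesis unfolding nbs_comm[of _ G, symmetric] e
      by (elim insertE emptyE) (simp_all add: f n dist dist[symmetric])
  qed
  ultimately show ?thesis unfolding graph_iso_def by blast
qed

lemma acyc_forest:
  assumes "simple_graph G" "subcubic G" "acyc (nbs G) F"
  shows "forest (induced_subgraph G F)"
  unfolding forest_def
proof
  interpret subcubic_nbs "verts G" "nbs G" by (rule subcubic_nbs_graph) fact+
  assume "\<exists>xs. is_cycle (induced_subgraph G F) xs"
  then obtain xs where n: "length xs \<ge> 3" "distinct xs"
    and e: "\<And>i. i < length xs \<Longrightarrow> {xs ! i, xs ! (Suc i mod length xs)} \<in> edges (induced_subgraph G F)"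
    unfolding is_cycle_def by blast
  have eG: "{xs ! i, xs ! (Suc i mod length xs)} \<in> edges G" "xs ! i \<in> F" if "i < length xs" for i
    using e[OF that] by (auto simp: induced_subgraph_def)
  have "set xs \<subseteq> F" using eG(2) by (auto simp: in_set_conv_nth)
  moreover have "set xs \<noteq> {}" using n by auto
  ultimately obtain a where a: "a \<in> set xs" "card (nbs G a \<inter> set xs) \<le> 1"
    using assms(3) unfolding acyc_def by blast
  then obtain i where i: "i < length xs" "a = xs ! i" by (auto simp: in_set_conv_nth)
  \<comment> \<open>\<open>j\<close> and \<open>k\<close> are the cyclic predecessor and successor
    of \<open>i\<close>. They differ because the cycle has length at least 3, so every vertex of a
    cycle has two neighbours on it.\<close>
  define j where "j = (if i = 0 then length xs - 1 else i - 1)"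
  define k where "k = Suc i mod length xs"
  have j: "j < length xs" "Suc j mod length xs = i" using i n by (auto simp: j_def)
  have k: "k < length xs" unfolding k_def using n(1) by (intro mod_less_divisor) linarith
  have "j \<noteq> k"
  proof (cases "Suc i = length xs")
    case True
    then show ?thesis using n by (auto simp: j_def k_def)
  next
    case False
    then have "k = Suc i" using i by (simp add: k_def)
    then show ?thesis using n i by (auto simp: j_def)
  qed
  then have "xs ! j \<noteq> xs ! k" using n j k by (simp add: nth_eq_iff_index_eq)
  moreover have "xs ! k \<in> nbs G a" using eG(1)[OF i(1)] i by (simp add: nbs_comm k_def)
  moreover have "xs ! j \<in> nbs G a" using eG(1)[OF j(1)] j i by (simp add: nbs_def)
  moreover have "xs ! j \<in> set xs" "xs ! k \<in> set xs" using j k by auto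
  ultimately have "2 \<le> card (nbs G a \<inter> set xs)"
    by (intro card_ge_subset[of _ "{xs ! j, xs ! k}"]) auto
  then show False using a by simp
qed

theorem theorem1:
  fixes G :: "'a ugraph"
  assumes "simple_graph G"
    and "connected_graph G"
    and "subcubic G"
    and "\<not> graph_iso G K4_plus"
    and "\<not> graph_iso G K33"
  shows "real (acyclic_matching_number G) \<ge> real (card (edges G)) / 6"
proof -
  interpret subcubic_nbs "verts G" "nbs G" by (rule subcubic_nbs_graph[OF assms(1,3)])
  have "good (nbs G)"
    unfolding good_def using k4p_iso[OF assms(1-3)] k33_iso[OF assms(1-3)] assms(4,5) by blast
  then obtain F where F: "F \<subseteq> verts G" "pforest (nbs G) F"
    "(\<Sum>v\<in>verts G. wt (card (nbs G v))) \<le> 6 * card F"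
    using forest_bound[OF subcubic_nbs_axioms] by blast
  obtain M where M: "finite M" "\<Union>M = F" "2 * card M = card F" "pairwise disjnt M"
    "\<forall>e\<in>M. \<exists>a b. e = {a, b} \<and> b \<in> nbs G a" using pforest_matching[OF F(2)] by blast
  have "M \<subseteq> edges G" using M(5) by (auto simp: nbs_comm)
  then have "matching G M"
    using M(4) unfolding matching_def pairwise_def disjnt_def by blast
  then have ac: "acyclic_matching G M"
    unfolding acyclic_matching_def M(2)
    using acyc_forest[OF assms(1,3) pforest_acyc[OF F(2)]] by simp
  have finE: "finite (edges G)"
  proof (rule finite_subset)
    show "edges G \<subseteq> Pow (verts G)" using assms(1) by (auto simp: simple_graph_def)
  qed (simp add: fin)
  have "finite {card M | M. acyclic_matching G M}"
  proof (rule finite_subset)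
    show "{card M | M. acyclic_matching G M} \<subseteq> card ` Pow (edges G)"
      by (auto simp: acyclic_matching_def matching_def)
  qed (simp add: finE)
  then have le: "card M \<le> acyclic_matching_number G"
    unfolding acyclic_matching_number_def using ac by (intro Max_ge) auto
  have "(\<Sum>v\<in>verts G. card {e \<in> edges G. v \<in> e}) = 2 * card (edges G)"
  proof (rule sum_multicount)
    show "\<forall>e\<in>edges G. card {v \<in> verts G. v \<in> e} = 2"
    proof
      fix e assume "e \<in> edges G"
      then have "e \<subseteq> verts G" "card e = 2" using assms(1) by (auto simp: simple_graph_def)
      moreover from this have "{v \<in> verts G. v \<in> e} = e" by blast
      ultimately show "card {v \<in> verts G. v \<in> e} = 2" by simp
    qed
  qed (use fin finE in auto)
  then have "2 * card (edges G) = (\<Sum>v\<in>verts G. card (nbs G v))"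
    by (simp add: card_nbs[OF assms(1)] degree_def)
  \<comment> \<open>The bonus for leaves served only the induction and is dropped here: 2m \<le>
    6|F| = 12|M|.\<close>
  also have "\<dots> \<le> (\<Sum>v\<in>verts G. wt (card (nbs G v)))"
    by (intro sum_mono) (simp add: wt_def)
  finally have "card (edges G) \<le> 6 * card M" using F(3) M(3) by linarith
  then show ?thesis using le by simp
qed

end
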